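(* Let $G$ be a locally compact Hausdorff étale groupoid and let $\Sigma\to G$ be a twist. Suppose that $G$ is exact and that $U\subseteq G^{(0)}$ is a regular invariant open set. Then $C^*_r(\Sigma_U;G_U)$ is a regular ideal in $C^*_r(\Sigma;G)$. If, in addition, $C_0(G^{(0)})$ has the regular ideal intersection property in $C^*_r(\Sigma;G)$, then every regular ideal of $C^*_r(\Sigma;G)$ is of this form, i.e. equals $C^*_r(\Sigma_V;G_V)$ for some regular invariant open set $V\subseteq G^{(0)}$.
   Context: Twists. $G$ is a groupoid with unit space $G^{(0)}$ and range and source maps $r,s$, with a locally compact Hausdorff topology making the operations continuous; $G$ is étale if it has a basis of open bisections (open sets on which $r$ and $s$ are homeomorphisms onto their images). A twist over $G$ is a central extension of locally compact Hausdorff groupoids $G^{(0)}\times\mathbb{T}\xrightarrow{\iota}\Sigma\xrightarrow{q}G$: $\iota$ is a groupoid homomorphism that is a homeomorphism onto $q^{-1}(G^{(0)})$, $q$ is a continuous open surjective groupoid homomorphism restricting to a homeomorphism $\Sigma^{(0)}\to G^{(0)}$ (used to identify these), and $\iota(r(\sigma),z)\sigma=\sigma\iota(s(\sigma),z)=:z\sigma$. Reduced $C^*$-algebra. $C_c(\Sigma;G)$ is the set of continuous compactly supported $f\colon\Sigma\to\mathbb{C}$ with $f(z\sigma)=zf(\sigma)$ for $z\in\mathbb T$, with $(f*g)(\sigma)=\sum_{\gamma\in G,\,r(\gamma)=r(\sigma)}f(\tilde\gamma)g(\tilde\gamma^{-1}\sigma)$ ($\tilde\gamma$ any lift of $\gamma$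 to $\Sigma$) and $f^*(\sigma)=\overline{f(\sigma^{-1})}$. For $x\in G^{(0)}$ let $\mathcal H_x$ be the Hilbert space of functions $\xi\colon s^{-1}(x)\subseteq\Sigma\to\mathbb{C}$ with $\xi(z\sigma)=z\xi(\sigma)$ and $\sum_{\gamma\in G,\,s(\gamma)=x}|\xi(\tilde\gamma)|^2<\infty$; $C_c(\Sigma;G)$ acts on $\mathcal H_x$ by the same convolution formula, giving $\pi_x$. $C^*_r(\Sigma;G)$ is the completion of $C_c(\Sigma;G)$ in the norm $\sup_x\|\pi_x(f)\|$. $C_0(G^{(0)})$ is regarded as a subalgebra by sending $h\in C_c(G^{(0)})$ to the function supported on $q^{-1}(G^{(0)})$ with value $zh(x)$ at $\iota(x,z)$. Restrictions. A set $\Delta\subseteq G^{(0)}$ is invariant if $s(\gamma)\in\Delta$ implies $r(\gamma)\in\Delta$; then $G_\Delta=\{\gamma\in G: r(\gamma),s(\gamma)\in\Delta\}$ and $\Sigma_\Delta=q^{-1}(G_\Delta)$. For $U$ open invariant, $C^*_r(\Sigma_U;G_U)$ embeds (extension by zero) as an ideal of $C^*_r(\Sigma;G)$, namely the ideal generated by $C_0(U)$. For $F=G^{(0)}\setminus U$, restriction of functions $f\mapsto f|_{\Sigma_F}$ extends to a surjective $*$-homomorphism $\phi\colon C^*_r(\Sigma;G)\to C^*_r(\Sigma_F;G_F)$. $G$ is (inner) exact if for every open invariant $U\subseteq G^{(0)}$ the sequence $C^*_r(\Sigma_U;G_U)\to C^*_r(\Sigma;G)\xrightarrow{\phi} C^*_r(\Sigma_F;G_F)$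 is exact in the middle (it is known that this does not depend on the twist over $G$). Regularity. An open set is regular if it equals the interior of its closure. Ideals are closed and two-sided; for $X\subseteq A$, $X^\perp=\{a\in A: ax=xa=0\ \forall x\in X\}$, and an ideal $J$ of $A$ is regular if $J=J^{\perp\perp}$. $B$ has the regular ideal intersection property in $A$ if $J\cap B\ne\{0\}$ for every non-zero regular ideal $J$ of $A$. *)

theory Defs
  imports "HOL-Analysis.Analysis" "HOL-Library.Function_Algebras"
begin

section \<open>Topological groupoids\<close>

text \<open>The set of arrows is the carrier of the topology. Units are identified with identity arrows,
  so range and source take values in the arrows.\<close>

record 'g groupoid =
  gtop :: "'g topology"
  rng :: "'g \<Rightarrow> 'g"
  src :: "'g \<Rightarrow> 'g"
  gmul :: "'g \<Rightarrow> 'g \<Rightarrow> 'g"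
  ginv :: "'g \<Rightarrow> 'g"

abbreviation arr :: "('g, 'm) groupoid_scheme \<Rightarrow> 'g set" where
  "arr G \<equiv> topspace (gtop G)"

definition units :: "('g, 'm) groupoid_scheme \<Rightarrow> 'g set" where
  "units G = rng G ` arr G"

definition unit_top :: "('g, 'm) groupoid_scheme \<Rightarrow> 'g topology" where
  "unit_top G = subtopology (gtop G) (units G)"

definition algebraic_groupoid :: "('g, 'm) groupoid_scheme \<Rightarrow> bool" where
  "algebraic_groupoid G \<longleftrightarrow>
     (\<forall>a\<in>arr G. rng G a \<in> arr G \<and> src G a \<in> arr G \<and>
        rng G (rng G a) = rng G a \<and> src G (rng G a) = rng G a \<and>
        rng G (src G a) = src G a \<and> src G (src G a) = src G a) \<and>
     (\<forall>a\<in>arr G. \<forall>b\<in>arr G. src G a = rng G b \<longrightarrow>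
        gmul G a b \<in> arr G \<and> rng G (gmul G a b) = rng G a \<and> src G (gmul G a b) = src G b) \<and>
     (\<forall>a\<in>arr G. \<forall>b\<in>arr G. \<forall>c\<in>arr G. src G a = rng G b \<longrightarrow> src G b = rng G c \<longrightarrow>
        gmul G (gmul G a b) c = gmul G a (gmul G b c)) \<and>
     (\<forall>a\<in>arr G. gmul G (rng G a) a = a \<and> gmul G a (src G a) = a) \<and>
     (\<forall>a\<in>arr G. ginv G a \<in> arr G \<and> rng G (ginv G a) = src G a \<and> src G (ginv G a) = rng G a \<and>
        gmul G a (ginv G a) = rng G a \<and> gmul G (ginv G a) a = src G a)"

definition lch_groupoid :: "('g, 'm) groupoid_scheme \<Rightarrow> bool" where
  "lch_groupoid G \<longleftrightarrow>
     algebraic_groupoid G \<and>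
     locally_compact_space (gtop G) \<and> Hausdorff_space (gtop G) \<and>
     continuous_map (gtop G) (gtop G) (rng G) \<and>
     continuous_map (gtop G) (gtop G) (src G) \<and>
     continuous_map (gtop G) (gtop G) (ginv G) \<and>
     continuous_map
       (subtopology (prod_topology (gtop G) (gtop G)) {(a, b). src G a = rng G b})
       (gtop G) (\<lambda>(a, b). gmul G a b)"

text \<open>The images of an open bisection are required to be open in the unit space. Without this,
  the group bundle over \<open>[0,1]\<close> with fibre of order two at \<open>0\<close> and trivial fibres elsewhere,
  topologised so that the non-unit at \<open>0\<close> is isolated, would count as etale, although its
  compactly supported continuous functions are not closed under convolution.\<close>

definition open_bisection :: "('g, 'm) groupoid_scheme \<Rightarrow> 'g set \<Rightarrow> bool" where
  "open_bisection G B \<longleftrightarrow>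
     openin (gtop G) B \<and>
     openin (unit_top G) (rng G ` B) \<and>
     homeomorphic_map (subtopology (gtop G) B) (subtopology (gtop G) (rng G ` B)) (rng G) \<and>
     openin (unit_top G) (src G ` B) \<and>
     homeomorphic_map (subtopology (gtop G) B) (subtopology (gtop G) (src G ` B)) (src G)"

definition etale_groupoid :: "('g, 'm) groupoid_scheme \<Rightarrow> bool" where
  "etale_groupoid G \<longleftrightarrow>
     lch_groupoid G \<and>
     (\<forall>W a. openin (gtop G) W \<and> a \<in> W \<longrightarrow> (\<exists>B. open_bisection G B \<and> a \<in> B \<and> B \<subseteq> W))"

definition groupoid_hom ::
  "('a, 'm) groupoid_scheme \<Rightarrow> ('b, 'n) groupoid_scheme \<Rightarrow> ('a \<Rightarrow> 'b) \<Rightarrow> bool" where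
  "groupoid_hom A B h \<longleftrightarrow>
     (\<forall>a\<in>arr A. h a \<in> arr B \<and> rng B (h a) = h (rng A a) \<and> src B (h a) = h (src A a)) \<and>
     (\<forall>a\<in>arr A. \<forall>b\<in>arr A. src A a = rng A b \<longrightarrow> h (gmul A a b) = gmul B (h a) (h b))"

definition invariant :: "('g, 'm) groupoid_scheme \<Rightarrow> 'g set \<Rightarrow> bool" where
  "invariant G D \<longleftrightarrow> D \<subseteq> units G \<and> (\<forall>a\<in>arr G. src G a \<in> D \<longrightarrow> rng G a \<in> D)"

definition open_invariant :: "('g, 'm) groupoid_scheme \<Rightarrow> 'g set \<Rightarrow> bool" where
  "open_invariant G U \<longleftrightarrow> openin (unit_top G) U \<and> invariant G U"

definition regular_open :: "'a topology \<Rightarrow> 'a set \<Rightarrow> bool" where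
  "regular_open X U \<longleftrightarrow> openin X U \<and> U = X interior_of (X closure_of U)"

definition restrict_groupoid :: "('g, 'm) groupoid_scheme \<Rightarrow> 'g set \<Rightarrow> ('g, 'm) groupoid_scheme" where
  "restrict_groupoid G D =
     G\<lparr>gtop := subtopology (gtop G) {a \<in> arr G. rng G a \<in> D \<and> src G a \<in> D}\<rparr>"

section \<open>Twists\<close>

text \<open>The trivial bundle with fibre the circle group over the unit space of \<open>G\<close>.\<close>

definition circle_bundle :: "('g, 'm) groupoid_scheme \<Rightarrow> ('g \<times> complex) groupoid" where
  "circle_bundle G =
     \<lparr>gtop = prod_topology (unit_top G) (top_of_set (sphere 0 1)),
      rng = (\<lambda>(x, z). (x, 1)),
      src = (\<lambda>(x, z). (x, 1)),
      gmul = (\<lambda>(x, z) (y, w). (x, z * w)),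
      ginv = (\<lambda>(x, z). (x, inverse z))\<rparr>"

record ('s, 'g) twist = "'s groupoid" +
  incl :: "'g \<times> complex \<Rightarrow> 's"
  proj :: "'s \<Rightarrow> 'g"

text \<open>The equation \<open>proj \<Sigma> (incl \<Sigma> (x, z)) = x\<close> says that \<open>incl\<close> is compatible with the
  identification of the unit spaces by \<open>proj\<close>; it is what makes the two products in the
  centrality condition composable.\<close>

definition is_twist :: "('s, 'g) twist \<Rightarrow> ('g, 'm) groupoid_scheme \<Rightarrow> bool" where
  "is_twist \<Sigma> G \<longleftrightarrow>
     lch_groupoid \<Sigma> \<and> lch_groupoid G \<and>
     groupoid_hom (circle_bundle G) \<Sigma> (incl \<Sigma>) \<and>
     homeomorphic_map (gtop (circle_bundle G))
       (subtopology (gtop \<Sigma>) {\<sigma> \<in> arr \<Sigma>. proj \<Sigma> \<sigma> \<in> units G}) (incl \<Sigma>) \<and>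
     groupoid_hom \<Sigma> G (proj \<Sigma>) \<and>
     continuous_map (gtop \<Sigma>) (gtop G) (proj \<Sigma>) \<and>
     open_map (gtop \<Sigma>) (gtop G) (proj \<Sigma>) \<and>
     proj \<Sigma> ` arr \<Sigma> = arr G \<and>
     homeomorphic_map (unit_top \<Sigma>) (unit_top G) (proj \<Sigma>) \<and>
     (\<forall>x\<in>units G. \<forall>z\<in>sphere 0 1. proj \<Sigma> (incl \<Sigma> (x, z)) = x) \<and>
     (\<forall>\<sigma>\<in>arr \<Sigma>. \<forall>z\<in>sphere 0 1.
        gmul \<Sigma> (incl \<Sigma> (proj \<Sigma> (rng \<Sigma> \<sigma>), z)) \<sigma> = gmul \<Sigma> \<sigma> (incl \<Sigma> (proj \<Sigma> (src \<Sigma> \<sigma>), z)))"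

definition circle_act :: "('s, 'g) twist \<Rightarrow> complex \<Rightarrow> 's \<Rightarrow> 's" where
  "circle_act \<Sigma> z \<sigma> = gmul \<Sigma> (incl \<Sigma> (proj \<Sigma> (rng \<Sigma> \<sigma>), z)) \<sigma>"

definition lift :: "('s, 'g) twist \<Rightarrow> 'g \<Rightarrow> 's" where
  "lift \<Sigma> \<gamma> = (SOME \<sigma>. \<sigma> \<in> arr \<Sigma> \<and> proj \<Sigma> \<sigma> = \<gamma>)"

definition restrict_twist :: "('s, 'g) twist \<Rightarrow> ('g, 'm) groupoid_scheme \<Rightarrow> 'g set \<Rightarrow> ('s, 'g) twist" where
  "restrict_twist \<Sigma> G D =
     \<Sigma>\<lparr>gtop := subtopology (gtop \<Sigma>) {\<sigma> \<in> arr \<Sigma>. proj \<Sigma> \<sigma> \<in> arr (restrict_groupoid G D)}\<rparr>"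

section \<open>The reduced C*-algebra\<close>

text \<open>Functions on a subset of the type \<open>'s\<close> are encoded as total functions that vanish outside
  that subset.\<close>

definition compactly_supported :: "'a topology \<Rightarrow> ('a \<Rightarrow> complex) \<Rightarrow> bool" where
  "compactly_supported X f \<longleftrightarrow>
     continuous_map X euclidean f \<and> (\<forall>x. x \<notin> topspace X \<longrightarrow> f x = 0) \<and>
     compactin X (X closure_of {x \<in> topspace X. f x \<noteq> 0})"

definition Cc :: "('s, 'g) twist \<Rightarrow> ('s \<Rightarrow> complex) set" where
  "Cc \<Sigma> = {f. compactly_supported (gtop \<Sigma>) f \<and>
     (\<forall>\<sigma>\<in>arr \<Sigma>. \<forall>z\<in>sphere 0 1. f (circle_act \<Sigma> z \<sigma>) = z * f \<sigma>)}"

text \<open>On the functions considered here the sum below has finite support.\<close>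

definition conv ::
  "('s, 'g) twist \<Rightarrow> ('g, 'm) groupoid_scheme \<Rightarrow> ('s \<Rightarrow> complex) \<Rightarrow> ('s \<Rightarrow> complex) \<Rightarrow> 's \<Rightarrow> complex" where
  "conv \<Sigma> G f g \<sigma> =
     (\<Sum>\<^sub>\<infinity>\<gamma>\<in>{\<gamma> \<in> arr G. rng G \<gamma> = proj \<Sigma> (rng \<Sigma> \<sigma>)}.
        f (lift \<Sigma> \<gamma>) * g (gmul \<Sigma> (ginv \<Sigma> (lift \<Sigma> \<gamma>)) \<sigma>))"

definition src_fibre :: "('s, 'g) twist \<Rightarrow> 'g \<Rightarrow> 's set" where
  "src_fibre \<Sigma> x = {\<sigma> \<in> arr \<Sigma>. proj \<Sigma> (src \<Sigma> \<sigma>) = x}"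

definition Hx :: "('s, 'g) twist \<Rightarrow> ('g, 'm) groupoid_scheme \<Rightarrow> 'g \<Rightarrow> ('s \<Rightarrow> complex) set" where
  "Hx \<Sigma> G x = {\<xi>.
     (\<forall>\<sigma>. \<sigma> \<notin> src_fibre \<Sigma> x \<longrightarrow> \<xi> \<sigma> = 0) \<and>
     (\<forall>\<sigma>\<in>src_fibre \<Sigma> x. \<forall>z\<in>sphere 0 1. \<xi> (circle_act \<Sigma> z \<sigma>) = z * \<xi> \<sigma>) \<and>
     (\<lambda>\<gamma>. (cmod (\<xi> (lift \<Sigma> \<gamma>)))\<^sup>2) summable_on {\<gamma> \<in> arr G. src G \<gamma> = x}}"

definition Hx_norm ::
  "('s, 'g) twist \<Rightarrow> ('g, 'm) groupoid_scheme \<Rightarrow> 'g \<Rightarrow> ('s \<Rightarrow> complex) \<Rightarrow> real" where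
  "Hx_norm \<Sigma> G x \<xi> = sqrt (\<Sum>\<^sub>\<infinity>\<gamma>\<in>{\<gamma> \<in> arr G. src G \<gamma> = x}. (cmod (\<xi> (lift \<Sigma> \<gamma>)))\<^sup>2)"

type_synonym 's operator = "('s \<Rightarrow> complex) \<Rightarrow> ('s \<Rightarrow> complex)"

definition op_norm ::
  "('s, 'g) twist \<Rightarrow> ('g, 'm) groupoid_scheme \<Rightarrow> 'g \<Rightarrow> 's operator \<Rightarrow> ennreal" where
  "op_norm \<Sigma> G x T =
     (SUP \<xi>\<in>{\<xi> \<in> Hx \<Sigma> G x. Hx_norm \<Sigma> G x \<xi> \<le> 1}. ennreal (Hx_norm \<Sigma> G x (T \<xi>)))"

text \<open>Bounded operators on \<open>Hx \<Sigma> G x\<close>; outside that space they take the junk value \<open>0\<close>.\<close>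

definition bounded_ops ::
  "('s, 'g) twist \<Rightarrow> ('g, 'm) groupoid_scheme \<Rightarrow> 'g \<Rightarrow> 's operator set" where
  "bounded_ops \<Sigma> G x = {T.
     (\<forall>\<xi>\<in>Hx \<Sigma> G x. T \<xi> \<in> Hx \<Sigma> G x) \<and>
     (\<forall>\<xi>\<in>Hx \<Sigma> G x. \<forall>\<eta>\<in>Hx \<Sigma> G x. T (\<xi> + \<eta>) = T \<xi> + T \<eta>) \<and>
     (\<forall>c. \<forall>\<xi>\<in>Hx \<Sigma> G x. T (\<lambda>\<sigma>. c * \<xi> \<sigma>) = (\<lambda>\<sigma>. c * T \<xi> \<sigma>)) \<and>
     (\<forall>\<xi>. \<xi> \<notin> Hx \<Sigma> G x \<longrightarrow> T \<xi> = 0) \<and>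
     op_norm \<Sigma> G x T < \<infinity>}"

text \<open>The sup-normed product of the algebras of bounded operators on the spaces \<open>Hx\<close>, in which
  \<open>fam_norm\<close> is the norm and \<open>fam_mult\<close> the product. Addition, difference and zero of families
  are those of function spaces.\<close>

type_synonym ('s, 'g) op_family = "'g \<Rightarrow> 's operator"

definition fam_norm ::
  "('s, 'g) twist \<Rightarrow> ('g, 'm) groupoid_scheme \<Rightarrow> ('s, 'g) op_family \<Rightarrow> ennreal" where
  "fam_norm \<Sigma> G a = (SUP x\<in>units G. op_norm \<Sigma> G x (a x))"

definition fam_mult :: "('s, 'g) op_family \<Rightarrow> ('s, 'g) op_family \<Rightarrow> ('s, 'g) op_family" where
  "fam_mult a b = (\<lambda>x. a x \<circ> b x)"

definition fam_scale :: "complex \<Rightarrow> ('s, 'g) op_family \<Rightarrow> ('s, 'g) op_family" where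
  "fam_scale c a = (\<lambda>x \<xi> \<sigma>. c * a x \<xi> \<sigma>)"

definition op_families ::
  "('s, 'g) twist \<Rightarrow> ('g, 'm) groupoid_scheme \<Rightarrow> ('s, 'g) op_family set" where
  "op_families \<Sigma> G = {a.
     (\<forall>x\<in>units G. a x \<in> bounded_ops \<Sigma> G x) \<and> (\<forall>x. x \<notin> units G \<longrightarrow> a x = 0) \<and>
     fam_norm \<Sigma> G a < \<infinity>}"

definition norm_closure ::
  "('s, 'g) twist \<Rightarrow> ('g, 'm) groupoid_scheme \<Rightarrow>
    ('s, 'g) op_family set \<Rightarrow> ('s, 'g) op_family set \<Rightarrow> ('s, 'g) op_family set" where
  "norm_closure \<Sigma> G A S = {a \<in> A. \<forall>e>0. \<exists>b\<in>S. fam_norm \<Sigma> G (a - b) < e}"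

text \<open>The family of the operators \<open>\<pi>\<^sub>x(f)\<close>.\<close>

definition reg_rep ::
  "('s, 'g) twist \<Rightarrow> ('g, 'm) groupoid_scheme \<Rightarrow> ('s \<Rightarrow> complex) \<Rightarrow> ('s, 'g) op_family" where
  "reg_rep \<Sigma> G f = (\<lambda>x \<xi> \<sigma>.
     if x \<in> units G \<and> \<xi> \<in> Hx \<Sigma> G x \<and> \<sigma> \<in> src_fibre \<Sigma> x then conv \<Sigma> G f \<xi> \<sigma> else 0)"

text \<open>The completion of \<open>Cc \<Sigma>\<close> in the norm \<open>f \<mapsto> sup\<^sub>x \<parallel>\<pi>\<^sub>x(f)\<parallel>\<close>, that is
  \<open>fam_norm \<Sigma> G (reg_rep \<Sigma> G f)\<close>, realised as the closure of the isometric copy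
  \<open>reg_rep \<Sigma> G ` Cc \<Sigma>\<close> in the complete normed algebra \<open>op_families \<Sigma> G\<close>.\<close>

definition Cr ::
  "('s, 'g) twist \<Rightarrow> ('g, 'm) groupoid_scheme \<Rightarrow> ('s, 'g) op_family set" where
  "Cr \<Sigma> G = norm_closure \<Sigma> G (op_families \<Sigma> G) (reg_rep \<Sigma> G ` Cc \<Sigma>)"

text \<open>The function of a twist given by a function \<open>h\<close> on the unit space: it is supported on the
  image of \<open>incl\<close> and takes the value \<open>z * h x\<close> at \<open>incl \<Sigma> (x, z)\<close>.\<close>

definition diag_fun ::
  "('s, 'g) twist \<Rightarrow> ('g, 'm) groupoid_scheme \<Rightarrow> ('g \<Rightarrow> complex) \<Rightarrow> 's \<Rightarrow> complex" where
  "diag_fun \<Sigma> G h \<sigma> =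
     (if \<sigma> \<in> incl \<Sigma> ` arr (circle_bundle G)
      then (case inv_into (arr (circle_bundle G)) (incl \<Sigma>) \<sigma> of (x, z) \<Rightarrow> z * h x)
      else 0)"

text \<open>The copy of \<open>C\<^sub>0\<close> of the unit space in the reduced C*-algebra.\<close>

definition C0_units ::
  "('s, 'g) twist \<Rightarrow> ('g, 'm) groupoid_scheme \<Rightarrow> ('s, 'g) op_family set" where
  "C0_units \<Sigma> G = norm_closure \<Sigma> G (Cr \<Sigma> G)
     (reg_rep \<Sigma> G ` diag_fun \<Sigma> G ` {h. compactly_supported (unit_top G) h})"

section \<open>Restrictions and exactness\<close>

text \<open>The continuous extension to reduced C*-algebras of a map \<open>h\<close> between the dense
  subalgebras \<open>Cc\<close>.\<close>

definition extend_to_Cr ::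
  "('s, 'g) twist \<Rightarrow> ('g, 'm) groupoid_scheme \<Rightarrow> ('s, 'g) twist \<Rightarrow> ('g, 'm) groupoid_scheme \<Rightarrow>
    (('s \<Rightarrow> complex) \<Rightarrow> 's \<Rightarrow> complex) \<Rightarrow> ('s, 'g) op_family \<Rightarrow> ('s, 'g) op_family" where
  "extend_to_Cr \<Sigma> G \<Sigma>' G' h a =
     (THE b. b \<in> Cr \<Sigma>' G' \<and>
        (\<forall>f. (\<forall>n::nat. f n \<in> Cc \<Sigma>) \<and>
             (\<lambda>n. fam_norm \<Sigma> G (reg_rep \<Sigma> G (f n) - a)) \<longlonglongrightarrow> 0 \<longrightarrow>
             (\<lambda>n. fam_norm \<Sigma>' G' (reg_rep \<Sigma>' G' (h (f n)) - b)) \<longlonglongrightarrow> 0))"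

definition zero_outside :: "'a set \<Rightarrow> ('a \<Rightarrow> complex) \<Rightarrow> 'a \<Rightarrow> complex" where
  "zero_outside S f = (\<lambda>x. if x \<in> S then f x else 0)"

text \<open>Both extension by zero from \<open>\<Sigma>\<^sub>U\<close> to \<open>\<Sigma>\<close> and restriction from \<open>\<Sigma>\<close> to \<open>\<Sigma>\<^sub>F\<close> are given
  by \<open>zero_outside\<close>, since functions vanish outside their domain.\<close>

definition Cr_embed ::
  "('s, 'g) twist \<Rightarrow> ('g, 'm) groupoid_scheme \<Rightarrow> 'g set \<Rightarrow> ('s, 'g) op_family \<Rightarrow> ('s, 'g) op_family" where
  "Cr_embed \<Sigma> G U =
     extend_to_Cr (restrict_twist \<Sigma> G U) (restrict_groupoid G U) \<Sigma> G
       (zero_outside (arr (restrict_twist \<Sigma> G U)))"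

definition Cr_restrict ::
  "('s, 'g) twist \<Rightarrow> ('g, 'm) groupoid_scheme \<Rightarrow> 'g set \<Rightarrow> ('s, 'g) op_family \<Rightarrow> ('s, 'g) op_family" where
  "Cr_restrict \<Sigma> G F =
     extend_to_Cr \<Sigma> G (restrict_twist \<Sigma> G F) (restrict_groupoid G F)
       (zero_outside (arr (restrict_twist \<Sigma> G F)))"

text \<open>The algebra \<open>Cr\<close> of the restriction to an open invariant set, as a subset of \<open>Cr \<Sigma> G\<close>.\<close>

definition Cr_sub ::
  "('s, 'g) twist \<Rightarrow> ('g, 'm) groupoid_scheme \<Rightarrow> 'g set \<Rightarrow> ('s, 'g) op_family set" where
  "Cr_sub \<Sigma> G U = Cr_embed \<Sigma> G U ` Cr (restrict_twist \<Sigma> G U) (restrict_groupoid G U)"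

text \<open>Inner exactness of \<open>G\<close>, tested on the given twist; it is known that the choice of the twist
  over \<open>G\<close> does not matter.\<close>

definition exact_groupoid :: "('s, 'g) twist \<Rightarrow> ('g, 'm) groupoid_scheme \<Rightarrow> bool" where
  "exact_groupoid \<Sigma> G \<longleftrightarrow>
     (\<forall>U. open_invariant G U \<longrightarrow>
        {a \<in> Cr \<Sigma> G. Cr_restrict \<Sigma> G (units G - U) a = 0} = Cr_sub \<Sigma> G U)"

section \<open>Regular ideals\<close>

definition closed_ideal ::
  "('s, 'g) twist \<Rightarrow> ('g, 'm) groupoid_scheme \<Rightarrow> ('s, 'g) op_family set \<Rightarrow> bool" where
  "closed_ideal \<Sigma> G J \<longleftrightarrow>
     J \<subseteq> Cr \<Sigma> G \<and> 0 \<in> J \<and>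
     (\<forall>a\<in>J. \<forall>b\<in>J. a + b \<in> J) \<and>
     (\<forall>c. \<forall>a\<in>J. fam_scale c a \<in> J) \<and>
     (\<forall>a\<in>J. \<forall>b\<in>Cr \<Sigma> G. fam_mult a b \<in> J \<and> fam_mult b a \<in> J) \<and>
     norm_closure \<Sigma> G (Cr \<Sigma> G) J \<subseteq> J"

definition annihilator ::
  "('s, 'g) twist \<Rightarrow> ('g, 'm) groupoid_scheme \<Rightarrow> ('s, 'g) op_family set \<Rightarrow> ('s, 'g) op_family set" where
  "annihilator \<Sigma> G X = {a \<in> Cr \<Sigma> G. \<forall>x\<in>X. fam_mult a x = 0 \<and> fam_mult x a = 0}"

definition regular_ideal ::
  "('s, 'g) twist \<Rightarrow> ('g, 'm) groupoid_scheme \<Rightarrow> ('s, 'g) op_family set \<Rightarrow> bool" where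
  "regular_ideal \<Sigma> G J \<longleftrightarrow>
     closed_ideal \<Sigma> G J \<and> J = annihilator \<Sigma> G (annihilator \<Sigma> G J)"

definition regular_ideal_intersection_property ::
  "('s, 'g) twist \<Rightarrow> ('g, 'm) groupoid_scheme \<Rightarrow> ('s, 'g) op_family set \<Rightarrow> bool" where
  "regular_ideal_intersection_property \<Sigma> G B \<longleftrightarrow>
     (\<forall>J. regular_ideal \<Sigma> G J \<and> J \<noteq> {0} \<longrightarrow> J \<inter> B \<noteq> {0})"

end

(* By exactness, Cr_sub U consists of the elements whose fibre operators vanish at every unit
   outside U. An element a of the reduced algebra is determined by the continuous function
   s |-> (a_x delta_x)(s) on the twist, where x is the source of s: one has
   (a_x delta_t)(r) = the value of this function at r t^-1. As the source map is open, the set of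
   units x with a_x nonzero is open and invariant. With functions on the unit space as multipliers,
   this shows that the annihilator of the ideal J(W) of elements supported in an open invariant W
   is J(int(W^c)), and the double annihilator of J(U) is J(int(cl U)).

   Conversely let J be a regular ideal, K its annihilator, W the union of the supports of the
   elements of K and V = int(W^c). Then J(V) is contained in J. If some element of J were not supported
   off W, then the intersection of J and J(int(cl W)) would be a nonzero regular ideal, hence would contain a
   nonzero c in C_0. At some unit x in W one has c_x delta_x = h delta_x with a scalar h nonzero, while
   kc = 0 for k in K. So k_x delta_x = 0 for all k in K, and replacing k by k f with f supported over
   a bisection gives k_x delta_t = 0 for all t with source x, that is k_x = 0 for all k in K,
   which contradicts x in W. *)

theory Submission
  imports Defs
begin

text \<open>The intersection property tests regular ideals only, and J(W) is not known to be
  regular; this forces the detour through int(cl W). The element c found there may live off W. The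
  set of units where its diagonal value is nonzero is open and meets cl W, hence meets W, and this
  supplies the unit x.

  The functions f enter because the scalar action of c controls a single vector, the point mass at
  the unit of the twist over x. A function supported over a bisection maps it to a multiple of one
  other point mass, and K absorbs right factors, so every point mass of the fibre is reached; their
  span is dense in the fibre Hilbert space.

  The kernel in the exactness condition becomes explicit through a literal coincidence: at a unit of
  an invariant set F the fibre Hilbert space of the restricted twist is the original one, so
  restriction to F merely forgets the operators at the other units. Interiors appear since supports
  are open: the annihilator of J(W) consists of the elements supported in W^c, and the interior of
  W^c carries the same ideal.\<close>

section \<open>Groupoids and twists\<close>

locale alg_groupoid =
  fixes G :: "('g, 'm) groupoid_scheme"
  assumes alg: "algebraic_groupoid G"
begin

lemma rng_arr [simp]: "a \<in> arr G \<Longrightarrow> rng G a \<in> arr G"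
  and src_arr [simp]: "a \<in> arr G \<Longrightarrow> src G a \<in> arr G"
  and rng_rng [simp]: "a \<in> arr G \<Longrightarrow> rng G (rng G a) = rng G a"
  and src_rng [simp]: "a \<in> arr G \<Longrightarrow> src G (rng G a) = rng G a"
  and rng_src [simp]: "a \<in> arr G \<Longrightarrow> rng G (src G a) = src G a"
  and src_src [simp]: "a \<in> arr G \<Longrightarrow> src G (src G a) = src G a"
  and rng_gmul_id [simp]: "a \<in> arr G \<Longrightarrow> gmul G (rng G a) a = a"
  and gmul_src_id [simp]: "a \<in> arr G \<Longrightarrow> gmul G a (src G a) = a"
  and ginv_arr [simp]: "a \<in> arr G \<Longrightarrow> ginv G a \<in> arr G"
  and rng_ginv [simp]: "a \<in> arr G \<Longrightarrow> rng G (ginv G a) = src G a"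
  and src_ginv [simp]: "a \<in> arr G \<Longrightarrow> src G (ginv G a) = rng G a"
  and gmul_ginv [simp]: "a \<in> arr G \<Longrightarrow> gmul G a (ginv G a) = rng G a"
  and ginv_gmul [simp]: "a \<in> arr G \<Longrightarrow> gmul G (ginv G a) a = src G a"
  using alg unfolding algebraic_groupoid_def by blast+

lemma gmul_arr [simp]: "\<lbrakk>a \<in> arr G; b \<in> arr G; src G a = rng G b\<rbrakk> \<Longrightarrow> gmul G a b \<in> arr G"
  and rng_gmul [simp]: "\<lbrakk>a \<in> arr G; b \<in> arr G; src G a = rng G b\<rbrakk> \<Longrightarrow> rng G (gmul G a b) = rng G a"
  and src_gmul [simp]: "\<lbrakk>a \<in> arr G; b \<in> arr G; src G a = rng G b\<rbrakk> \<Longrightarrow> src G (gmul G a b) = src G b"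
  using alg unfolding algebraic_groupoid_def by blast+

lemma gmul_assoc:
  "\<lbrakk>a \<in> arr G; b \<in> arr G; c \<in> arr G; src G a = rng G b; src G b = rng G c\<rbrakk>
    \<Longrightarrow> gmul G (gmul G a b) c = gmul G a (gmul G b c)"
  using alg unfolding algebraic_groupoid_def by blast

lemma ginv_gmul_cancel [simp]:
  assumes "a \<in> arr G" "b \<in> arr G" "src G a = rng G b"
  shows "gmul G (ginv G a) (gmul G a b) = b"
  using gmul_assoc[of "ginv G a" a b] assms by simp

lemma gmul_ginv_cancel [simp]:
  assumes "a \<in> arr G" "b \<in> arr G" "rng G a = rng G b"
  shows "gmul G a (gmul G (ginv G a) b) = b"
  using gmul_assoc[of a "ginv G a" b] assms by simp

lemma gmul_ginv_cancel_right [simp]: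
  assumes "a \<in> arr G" "b \<in> arr G" "src G a = rng G b"
  shows "gmul G (gmul G a b) (ginv G b) = a"
  using gmul_assoc[of a b "ginv G b"] assms by (metis gmul_ginv gmul_src_id ginv_arr rng_ginv)

lemma ginv_gmul_cancel_right [simp]:
  assumes "a \<in> arr G" "b \<in> arr G" "src G a = src G b"
  shows "gmul G (gmul G a (ginv G b)) b = a"
  using gmul_assoc[of a "ginv G b" b] assms by (metis ginv_gmul gmul_src_id ginv_arr rng_ginv src_ginv)

lemma ginv_unique:
  assumes "a \<in> arr G" "b \<in> arr G" "src G a = rng G b" "gmul G a b = rng G a"
  shows "b = ginv G a"
proof -
  have "b = gmul G (ginv G a) (gmul G a b)" using assms(1-3) by simp
  also have "\<dots> = ginv G a" using assms by (metis gmul_src_id src_ginv ginv_arr)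
  finally show ?thesis .
qed

lemma ginv_ginv [simp]: "a \<in> arr G \<Longrightarrow> ginv G (ginv G a) = a"
  by (rule ginv_unique[symmetric]) simp_all

lemma ginv_gmul_rev:
  assumes "a \<in> arr G" "b \<in> arr G" "src G a = rng G b"
  shows "ginv G (gmul G a b) = gmul G (ginv G b) (ginv G a)"
proof (rule ginv_unique[symmetric])
  show "gmul G (gmul G a b) (gmul G (ginv G b) (ginv G a)) = rng G (gmul G a b)"
    using assms gmul_assoc[of a b "gmul G (ginv G b) (ginv G a)"] by simp
qed (use assms in simp_all)

lemma units_subset_arr: "units G \<subseteq> arr G"
  unfolding units_def by auto

lemma units_arr [simp]: "u \<in> units G \<Longrightarrow> u \<in> arr G"
  using units_subset_arr by blast

lemma rng_units [simp]: "a \<in> arr G \<Longrightarrow> rng G a \<in> units G"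
  unfolding units_def by auto

lemma src_units [simp]: "a \<in> arr G \<Longrightarrow> src G a \<in> units G"
  unfolding units_def by (metis image_eqI rng_src src_arr)

lemma unit_rng [simp]: "u \<in> units G \<Longrightarrow> rng G u = u"
  unfolding units_def by auto

lemma unit_src [simp]: "u \<in> units G \<Longrightarrow> src G u = u"
  unfolding units_def by auto

lemma units_eq: "units G = {a \<in> arr G. rng G a = a}"
proof (intro subset_antisym subsetI CollectI conjI)
  fix a assume "a \<in> {a \<in> arr G. rng G a = a}"
  then show "a \<in> units G" using rng_units[of a] by auto
qed simp_all

lemma ginv_unit [simp]: "u \<in> units G \<Longrightarrow> ginv G u = u"
  by (metis ginv_unique gmul_src_id unit_rng unit_src units_arr)

lemma topspace_unit_top [simp]: "topspace (unit_top G) = units G"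
  unfolding unit_top_def using units_subset_arr by (auto simp: topspace_subtopology)

text \<open>The definition of \<open>invariant\<close> gives one direction; the other follows by
  passing to the inverse arrow.\<close>

lemma invariant_src_iff:
  "\<lbrakk>invariant G D; a \<in> arr G\<rbrakk> \<Longrightarrow> src G a \<in> D \<longleftrightarrow> rng G a \<in> D"
  unfolding invariant_def by (metis ginv_arr rng_ginv src_ginv)

lemma invariant_Compl: "invariant G D \<Longrightarrow> invariant G (units G - D)"
  unfolding invariant_def by (metis Diff_iff Diff_subset ginv_arr rng_ginv rng_units src_ginv)

end

section \<open>Twists: composability, lifts and the free circle action\<close>

locale twisted_groupoid =
  fixes G :: "('g, 'm) groupoid_scheme" and \<Sigma> :: "('s, 'g) twist"
  assumes twist: "is_twist \<Sigma> G"
begin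

sublocale base: alg_groupoid G
  using twist unfolding is_twist_def lch_groupoid_def by unfold_locales blast

sublocale ext: alg_groupoid \<Sigma>
  using twist unfolding is_twist_def lch_groupoid_def by unfold_locales blast

lemma proj_arr [simp]: "\<sigma> \<in> arr \<Sigma> \<Longrightarrow> proj \<Sigma> \<sigma> \<in> arr G"
  and rng_proj: "\<sigma> \<in> arr \<Sigma> \<Longrightarrow> rng G (proj \<Sigma> \<sigma>) = proj \<Sigma> (rng \<Sigma> \<sigma>)"
  and src_proj: "\<sigma> \<in> arr \<Sigma> \<Longrightarrow> src G (proj \<Sigma> \<sigma>) = proj \<Sigma> (src \<Sigma> \<sigma>)"
  and proj_gmul [simp]: "\<lbrakk>\<sigma> \<in> arr \<Sigma>; \<tau> \<in> arr \<Sigma>; src \<Sigma> \<sigma> = rng \<Sigma> \<tau>\<rbrakk>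
    \<Longrightarrow> proj \<Sigma> (gmul \<Sigma> \<sigma> \<tau>) = gmul G (proj \<Sigma> \<sigma>) (proj \<Sigma> \<tau>)"
  using twist unfolding is_twist_def groupoid_hom_def by blast+

lemma proj_units [simp]: "u \<in> units \<Sigma> \<Longrightarrow> proj \<Sigma> u \<in> units G"
  by (metis base.rng_units ext.unit_rng ext.units_arr proj_arr rng_proj)

lemma proj_surj: "\<gamma> \<in> arr G \<Longrightarrow> \<exists>\<sigma>\<in>arr \<Sigma>. proj \<Sigma> \<sigma> = \<gamma>"
  using twist unfolding is_twist_def by (metis (no_types, lifting) imageE)

lemma proj_inj_units: "\<lbrakk>u \<in> units \<Sigma>; v \<in> units \<Sigma>; proj \<Sigma> u = proj \<Sigma> v\<rbrakk> \<Longrightarrow> u = v"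
proof -
  have "homeomorphic_map (unit_top \<Sigma>) (unit_top G) (proj \<Sigma>)"
    using twist unfolding is_twist_def by blast
  then have "inj_on (proj \<Sigma>) (units \<Sigma>)"
    using homeomorphic_imp_injective_map by fastforce
  then show "\<lbrakk>u \<in> units \<Sigma>; v \<in> units \<Sigma>; proj \<Sigma> u = proj \<Sigma> v\<rbrakk> \<Longrightarrow> u = v"
    by (simp add: inj_on_eq_iff)
qed

text \<open>\<open>proj\<close> is injective on units, so composability in the twist can be tested
  in the base groupoid.\<close>

lemma src_eq_rng_iff:
  "\<lbrakk>\<sigma> \<in> arr \<Sigma>; \<tau> \<in> arr \<Sigma>\<rbrakk> \<Longrightarrow> src \<Sigma> \<sigma> = rng \<Sigma> \<tau> \<longleftrightarrow> src G (proj \<Sigma> \<sigma>) = rng G (proj \<Sigma> \<tau>)"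
  by (metis ext.rng_units ext.src_units proj_inj_units rng_proj src_proj)

lemma src_eq_src_iff:
  "\<lbrakk>\<sigma> \<in> arr \<Sigma>; \<tau> \<in> arr \<Sigma>\<rbrakk> \<Longrightarrow> src \<Sigma> \<sigma> = src \<Sigma> \<tau> \<longleftrightarrow> src G (proj \<Sigma> \<sigma>) = src G (proj \<Sigma> \<tau>)"
  by (metis ext.src_units proj_inj_units src_proj)

lemma rng_eq_rng_iff:
  "\<lbrakk>\<sigma> \<in> arr \<Sigma>; \<tau> \<in> arr \<Sigma>\<rbrakk> \<Longrightarrow> rng \<Sigma> \<sigma> = rng \<Sigma> \<tau> \<longleftrightarrow> rng G (proj \<Sigma> \<sigma>) = rng G (proj \<Sigma> \<tau>)"
  by (metis ext.rng_units proj_inj_units rng_proj)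

lemma proj_ginv [simp]: "\<sigma> \<in> arr \<Sigma> \<Longrightarrow> proj \<Sigma> (ginv \<Sigma> \<sigma>) = ginv G (proj \<Sigma> \<sigma>)"
proof (rule base.ginv_unique)
  assume s: "\<sigma> \<in> arr \<Sigma>"
  show "gmul G (proj \<Sigma> \<sigma>) (proj \<Sigma> (ginv \<Sigma> \<sigma>)) = rng G (proj \<Sigma> \<sigma>)"
    by (metis s ext.ginv_arr ext.gmul_ginv ext.rng_ginv proj_gmul rng_proj)
qed (auto simp: src_proj rng_proj)

lemma lift_arr [simp]: "\<gamma> \<in> arr G \<Longrightarrow> lift \<Sigma> \<gamma> \<in> arr \<Sigma>"
  and proj_lift [simp]: "\<gamma> \<in> arr G \<Longrightarrow> proj \<Sigma> (lift \<Sigma> \<gamma>) = \<gamma>"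
  using someI_ex[of "\<lambda>\<sigma>. \<sigma> \<in> arr \<Sigma> \<and> proj \<Sigma> \<sigma> = \<gamma>"] proj_surj[of \<gamma>] unfolding lift_def by blast+

lemma arr_circle_bundle: "arr (circle_bundle G) = units G \<times> sphere 0 1"
  by (simp add: circle_bundle_def)

lemma incl_homeo:
  "homeomorphic_map (prod_topology (unit_top G) (top_of_set (sphere 0 1)))
     (subtopology (gtop \<Sigma>) {\<sigma> \<in> arr \<Sigma>. proj \<Sigma> \<sigma> \<in> units G}) (incl \<Sigma>)"
  using twist unfolding is_twist_def circle_bundle_def by simp

lemma incl_image: "incl \<Sigma> ` (units G \<times> sphere 0 1) = {\<sigma> \<in> arr \<Sigma>. proj \<Sigma> \<sigma> \<in> units G}"
  using homeomorphic_imp_surjective_map[OF incl_homeo] by auto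

lemma incl_inj: "inj_on (incl \<Sigma>) (units G \<times> sphere 0 1)"
  using homeomorphic_imp_injective_map[OF incl_homeo] by simp

lemma incl_hom: "groupoid_hom (circle_bundle G) \<Sigma> (incl \<Sigma>)"
  using twist unfolding is_twist_def by blast

lemma incl_arr [simp]: "\<lbrakk>y \<in> units G; cmod z = 1\<rbrakk> \<Longrightarrow> incl \<Sigma> (y, z) \<in> arr \<Sigma>"
  using incl_image by auto

lemma proj_incl [simp]: "\<lbrakk>y \<in> units G; cmod z = 1\<rbrakk> \<Longrightarrow> proj \<Sigma> (incl \<Sigma> (y, z)) = y"
  using twist unfolding is_twist_def by simp

lemma rng_incl [simp]: "\<lbrakk>y \<in> units G; cmod z = 1\<rbrakk> \<Longrightarrow> rng \<Sigma> (incl \<Sigma> (y, z)) = incl \<Sigma> (y, 1)"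
  and src_incl [simp]: "\<lbrakk>y \<in> units G; cmod z = 1\<rbrakk> \<Longrightarrow> src \<Sigma> (incl \<Sigma> (y, z)) = incl \<Sigma> (y, 1)"
  using incl_hom unfolding groupoid_hom_def arr_circle_bundle by (auto simp: circle_bundle_def)

lemma gmul_incl:
  assumes "y \<in> units G" "cmod z = 1" "cmod w = 1"
  shows "gmul \<Sigma> (incl \<Sigma> (y, z)) (incl \<Sigma> (y, w)) = incl \<Sigma> (y, z * w)"
proof -
  have "\<And>a b. \<lbrakk>a \<in> units G \<times> sphere 0 1; b \<in> units G \<times> sphere 0 1; src (circle_bundle G) a = rng (circle_bundle G) b\<rbrakk>
    \<Longrightarrow> incl \<Sigma> (gmul (circle_bundle G) a b) = gmul \<Sigma> (incl \<Sigma> a) (incl \<Sigma> b)"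
    using incl_hom unfolding groupoid_hom_def arr_circle_bundle by blast
  from this[of "(y, z)" "(y, w)"] show ?thesis using assms by (simp add: circle_bundle_def)
qed

lemma incl_one_unit [simp]: "y \<in> units G \<Longrightarrow> incl \<Sigma> (y, 1) \<in> units \<Sigma>"
  using rng_incl[of y 1] ext.rng_units[of "incl \<Sigma> (y, 1)"] by simp

lemma incl_one_rng [simp]: "\<sigma> \<in> arr \<Sigma> \<Longrightarrow> incl \<Sigma> (proj \<Sigma> (rng \<Sigma> \<sigma>), 1) = rng \<Sigma> \<sigma>"
  by (rule proj_inj_units) auto

lemma incl_one_src [simp]: "\<sigma> \<in> arr \<Sigma> \<Longrightarrow> incl \<Sigma> (proj \<Sigma> (src \<Sigma> \<sigma>), 1) = src \<Sigma> \<sigma>"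
  by (rule proj_inj_units) auto

lemma act_arr [simp]: "\<lbrakk>\<sigma> \<in> arr \<Sigma>; cmod z = 1\<rbrakk> \<Longrightarrow> circle_act \<Sigma> z \<sigma> \<in> arr \<Sigma>"
  and rng_act [simp]: "\<lbrakk>\<sigma> \<in> arr \<Sigma>; cmod z = 1\<rbrakk> \<Longrightarrow> rng \<Sigma> (circle_act \<Sigma> z \<sigma>) = rng \<Sigma> \<sigma>"
  and src_act [simp]: "\<lbrakk>\<sigma> \<in> arr \<Sigma>; cmod z = 1\<rbrakk> \<Longrightarrow> src \<Sigma> (circle_act \<Sigma> z \<sigma>) = src \<Sigma> \<sigma>"
  unfolding circle_act_def by simp_all

lemma proj_act [simp]: "\<lbrakk>\<sigma> \<in> arr \<Sigma>; cmod z = 1\<rbrakk> \<Longrightarrow> proj \<Sigma> (circle_act \<Sigma> z \<sigma>) = proj \<Sigma> \<sigma>"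
proof -
  assume s: "\<sigma> \<in> arr \<Sigma>" "cmod z = 1"
  then have "proj \<Sigma> (circle_act \<Sigma> z \<sigma>) = gmul G (rng G (proj \<Sigma> \<sigma>)) (proj \<Sigma> \<sigma>)"
    unfolding circle_act_def by (simp add: rng_proj)
  then show ?thesis using s by simp
qed

lemma act_one [simp]: "\<sigma> \<in> arr \<Sigma> \<Longrightarrow> circle_act \<Sigma> 1 \<sigma> = \<sigma>"
  unfolding circle_act_def by simp

lemma act_act: "\<lbrakk>\<sigma> \<in> arr \<Sigma>; cmod z = 1; cmod w = 1\<rbrakk>
    \<Longrightarrow> circle_act \<Sigma> z (circle_act \<Sigma> w \<sigma>) = circle_act \<Sigma> (z * w) \<sigma>"
proof -
  assume s: "\<sigma> \<in> arr \<Sigma>" "cmod z = 1" "cmod w = 1"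
  let ?y = "proj \<Sigma> (rng \<Sigma> \<sigma>)"
  have "circle_act \<Sigma> z (circle_act \<Sigma> w \<sigma>) = gmul \<Sigma> (incl \<Sigma> (?y, z)) (gmul \<Sigma> (incl \<Sigma> (?y, w)) \<sigma>)"
    using s rng_act[of \<sigma> w] unfolding circle_act_def by simp
  also have "\<dots> = gmul \<Sigma> (gmul \<Sigma> (incl \<Sigma> (?y, z)) (incl \<Sigma> (?y, w))) \<sigma>"
    using s by (intro ext.gmul_assoc[symmetric]) simp_all
  also have "\<dots> = circle_act \<Sigma> (z * w) \<sigma>" using s by (simp add: gmul_incl circle_act_def)
  finally show ?thesis .
qed

lemma act_gmul_left:
  assumes "\<sigma> \<in> arr \<Sigma>" "\<tau> \<in> arr \<Sigma>" "src \<Sigma> \<sigma> = rng \<Sigma> \<tau>" "cmod z = 1"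
  shows "gmul \<Sigma> (circle_act \<Sigma> z \<sigma>) \<tau> = circle_act \<Sigma> z (gmul \<Sigma> \<sigma> \<tau>)"
  using assms unfolding circle_act_def by (simp add: ext.gmul_assoc)

lemma act_eq_right: "\<lbrakk>\<sigma> \<in> arr \<Sigma>; cmod z = 1\<rbrakk>
    \<Longrightarrow> circle_act \<Sigma> z \<sigma> = gmul \<Sigma> \<sigma> (incl \<Sigma> (proj \<Sigma> (src \<Sigma> \<sigma>), z))"
  using twist unfolding is_twist_def circle_act_def by simp

text \<open>Centrality writes the action as right multiplication by a value of \<open>incl\<close>;
  associativity then moves it out of the product.\<close>

lemma act_gmul_right:
  assumes "\<sigma> \<in> arr \<Sigma>" "\<tau> \<in> arr \<Sigma>" "src \<Sigma> \<sigma> = rng \<Sigma> \<tau>" "cmod z = 1"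
  shows "gmul \<Sigma> \<sigma> (circle_act \<Sigma> z \<tau>) = circle_act \<Sigma> z (gmul \<Sigma> \<sigma> \<tau>)"
  using assms by (simp add: act_eq_right ext.gmul_assoc)

lemma ginv_act:
  assumes "\<sigma> \<in> arr \<Sigma>" "cmod z = 1"
  shows "ginv \<Sigma> (circle_act \<Sigma> z \<sigma>) = circle_act \<Sigma> (inverse z) (ginv \<Sigma> \<sigma>)"
proof (rule ext.ginv_unique[symmetric])
  have [simp]: "cmod (inverse z) = 1" "z \<noteq> 0" using assms by (auto simp: norm_inverse)
  show "gmul \<Sigma> (circle_act \<Sigma> z \<sigma>) (circle_act \<Sigma> (inverse z) (ginv \<Sigma> \<sigma>)) = rng \<Sigma> (circle_act \<Sigma> z \<sigma>)"
    using assms by (simp add: act_gmul_left act_gmul_right act_act)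
qed (use assms in \<open>auto simp: norm_inverse\<close>)

text \<open>The arrow \<tau>\<sigma>^-1 lies over a unit, hence in the image of \<open>incl\<close>:
  the fibres of \<open>proj\<close> are circle orbits. Through this, changing a lift costs an
  equivariant function only a factor of modulus one.\<close>

lemma proj_eqE:
  assumes "\<sigma> \<in> arr \<Sigma>" "\<tau> \<in> arr \<Sigma>" "proj \<Sigma> \<sigma> = proj \<Sigma> \<tau>"
  obtains z where "cmod z = 1" "\<tau> = circle_act \<Sigma> z \<sigma>"
proof -
  have eq: "src \<Sigma> \<tau> = src \<Sigma> \<sigma>" "rng \<Sigma> \<tau> = rng \<Sigma> \<sigma>"
    using assms by (simp_all add: src_eq_src_iff rng_eq_rng_iff)
  let ?k = "gmul \<Sigma> \<tau> (ginv \<Sigma> \<sigma>)"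
  have k: "?k \<in> arr \<Sigma>" "proj \<Sigma> ?k = proj \<Sigma> (rng \<Sigma> \<sigma>)"
    using assms eq by (simp_all add: rng_proj[symmetric] flip: assms(3))
  then have "?k \<in> incl \<Sigma> ` (units G \<times> sphere 0 1)" unfolding incl_image using assms by simp
  then obtain y z where yz: "?k = incl \<Sigma> (y, z)" "y \<in> units G" "cmod z = 1"
    by (auto simp: image_iff)
  then have "y = proj \<Sigma> (rng \<Sigma> \<sigma>)" using k by simp
  then have "circle_act \<Sigma> z \<sigma> = gmul \<Sigma> ?k \<sigma>" using yz unfolding circle_act_def by simp
  also have "\<dots> = \<tau>" using assms eq by simp
  finally show ?thesis using that yz by blast
qed

text \<open>Cancelling \<sigma> on the right leaves two values of the injective map
  \<open>incl\<close>. Freeness is what makes the circle coordinate in \<open>delta\<close> well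
  defined.\<close>

lemma act_inj:
  assumes "\<sigma> \<in> arr \<Sigma>" "cmod z = 1" "cmod w = 1" "circle_act \<Sigma> z \<sigma> = circle_act \<Sigma> w \<sigma>"
  shows "z = w"
proof -
  let ?y = "proj \<Sigma> (rng \<Sigma> \<sigma>)"
  have "gmul \<Sigma> (circle_act \<Sigma> z \<sigma>) (ginv \<Sigma> \<sigma>) = gmul \<Sigma> (circle_act \<Sigma> w \<sigma>) (ginv \<Sigma> \<sigma>)"
    using assms by simp
  then have "incl \<Sigma> (?y, z) = incl \<Sigma> (?y, w)"
    unfolding circle_act_def using assms by simp
  then show ?thesis
    using inj_onD[OF incl_inj, of "(?y, z)" "(?y, w)"] assms by simp
qed

lemma act_incl: "\<lbrakk>y \<in> units G; cmod z = 1; cmod w = 1\<rbrakk>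
    \<Longrightarrow> circle_act \<Sigma> w (incl \<Sigma> (y, z)) = incl \<Sigma> (y, w * z)"
  unfolding circle_act_def by (simp add: gmul_incl)

end

section \<open>Operators on the Hilbert spaces of the source fibres\<close>

context twisted_groupoid
begin

lemma src_fibre_iff: "\<sigma> \<in> src_fibre \<Sigma> x \<longleftrightarrow> \<sigma> \<in> arr \<Sigma> \<and> src G (proj \<Sigma> \<sigma>) = x"
  unfolding src_fibre_def by (auto simp: src_proj)

lemma src_fibre_units: "\<sigma> \<in> src_fibre \<Sigma> x \<Longrightarrow> x \<in> units G"
  unfolding src_fibre_iff by auto

text \<open>The conditions of \<open>Hx\<close> other than summability, kept apart so that
  \<open>HxI\<close> can derive summability from a bound on finite sums.\<close>

definition twisted_fun :: "'g \<Rightarrow> ('s \<Rightarrow> complex) \<Rightarrow> bool" where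
  "twisted_fun x \<xi> \<longleftrightarrow> (\<forall>\<sigma>. \<sigma> \<notin> src_fibre \<Sigma> x \<longrightarrow> \<xi> \<sigma> = 0) \<and>
     (\<forall>\<sigma>\<in>src_fibre \<Sigma> x. \<forall>z\<in>sphere 0 1. \<xi> (circle_act \<Sigma> z \<sigma>) = z * \<xi> \<sigma>)"

abbreviation l2sum :: "('s \<Rightarrow> complex) \<Rightarrow> 'g set \<Rightarrow> real" where
  "l2sum \<xi> F \<equiv> L2_set (\<lambda>\<gamma>. cmod (\<xi> (lift \<Sigma> \<gamma>))) F"

abbreviation gfibre :: "'g \<Rightarrow> 'g set" where
  "gfibre x \<equiv> {\<gamma> \<in> arr G. src G \<gamma> = x}"

lemma Hx_twisted: "\<xi> \<in> Hx \<Sigma> G x \<Longrightarrow> twisted_fun x \<xi>"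
  unfolding Hx_def twisted_fun_def by auto

lemma twisted_fun_cmod:
  assumes "twisted_fun x \<xi>" "\<sigma> \<in> arr \<Sigma>" "\<tau> \<in> arr \<Sigma>" "proj \<Sigma> \<sigma> = proj \<Sigma> \<tau>"
  shows "cmod (\<xi> \<sigma>) = cmod (\<xi> \<tau>)"
proof (cases "\<tau> \<in> src_fibre \<Sigma> x")
  case True
  obtain z where z: "cmod z = 1" "\<sigma> = circle_act \<Sigma> z \<tau>"
    using proj_eqE[OF assms(3,2)] assms(4) by metis
  then have "\<xi> \<sigma> = z * \<xi> \<tau>" using assms(1) True unfolding twisted_fun_def by auto
  then show ?thesis using z by (simp add: norm_mult)
next
  case False
  then have "\<sigma> \<notin> src_fibre \<Sigma> x" using assms by (auto simp: src_fibre_iff)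
  then show ?thesis using False assms(1) unfolding twisted_fun_def by auto
qed

lemma Hx_norm_nonneg [simp]: "Hx_norm \<Sigma> G x \<xi> \<ge> 0"
  unfolding Hx_norm_def by (simp add: infsum_nonneg)

lemma l2sum_le_Hx_norm:
  assumes "\<xi> \<in> Hx \<Sigma> G x" "finite F" "F \<subseteq> gfibre x"
  shows "l2sum \<xi> F \<le> Hx_norm \<Sigma> G x \<xi>"
  unfolding L2_set_def Hx_norm_def
  using assms by (intro real_sqrt_le_mono finite_sum_le_infsum) (auto simp: Hx_def)

text \<open>Bounded finite sums of nonnegative terms give summability, and the infinite sum inherits
  the bound. Together with \<open>l2sum_le_Hx_norm\<close> this turns Hilbert space estimates into
  estimates of \<open>L2_set\<close> over finite sets.\<close>

lemma HxI:
  assumes "twisted_fun x \<xi>" "C \<ge> 0" "\<And>F. \<lbrakk>finite F; F \<subseteq> gfibre x\<rbrakk> \<Longrightarrow> l2sum \<xi> F \<le> C"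
  shows "\<xi> \<in> Hx \<Sigma> G x" "Hx_norm \<Sigma> G x \<xi> \<le> C"
proof -
  let ?f = "\<lambda>\<gamma>. (cmod (\<xi> (lift \<Sigma> \<gamma>)))\<^sup>2"
  have le: "sum ?f F \<le> C\<^sup>2" if "finite F" "F \<subseteq> gfibre x" for F
    using assms(3)[OF that] assms(2) unfolding L2_set_def by (simp add: sqrt_le_D)
  have s: "?f summable_on gfibre x"
    by (rule nonneg_bdd_above_summable_on) (auto intro!: bdd_aboveI[of _ "C\<^sup>2"] le)
  then show "\<xi> \<in> Hx \<Sigma> G x" using assms(1) unfolding Hx_def twisted_fun_def by auto
  have "infsum ?f (gfibre x) \<le> C\<^sup>2"
    by (rule infsum_le_finite_sums[OF s]) (auto intro: le)
  then show "Hx_norm \<Sigma> G x \<xi> \<le> C"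
    unfolding Hx_norm_def using assms(2) by (simp add: real_le_lsqrt)
qed

lemma Hx_add:
  assumes "\<xi> \<in> Hx \<Sigma> G x" "\<eta> \<in> Hx \<Sigma> G x"
  shows "\<xi> + \<eta> \<in> Hx \<Sigma> G x" "Hx_norm \<Sigma> G x (\<xi> + \<eta>) \<le> Hx_norm \<Sigma> G x \<xi> + Hx_norm \<Sigma> G x \<eta>"
proof -
  have t: "twisted_fun x (\<xi> + \<eta>)"
    using assms[THEN Hx_twisted] unfolding twisted_fun_def by (auto simp: algebra_simps)
  have "l2sum (\<xi> + \<eta>) F \<le> Hx_norm \<Sigma> G x \<xi> + Hx_norm \<Sigma> G x \<eta>"
    if F: "finite F" "F \<subseteq> gfibre x" for F
  proof -
    have "l2sum (\<xi> + \<eta>) F \<le> L2_set (\<lambda>\<gamma>. cmod (\<xi> (lift \<Sigma> \<gamma>)) + cmod (\<eta> (lift \<Sigma> \<gamma>))) F"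
      by (rule L2_set_mono) (auto intro: norm_triangle_ineq)
    also have "\<dots> \<le> l2sum \<xi> F + l2sum \<eta> F" by (rule L2_set_triangle_ineq)
    also have "\<dots> \<le> Hx_norm \<Sigma> G x \<xi> + Hx_norm \<Sigma> G x \<eta>"
      using l2sum_le_Hx_norm[OF assms(1) F] l2sum_le_Hx_norm[OF assms(2) F] by simp
    finally show ?thesis .
  qed
  with t show "\<xi> + \<eta> \<in> Hx \<Sigma> G x" "Hx_norm \<Sigma> G x (\<xi> + \<eta>) \<le> Hx_norm \<Sigma> G x \<xi> + Hx_norm \<Sigma> G x \<eta>"
    by (intro HxI[where C = "Hx_norm \<Sigma> G x \<xi> + Hx_norm \<Sigma> G x \<eta>"]; simp)+
qed

lemma Hx_scale:
  assumes "\<xi> \<in> Hx \<Sigma> G x"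
  shows "(\<lambda>\<sigma>. c * \<xi> \<sigma>) \<in> Hx \<Sigma> G x" "Hx_norm \<Sigma> G x (\<lambda>\<sigma>. c * \<xi> \<sigma>) \<le> cmod c * Hx_norm \<Sigma> G x \<xi>"
proof -
  have t: "twisted_fun x (\<lambda>\<sigma>. c * \<xi> \<sigma>)"
    using assms[THEN Hx_twisted] unfolding twisted_fun_def by (auto simp: algebra_simps)
  have "l2sum (\<lambda>\<sigma>. c * \<xi> \<sigma>) F \<le> cmod c * Hx_norm \<Sigma> G x \<xi>"
    if F: "finite F" "F \<subseteq> gfibre x" for F
  proof -
    have "l2sum (\<lambda>\<sigma>. c * \<xi> \<sigma>) F = cmod c * l2sum \<xi> F"
      by (simp add: norm_mult L2_set_right_distrib)
    also have "\<dots> \<le> cmod c * Hx_norm \<Sigma> G x \<xi>"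
      using l2sum_le_Hx_norm[OF assms F] by (simp add: mult_left_mono)
    finally show ?thesis .
  qed
  with t show "(\<lambda>\<sigma>. c * \<xi> \<sigma>) \<in> Hx \<Sigma> G x"
      "Hx_norm \<Sigma> G x (\<lambda>\<sigma>. c * \<xi> \<sigma>) \<le> cmod c * Hx_norm \<Sigma> G x \<xi>"
    by (intro HxI[where C = "cmod c * Hx_norm \<Sigma> G x \<xi>"]; simp)+
qed

lemma Hx_zero [simp]: "0 \<in> Hx \<Sigma> G x" and Hx_norm_zero [simp]: "Hx_norm \<Sigma> G x 0 = 0"
proof -
  have "twisted_fun x 0" by (simp add: twisted_fun_def)
  then have "0 \<in> Hx \<Sigma> G x \<and> Hx_norm \<Sigma> G x 0 \<le> 0"
    by (intro conjI HxI[where C = 0]) (auto simp: L2_set_def)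
  then show "0 \<in> Hx \<Sigma> G x" "Hx_norm \<Sigma> G x 0 = 0"
    using Hx_norm_nonneg[of x 0] by (auto simp del: Hx_norm_nonneg)
qed

lemma Hx_diff:
  assumes "\<xi> \<in> Hx \<Sigma> G x" "\<eta> \<in> Hx \<Sigma> G x"
  shows "\<xi> - \<eta> \<in> Hx \<Sigma> G x" "Hx_norm \<Sigma> G x (\<xi> - \<eta>) \<le> Hx_norm \<Sigma> G x \<xi> + Hx_norm \<Sigma> G x \<eta>"
proof -
  have eq: "\<xi> - \<eta> = \<xi> + (\<lambda>\<sigma>. (- 1) * \<eta> \<sigma>)" by auto
  note m = Hx_scale[OF assms(2), of "-1"]
  show "\<xi> - \<eta> \<in> Hx \<Sigma> G x" unfolding eq by (rule Hx_add(1)[OF assms(1) m(1)])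
  show "Hx_norm \<Sigma> G x (\<xi> - \<eta>) \<le> Hx_norm \<Sigma> G x \<xi> + Hx_norm \<Sigma> G x \<eta>"
    unfolding eq using Hx_add(2)[OF assms(1) m(1)] m(2) by simp
qed

text \<open>The modulus depends only on the arrow below, so its square is one term of the square
  sum. Norm bounds thereby yield bounds at every point.\<close>

lemma Hx_pointwise:
  assumes "\<xi> \<in> Hx \<Sigma> G x"
  shows "cmod (\<xi> \<sigma>) \<le> Hx_norm \<Sigma> G x \<xi>"
proof (cases "\<sigma> \<in> src_fibre \<Sigma> x")
  case True
  then have s: "\<sigma> \<in> arr \<Sigma>" "proj \<Sigma> \<sigma> \<in> gfibre x" by (auto simp: src_fibre_iff)
  have "cmod (\<xi> \<sigma>) = cmod (\<xi> (lift \<Sigma> (proj \<Sigma> \<sigma>)))"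
    by (rule twisted_fun_cmod[OF Hx_twisted[OF assms]]) (use s in auto)
  also have "\<dots> \<le> Hx_norm \<Sigma> G x \<xi>"
    using l2sum_le_Hx_norm[OF assms, of "{proj \<Sigma> \<sigma>}"] s by simp
  finally show ?thesis .
next
  case False
  then show ?thesis using Hx_twisted[OF assms] unfolding twisted_fun_def by simp
qed

lemma Hx_norm_eq_0: "\<lbrakk>\<xi> \<in> Hx \<Sigma> G x; Hx_norm \<Sigma> G x \<xi> \<le> 0\<rbrakk> \<Longrightarrow> \<xi> = 0"
  using Hx_pointwise[of \<xi> x] by (intro ext) (metis norm_le_zero_iff order_trans zero_fun_apply)

section \<open>Linear operators on one fibre and their norms\<close>

definition linear_op :: "'g \<Rightarrow> 's operator \<Rightarrow> bool" where
  "linear_op x T \<longleftrightarrow> (\<forall>\<xi>\<in>Hx \<Sigma> G x. T \<xi> \<in> Hx \<Sigma> G x) \<and>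
     (\<forall>\<xi>\<in>Hx \<Sigma> G x. \<forall>\<eta>\<in>Hx \<Sigma> G x. T (\<xi> + \<eta>) = T \<xi> + T \<eta>) \<and>
     (\<forall>c. \<forall>\<xi>\<in>Hx \<Sigma> G x. T (\<lambda>\<sigma>. c * \<xi> \<sigma>) = (\<lambda>\<sigma>. c * T \<xi> \<sigma>)) \<and>
     (\<forall>\<xi>. \<xi> \<notin> Hx \<Sigma> G x \<longrightarrow> T \<xi> = 0)"

lemma linear_opD:
  assumes "linear_op x T"
  shows "\<xi> \<in> Hx \<Sigma> G x \<Longrightarrow> T \<xi> \<in> Hx \<Sigma> G x"
    and "\<lbrakk>\<xi> \<in> Hx \<Sigma> G x; \<eta> \<in> Hx \<Sigma> G x\<rbrakk> \<Longrightarrow> T (\<xi> + \<eta>) = T \<xi> + T \<eta>"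
    and "\<xi> \<in> Hx \<Sigma> G x \<Longrightarrow> T (\<lambda>\<sigma>. c * \<xi> \<sigma>) = (\<lambda>\<sigma>. c * T \<xi> \<sigma>)"
    and "\<xi> \<notin> Hx \<Sigma> G x \<Longrightarrow> T \<xi> = 0"
  using assms unfolding linear_op_def by auto

lemma linear_op_zero_arg [simp]: "linear_op x T \<Longrightarrow> T 0 = 0"
  using linear_opD(3)[of x T 0 0] by (simp add: zero_fun_def[symmetric])

lemma linear_op_diff_arg:
  assumes "linear_op x T" "\<xi> \<in> Hx \<Sigma> G x" "\<eta> \<in> Hx \<Sigma> G x"
  shows "T (\<xi> - \<eta>) = T \<xi> - T \<eta>"
  using linear_opD(2)[OF assms(1) Hx_diff(1)[OF assms(2,3)] assms(3)] by (simp add: algebra_simps)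

lemma linear_op_zero: "linear_op x 0"
  unfolding linear_op_def by (auto simp: zero_fun_def[symmetric])

lemma linear_op_add: "\<lbrakk>linear_op x S; linear_op x T\<rbrakk> \<Longrightarrow> linear_op x (S + T)"
  unfolding linear_op_def by (auto intro: Hx_add simp: algebra_simps)

lemma linear_op_diff: "\<lbrakk>linear_op x S; linear_op x T\<rbrakk> \<Longrightarrow> linear_op x (S - T)"
  unfolding linear_op_def by (auto intro: Hx_diff simp: algebra_simps)

lemma linear_op_scale: "linear_op x T \<Longrightarrow> linear_op x (\<lambda>\<xi> \<sigma>. c * T \<xi> \<sigma>)"
  unfolding linear_op_def by (auto intro: Hx_scale simp: algebra_simps zero_fun_def)

lemma linear_op_comp: "\<lbrakk>linear_op x S; linear_op x T\<rbrakk> \<Longrightarrow> linear_op x (S \<circ> T)"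
  using linear_op_zero_arg[of x S] unfolding linear_op_def by auto

text \<open>Rescaling to the unit ball turns the supremum in \<open>ennreal\<close> into a
  homogeneous real inequality; a vector of norm zero is zero.\<close>

lemma op_norm_le_iff:
  assumes "linear_op x T" "C \<ge> 0"
  shows "op_norm \<Sigma> G x T \<le> ennreal C \<longleftrightarrow>
    (\<forall>\<xi>\<in>Hx \<Sigma> G x. Hx_norm \<Sigma> G x (T \<xi>) \<le> C * Hx_norm \<Sigma> G x \<xi>)"
proof
  assume L: "op_norm \<Sigma> G x T \<le> ennreal C"
  have 1: "Hx_norm \<Sigma> G x (T \<xi>) \<le> C" if "\<xi> \<in> Hx \<Sigma> G x" "Hx_norm \<Sigma> G x \<xi> \<le> 1" for \<xi>
  proof -
    have "ennreal (Hx_norm \<Sigma> G x (T \<xi>)) \<le> op_norm \<Sigma> G x T"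
      unfolding op_norm_def by (rule SUP_upper) (use that in auto)
    with L have "ennreal (Hx_norm \<Sigma> G x (T \<xi>)) \<le> ennreal C" by (rule order_trans[rotated])
    then show ?thesis using assms(2) by simp
  qed
  show "\<forall>\<xi>\<in>Hx \<Sigma> G x. Hx_norm \<Sigma> G x (T \<xi>) \<le> C * Hx_norm \<Sigma> G x \<xi>"
  proof
    fix \<xi> assume \<xi>: "\<xi> \<in> Hx \<Sigma> G x"
    let ?n = "Hx_norm \<Sigma> G x \<xi>"
    show "Hx_norm \<Sigma> G x (T \<xi>) \<le> C * ?n"
    proof (cases "?n = 0")
      case True
      then have "\<xi> = 0" using Hx_norm_eq_0[OF \<xi>] by simp
      then show ?thesis
        by (metis Hx_norm_zero linear_op_zero_arg assms(1) mult_zero_right order_refl)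
    next
      case False
      then have n: "?n > 0" using Hx_norm_nonneg[of x \<xi>] by linarith
      let ?e = "\<lambda>\<sigma>. complex_of_real (1 / ?n) * \<xi> \<sigma>"
      have e: "?e \<in> Hx \<Sigma> G x" "Hx_norm \<Sigma> G x ?e \<le> 1"
        using Hx_scale[OF \<xi>, of "complex_of_real (1 / ?n)"] n by (auto simp: norm_divide)
      have "T \<xi> = (\<lambda>\<sigma>. complex_of_real ?n * T ?e \<sigma>)"
        using linear_opD(3)[OF assms(1) e(1), of "complex_of_real ?n"] n by simp
      then have "Hx_norm \<Sigma> G x (T \<xi>) \<le> cmod (complex_of_real ?n) * Hx_norm \<Sigma> G x (T ?e)"
        using Hx_scale(2)[OF linear_opD(1)[OF assms(1) e(1)], of "complex_of_real ?n"] by simp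
      also have "\<dots> \<le> ?n * C" using 1[OF e] n by (simp add: mult_left_mono)
      finally show ?thesis by (simp add: mult.commute)
    qed
  qed
next
  assume R: "\<forall>\<xi>\<in>Hx \<Sigma> G x. Hx_norm \<Sigma> G x (T \<xi>) \<le> C * Hx_norm \<Sigma> G x \<xi>"
  have "Hx_norm \<Sigma> G x (T \<xi>) \<le> C" if "\<xi> \<in> Hx \<Sigma> G x" "Hx_norm \<Sigma> G x \<xi> \<le> 1" for \<xi>
  proof -
    have "Hx_norm \<Sigma> G x (T \<xi>) \<le> C * Hx_norm \<Sigma> G x \<xi>" using R that by simp
    also have "\<dots> \<le> C * 1" using that assms(2) by (intro mult_left_mono)
    finally show ?thesis by simp
  qed
  then show "op_norm \<Sigma> G x T \<le> ennreal C"
    unfolding op_norm_def by (intro SUP_least) (auto intro: ennreal_leI)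
qed

section \<open>Families of operators over the unit space\<close>

definition linear_family :: "('s, 'g) op_family \<Rightarrow> bool" where
  "linear_family a \<longleftrightarrow> (\<forall>x\<in>units G. linear_op x (a x)) \<and> (\<forall>x. x \<notin> units G \<longrightarrow> a x = 0)"

text \<open>A real inequality standing for an upper bound on \<open>fam_norm\<close>, with
  \<open>fam_norm_le_iff\<close> as the translation; sums and products can then be estimated by real
  arithmetic.\<close>

definition bounded_by :: "real \<Rightarrow> ('s, 'g) op_family \<Rightarrow> bool" where
  "bounded_by C a \<longleftrightarrow>
     (\<forall>x\<in>units G. \<forall>\<xi>\<in>Hx \<Sigma> G x. Hx_norm \<Sigma> G x (a x \<xi>) \<le> C * Hx_norm \<Sigma> G x \<xi>)"

lemma fam_norm_le_iff:
  assumes "linear_family a" "C \<ge> 0"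
  shows "fam_norm \<Sigma> G a \<le> ennreal C \<longleftrightarrow> bounded_by C a"
  using assms op_norm_le_iff unfolding fam_norm_def SUP_le_iff bounded_by_def linear_family_def by simp

lemma bounded_by_mono: "\<lbrakk>bounded_by C a; C \<le> D\<rbrakk> \<Longrightarrow> bounded_by D a"
  unfolding bounded_by_def by (meson Hx_norm_nonneg mult_right_mono order_trans)

lemma ennreal_less_infinity_iff: "(t :: ennreal) < \<infinity> \<longleftrightarrow> (\<exists>C\<ge>0. t \<le> ennreal C)"
proof
  assume "t < \<infinity>"
  then have "t \<le> ennreal (enn2real t)" by simp
  then show "\<exists>C\<ge>0. t \<le> ennreal C" using enn2real_nonneg by blast
qed (auto intro: le_less_trans)

lemma op_families_iff:
  "a \<in> op_families \<Sigma> G \<longleftrightarrow> linear_family a \<and> (\<exists>C\<ge>0. bounded_by C a)"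
proof -
  have "a \<in> op_families \<Sigma> G \<longleftrightarrow> linear_family a \<and> fam_norm \<Sigma> G a < \<infinity>"
  proof
    assume "a \<in> op_families \<Sigma> G"
    then show "linear_family a \<and> fam_norm \<Sigma> G a < \<infinity>"
      unfolding op_families_def bounded_ops_def linear_family_def linear_op_def by auto
  next
    assume L: "linear_family a \<and> fam_norm \<Sigma> G a < \<infinity>"
    have "op_norm \<Sigma> G x (a x) < \<infinity>" if "x \<in> units G" for x
      using L that SUP_upper[of x "units G" "\<lambda>x. op_norm \<Sigma> G x (a x)"] unfolding fam_norm_def
      by (auto intro: le_less_trans)
    with L show "a \<in> op_families \<Sigma> G"
      unfolding op_families_def bounded_ops_def linear_family_def linear_op_def by auto
  qed
  also have "\<dots> \<longleftrightarrow> linear_family a \<and> (\<exists>C\<ge>0. fam_norm \<Sigma> G a \<le> ennreal C)"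
    unfolding ennreal_less_infinity_iff ..
  also have "\<dots> \<longleftrightarrow> linear_family a \<and> (\<exists>C\<ge>0. bounded_by C a)"
    using fam_norm_le_iff by blast
  finally show ?thesis .
qed

lemma bounded_by_zero: "bounded_by 0 0"
  unfolding bounded_by_def by simp

lemma bounded_by_add:
  assumes "linear_family a" "linear_family b" "bounded_by C a" "bounded_by D b"
  shows "bounded_by (C + D) (a + b)"
  unfolding bounded_by_def
proof (intro ballI)
  fix x \<xi> assume x: "x \<in> units G" "\<xi> \<in> Hx \<Sigma> G x"
  have "Hx_norm \<Sigma> G x (a x \<xi> + b x \<xi>) \<le> Hx_norm \<Sigma> G x (a x \<xi>) + Hx_norm \<Sigma> G x (b x \<xi>)"
    using assms(1,2) x by (intro Hx_add) (auto simp: linear_family_def intro: linear_opD)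
  also have "\<dots> \<le> C * Hx_norm \<Sigma> G x \<xi> + D * Hx_norm \<Sigma> G x \<xi>"
    using assms(3,4) x unfolding bounded_by_def by (intro add_mono) auto
  finally show "Hx_norm \<Sigma> G x ((a + b) x \<xi>) \<le> (C + D) * Hx_norm \<Sigma> G x \<xi>"
    by (simp add: algebra_simps)
qed

lemma bounded_by_diff:
  assumes "linear_family a" "linear_family b" "bounded_by C a" "bounded_by D b"
  shows "bounded_by (C + D) (a - b)"
  unfolding bounded_by_def
proof (intro ballI)
  fix x \<xi> assume x: "x \<in> units G" "\<xi> \<in> Hx \<Sigma> G x"
  have "Hx_norm \<Sigma> G x (a x \<xi> - b x \<xi>) \<le> Hx_norm \<Sigma> G x (a x \<xi>) + Hx_norm \<Sigma> G x (b x \<xi>)"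
    using assms(1,2) x by (intro Hx_diff) (auto simp: linear_family_def intro: linear_opD)
  also have "\<dots> \<le> C * Hx_norm \<Sigma> G x \<xi> + D * Hx_norm \<Sigma> G x \<xi>"
    using assms(3,4) x unfolding bounded_by_def by (intro add_mono) auto
  finally show "Hx_norm \<Sigma> G x ((a - b) x \<xi>) \<le> (C + D) * Hx_norm \<Sigma> G x \<xi>"
    by (simp add: algebra_simps)
qed

lemma bounded_by_scale:
  assumes "linear_family a" "bounded_by C a"
  shows "bounded_by (cmod c * C) (fam_scale c a)"
  unfolding bounded_by_def
proof (intro ballI)
  fix x \<xi> assume x: "x \<in> units G" "\<xi> \<in> Hx \<Sigma> G x"
  have "Hx_norm \<Sigma> G x (fam_scale c a x \<xi>) \<le> cmod c * Hx_norm \<Sigma> G x (a x \<xi>)"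
    unfolding fam_scale_def
    using assms(1) x by (intro Hx_scale) (auto simp: linear_family_def intro: linear_opD)
  also have "\<dots> \<le> cmod c * (C * Hx_norm \<Sigma> G x \<xi>)"
    using assms(2) x unfolding bounded_by_def by (intro mult_left_mono) auto
  finally show "Hx_norm \<Sigma> G x (fam_scale c a x \<xi>) \<le> cmod c * C * Hx_norm \<Sigma> G x \<xi>"
    by (simp add: algebra_simps)
qed

lemma bounded_by_mult:
  assumes "linear_family a" "linear_family b" "bounded_by C a" "bounded_by D b" "C \<ge> 0"
  shows "bounded_by (C * D) (fam_mult a b)"
  unfolding bounded_by_def
proof (intro ballI)
  fix x \<xi> assume x: "x \<in> units G" "\<xi> \<in> Hx \<Sigma> G x"
  have "Hx_norm \<Sigma> G x (a x (b x \<xi>)) \<le> C * Hx_norm \<Sigma> G x (b x \<xi>)"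
    using assms(2,3) x unfolding bounded_by_def by (auto simp: linear_family_def intro: linear_opD)
  also have "\<dots> \<le> C * (D * Hx_norm \<Sigma> G x \<xi>)"
    using assms(4,5) x unfolding bounded_by_def by (intro mult_left_mono) auto
  finally show "Hx_norm \<Sigma> G x (fam_mult a b x \<xi>) \<le> C * D * Hx_norm \<Sigma> G x \<xi>"
    by (simp add: fam_mult_def algebra_simps)
qed

lemma linear_family_zero: "linear_family 0"
  unfolding linear_family_def by (simp add: linear_op_zero)

lemma linear_family_add: "\<lbrakk>linear_family a; linear_family b\<rbrakk> \<Longrightarrow> linear_family (a + b)"
  unfolding linear_family_def by (auto intro: linear_op_add)

lemma linear_family_diff: "\<lbrakk>linear_family a; linear_family b\<rbrakk> \<Longrightarrow> linear_family (a - b)"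
  unfolding linear_family_def by (auto intro: linear_op_diff)

lemma linear_family_scale: "linear_family a \<Longrightarrow> linear_family (fam_scale c a)"
  unfolding linear_family_def fam_scale_def by (auto intro: linear_op_scale simp: fun_eq_iff)

lemma linear_family_mult: "\<lbrakk>linear_family a; linear_family b\<rbrakk> \<Longrightarrow> linear_family (fam_mult a b)"
  unfolding linear_family_def fam_mult_def by (auto intro: linear_op_comp simp: fun_eq_iff)

lemma op_families_zero: "0 \<in> op_families \<Sigma> G"
  using op_families_iff linear_family_zero bounded_by_zero by blast

lemma op_families_add: "\<lbrakk>a \<in> op_families \<Sigma> G; b \<in> op_families \<Sigma> G\<rbrakk> \<Longrightarrow> a + b \<in> op_families \<Sigma> G"
  using linear_family_add bounded_by_add unfolding op_families_iff by (meson add_nonneg_nonneg)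

lemma op_families_diff: "\<lbrakk>a \<in> op_families \<Sigma> G; b \<in> op_families \<Sigma> G\<rbrakk> \<Longrightarrow> a - b \<in> op_families \<Sigma> G"
  using linear_family_diff bounded_by_diff unfolding op_families_iff by (meson add_nonneg_nonneg)

lemma op_families_scale: "a \<in> op_families \<Sigma> G \<Longrightarrow> fam_scale c a \<in> op_families \<Sigma> G"
  using linear_family_scale bounded_by_scale unfolding op_families_iff
  by (meson mult_nonneg_nonneg norm_ge_zero)

lemma op_families_mult: "\<lbrakk>a \<in> op_families \<Sigma> G; b \<in> op_families \<Sigma> G\<rbrakk> \<Longrightarrow> fam_mult a b \<in> op_families \<Sigma> G"
  using linear_family_mult bounded_by_mult unfolding op_families_iff by (meson mult_nonneg_nonneg)

text \<open>The twisted point mass at \<tau>: it lives on the circle orbit of \<tau> and equals z at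
  z\<tau>. With one \<tau> chosen over each arrow of source x these vectors form an orthonormal
  basis of the Hilbert space at x.\<close>

definition delta :: "'s \<Rightarrow> 's \<Rightarrow> complex" where
  "delta \<tau> \<sigma> = (if \<sigma> \<in> arr \<Sigma> \<and> proj \<Sigma> \<sigma> = proj \<Sigma> \<tau>
     then THE z. cmod z = 1 \<and> \<sigma> = circle_act \<Sigma> z \<tau> else 0)"

lemma delta_act [simp]: "\<lbrakk>\<tau> \<in> arr \<Sigma>; cmod z = 1\<rbrakk> \<Longrightarrow> delta \<tau> (circle_act \<Sigma> z \<tau>) = z"
  unfolding delta_def by (auto intro!: the_equality dest: act_inj)

lemma delta_self [simp]: "\<tau> \<in> arr \<Sigma> \<Longrightarrow> delta \<tau> \<tau> = 1"
  using delta_act[of \<tau> 1] by simp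

lemma delta_eq_0: "proj \<Sigma> \<sigma> \<noteq> proj \<Sigma> \<tau> \<Longrightarrow> delta \<tau> \<sigma> = 0"
  unfolding delta_def by simp

lemma twisted_fun_delta:
  assumes "\<tau> \<in> src_fibre \<Sigma> x"
  shows "twisted_fun x (delta \<tau>)"
  unfolding twisted_fun_def
proof (intro conjI allI ballI impI)
  fix \<sigma> assume "\<sigma> \<notin> src_fibre \<Sigma> x"
  then show "delta \<tau> \<sigma> = 0" using assms unfolding delta_def src_fibre_iff by auto
next
  fix \<sigma> z assume s: "\<sigma> \<in> src_fibre \<Sigma> x" "z \<in> sphere (0::complex) 1"
  have a: "\<sigma> \<in> arr \<Sigma>" "\<tau> \<in> arr \<Sigma>" "cmod z = 1" using s assms by (auto simp: src_fibre_iff)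
  show "delta \<tau> (circle_act \<Sigma> z \<sigma>) = z * delta \<tau> \<sigma>"
  proof (cases "proj \<Sigma> \<sigma> = proj \<Sigma> \<tau>")
    case True
    then obtain w where w: "cmod w = 1" "\<sigma> = circle_act \<Sigma> w \<tau>" using proj_eqE a by metis
    then have "circle_act \<Sigma> z \<sigma> = circle_act \<Sigma> (z * w) \<tau>" using a by (simp add: act_act)
    then show ?thesis using w a by (simp add: norm_mult)
  qed (use a in \<open>simp add: delta_eq_0\<close>)
qed

lemma delta_Hx:
  assumes "\<tau> \<in> src_fibre \<Sigma> x"
  shows "delta \<tau> \<in> Hx \<Sigma> G x" "Hx_norm \<Sigma> G x (delta \<tau>) \<le> 1"
proof -
  have t: "\<tau> \<in> arr \<Sigma>" using assms by (auto simp: src_fibre_iff)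
  have le: "l2sum (delta \<tau>) F \<le> 1" if F: "finite F" "F \<subseteq> gfibre x" for F
  proof -
    have z: "cmod (delta \<tau> (lift \<Sigma> \<gamma>)) = (if \<gamma> = proj \<Sigma> \<tau> then 1 else 0)" if "\<gamma> \<in> F" for \<gamma>
    proof -
      have g: "\<gamma> \<in> arr G" using that F by auto
      show ?thesis
      proof (cases "\<gamma> = proj \<Sigma> \<tau>")
        case True
        then have "cmod (delta \<tau> (lift \<Sigma> \<gamma>)) = cmod (delta \<tau> \<tau>)"
          by (intro twisted_fun_cmod[OF twisted_fun_delta[OF assms]]) (use g t in auto)
        then show ?thesis using True t by simp
      qed (use g in \<open>simp add: delta_eq_0\<close>)
    qed
    have "(\<Sum>\<gamma>\<in>F. (cmod (delta \<tau> (lift \<Sigma> \<gamma>)))\<^sup>2) = (\<Sum>\<gamma>\<in>F. if \<gamma> = proj \<Sigma> \<tau> then 1 else 0)"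
      by (rule sum.cong) (simp_all add: z)
    also have "\<dots> \<le> 1" using F by simp
    finally show ?thesis unfolding L2_set_def by simp
  qed
  show "delta \<tau> \<in> Hx \<Sigma> G x" "Hx_norm \<Sigma> G x (delta \<tau>) \<le> 1"
    using HxI[OF twisted_fun_delta[OF assms], of 1] le by auto
qed

text \<open>Truncation to finitely many arrows: summability of the squares leaves a tail whose sum
  is at most e^2.\<close>

lemma Hx_finite_approx:
  assumes "\<xi> \<in> Hx \<Sigma> G x" "e > 0"
  obtains F where "finite F" "F \<subseteq> gfibre x"
    "(\<lambda>\<sigma>. if proj \<Sigma> \<sigma> \<in> F then \<xi> \<sigma> else 0) \<in> Hx \<Sigma> G x"
    "Hx_norm \<Sigma> G x (\<xi> - (\<lambda>\<sigma>. if proj \<Sigma> \<sigma> \<in> F then \<xi> \<sigma> else 0)) \<le> e"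
proof -
  let ?f = "\<lambda>\<gamma>. (cmod (\<xi> (lift \<Sigma> \<gamma>)))\<^sup>2"
  have s: "?f summable_on gfibre x" using assms(1) by (simp add: Hx_def)
  obtain F where F: "finite F" "F \<subseteq> gfibre x" and d: "dist (sum ?f F) (infsum ?f (gfibre x)) \<le> e\<^sup>2 / 2"
    using infsum_finite_approximation[OF s, of "e\<^sup>2 / 2"] assms(2) by auto
  have "e\<^sup>2 / 2 \<le> e\<^sup>2" by simp
  with d have Fs: "infsum ?f (gfibre x) \<le> sum ?f F + e\<^sup>2" unfolding dist_real_def by linarith
  let ?c = "\<lambda>\<sigma>. if proj \<Sigma> \<sigma> \<in> F then \<xi> \<sigma> else 0"
  have "twisted_fun x (\<xi> - ?c)"
    using Hx_twisted[OF assms(1)] unfolding twisted_fun_def by (auto simp: src_fibre_iff)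
  moreover have "l2sum (\<xi> - ?c) F' \<le> e" if F': "finite F'" "F' \<subseteq> gfibre x" for F'
  proof -
    have "(\<Sum>\<gamma>\<in>F'. (cmod ((\<xi> - ?c) (lift \<Sigma> \<gamma>)))\<^sup>2) = (\<Sum>\<gamma>\<in>F'. if \<gamma> \<in> F then 0 else ?f \<gamma>)"
      using F' by (intro sum.cong) auto
    also have "\<dots> = sum ?f (F' - F)"
      using F' by (simp add: sum.If_cases Diff_eq Collect_neg_eq)
    also have "\<dots> = sum ?f ((F' - F) \<union> F) - sum ?f F"
      using F F' by (subst sum.union_disjoint) auto
    also have "sum ?f ((F' - F) \<union> F) \<le> infsum ?f (gfibre x)"
      using F F' by (intro finite_sum_le_infsum[OF s]) auto
    finally have "(\<Sum>\<gamma>\<in>F'. (cmod ((\<xi> - ?c) (lift \<Sigma> \<gamma>)))\<^sup>2) \<le> e\<^sup>2" using Fs by linarith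
    then show ?thesis unfolding L2_set_def using assms(2) by (simp add: real_le_lsqrt)
  qed
  ultimately have d: "\<xi> - ?c \<in> Hx \<Sigma> G x" "Hx_norm \<Sigma> G x (\<xi> - ?c) \<le> e"
    using HxI[of x "\<xi> - ?c" e] assms(2) by auto
  have "?c = \<xi> - (\<xi> - ?c)" by simp
  then have "?c \<in> Hx \<Sigma> G x" using Hx_diff(1)[OF assms(1) d(1)] by argo
  then show ?thesis using that F d by blast
qed

text \<open>Truncations of a vector are finite combinations of point masses, so the operator kills
  them; boundedness carries this to the limit.\<close>

lemma linear_op_eq_0:
  assumes T: "linear_op x T" and C: "\<And>\<xi>. \<xi> \<in> Hx \<Sigma> G x \<Longrightarrow> Hx_norm \<Sigma> G x (T \<xi>) \<le> C * Hx_norm \<Sigma> G x \<xi>"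
    and d: "\<And>\<tau>. \<tau> \<in> src_fibre \<Sigma> x \<Longrightarrow> T (delta \<tau>) = 0"
  shows "T = 0"
proof
  fix \<xi>
  show "T \<xi> = 0 \<xi>"
  proof (cases "\<xi> \<in> Hx \<Sigma> G x")
    case xi: True
    define c where "c F = (\<lambda>\<sigma>. if proj \<Sigma> \<sigma> \<in> F then \<xi> \<sigma> else 0)" for F
    have fin: "c F \<in> Hx \<Sigma> G x \<and> T (c F) = 0" if "finite F" "F \<subseteq> gfibre x" for F
      using that
    proof (induction F)
      case empty
      have "c {} = 0" by (simp add: c_def fun_eq_iff)
      then show ?case using T by (metis Hx_zero linear_op_zero_arg)
    next
      case (insert \<gamma> F)
      let ?l = "lift \<Sigma> \<gamma>"
      have g: "\<gamma> \<in> arr G" "src G \<gamma> = x" using insert by auto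
      then have l: "?l \<in> arr \<Sigma>" "?l \<in> src_fibre \<Sigma> x" by (auto simp: src_fibre_iff)
      \<comment> \<open>On the orbit over \<gamma> the vector is its value at the lift times the
        point mass there; off this orbit the point mass vanishes.\<close>
      have split: "c (insert \<gamma> F) = c F + (\<lambda>\<sigma>. \<xi> ?l * delta ?l \<sigma>)"
      proof
        fix \<sigma>
        show "c (insert \<gamma> F) \<sigma> = (c F + (\<lambda>\<sigma>. \<xi> ?l * delta ?l \<sigma>)) \<sigma>"
        proof (cases "\<sigma> \<in> arr \<Sigma> \<and> proj \<Sigma> \<sigma> = \<gamma>")
          case True
          then obtain w where w: "cmod w = 1" "\<sigma> = circle_act \<Sigma> w ?l"
            using proj_eqE[OF l(1)] g by (metis proj_lift)
          then have "\<xi> \<sigma> = w * \<xi> ?l"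
            using Hx_twisted[OF xi] l unfolding twisted_fun_def by auto
          then show ?thesis using True insert w l by (simp add: c_def)
        next
          case False
          have "\<sigma> \<notin> arr \<Sigma> \<Longrightarrow> \<xi> \<sigma> = 0"
            using Hx_twisted[OF xi] unfolding twisted_fun_def src_fibre_iff by auto
          then show ?thesis using False g by (auto simp: c_def delta_def)
        qed
      qed
      have F: "c F \<in> Hx \<Sigma> G x" "T (c F) = 0" using insert by auto
      note dl = delta_Hx(1)[OF l(2)]
      have "T (c (insert \<gamma> F)) = (\<lambda>\<sigma>. \<xi> ?l * T (delta ?l) \<sigma>)"
        unfolding split linear_opD(2)[OF T F(1) Hx_scale(1)[OF dl]] linear_opD(3)[OF T dl] F(2) by simp
      also have "\<dots> = 0" unfolding d[OF l(2)] by (simp add: fun_eq_iff)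
      finally show ?case unfolding split using Hx_add(1)[OF F(1) Hx_scale(1)[OF dl]] by blast
    qed
    \<comment> \<open>The absolute value covers a negative \<open>C\<close>, whose sign is left
      open.\<close>
    have C': "Hx_norm \<Sigma> G x (T \<xi>) \<le> \<bar>C\<bar> * e" if e: "e > 0" for e
    proof -
      obtain F where F: "finite F" "F \<subseteq> gfibre x" "c F \<in> Hx \<Sigma> G x" "Hx_norm \<Sigma> G x (\<xi> - c F) \<le> e"
        using Hx_finite_approx[OF xi e, folded c_def] by blast
      have "T \<xi> = T (\<xi> - c F)" using linear_op_diff_arg[OF T xi F(3)] fin[OF F(1,2)] by simp
      then have "Hx_norm \<Sigma> G x (T \<xi>) \<le> C * Hx_norm \<Sigma> G x (\<xi> - c F)"
        using C[OF Hx_diff(1)[OF xi F(3)]] by simp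
      also have "\<dots> \<le> \<bar>C\<bar> * e" using F(4) by (intro mult_mono) auto
      finally show ?thesis .
    qed
    have "Hx_norm \<Sigma> G x (T \<xi>) \<le> 0"
    proof (rule ccontr)
      let ?n = "Hx_norm \<Sigma> G x (T \<xi>)"
      assume "\<not> ?n \<le> 0"
      then have n: "?n > 0" by simp
      \<comment> \<open>This tolerance makes the bound strictly smaller than \<open>?n\<close>; the
        summand 1 keeps the denominator positive when \<open>C\<close> is zero.\<close>
      have "?n \<le> \<bar>C\<bar> * (?n / (\<bar>C\<bar> + 1))" by (rule C') (use n in simp)
      also have "\<dots> < ?n" using n by (simp add: field_simps)
      finally show False by simp
    qed
    then have "T \<xi> = 0" using Hx_norm_eq_0 linear_opD(1)[OF T xi] by blast
    then show ?thesis by simp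
  qed (use linear_opD(4)[OF T] in simp)
qed

lemma linear_op_ext:
  assumes "a \<in> op_families \<Sigma> G" "b \<in> op_families \<Sigma> G"
    and "\<And>\<tau>. \<tau> \<in> src_fibre \<Sigma> x \<Longrightarrow> a x (delta \<tau>) = b x (delta \<tau>)"
  shows "a x = b x"
proof (cases "x \<in> units G")
  case True
  obtain C where C: "bounded_by C (a - b)" and l: "linear_family (a - b)"
    using op_families_diff[OF assms(1,2)] unfolding op_families_iff by blast
  have "(a - b) x = 0"
  proof (rule linear_op_eq_0)
    show "linear_op x ((a - b) x)" using l True by (simp add: linear_family_def)
    show "Hx_norm \<Sigma> G x ((a - b) x \<xi>) \<le> C * Hx_norm \<Sigma> G x \<xi>" if "\<xi> \<in> Hx \<Sigma> G x" for \<xi>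
      using C True that unfolding bounded_by_def by blast
  qed (use assms(3) in auto)
  then show ?thesis by simp
qed (use assms(1,2) in \<open>simp add: op_families_def\<close>)

end

section \<open>Etale groupoids and the regular representation\<close>

locale etale_twist = twisted_groupoid G \<Sigma>
  for G :: "('g, 'm) groupoid_scheme" and \<Sigma> :: "('s, 'g) twist" +
  assumes etale: "etale_groupoid G"
begin

section \<open>Topology of the etale groupoid and of the twist\<close>

lemma Hausdorff_G: "Hausdorff_space (gtop G)"
  and continuous_rng_G: "continuous_map (gtop G) (gtop G) (rng G)"
  and continuous_src_G: "continuous_map (gtop G) (gtop G) (src G)"
  and Hausdorff_\<Sigma>: "Hausdorff_space (gtop \<Sigma>)"
  and locally_compact_\<Sigma>: "locally_compact_space (gtop \<Sigma>)"
  and locally_compact_G: "locally_compact_space (gtop G)"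
  and continuous_rng_\<Sigma>: "continuous_map (gtop \<Sigma>) (gtop \<Sigma>) (rng \<Sigma>)"
  and continuous_src_\<Sigma>: "continuous_map (gtop \<Sigma>) (gtop \<Sigma>) (src \<Sigma>)"
  and continuous_ginv_\<Sigma>: "continuous_map (gtop \<Sigma>) (gtop \<Sigma>) (ginv \<Sigma>)"
  and continuous_gmul_\<Sigma>: "continuous_map
       (subtopology (prod_topology (gtop \<Sigma>) (gtop \<Sigma>)) {(a, b). src \<Sigma> a = rng \<Sigma> b})
       (gtop \<Sigma>) (\<lambda>(a, b). gmul \<Sigma> a b)"
  and continuous_proj: "continuous_map (gtop \<Sigma>) (gtop G) (proj \<Sigma>)"
  and open_map_proj: "open_map (gtop \<Sigma>) (gtop G) (proj \<Sigma>)"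
  using twist unfolding is_twist_def lch_groupoid_def by blast+

lemma ex_bisection:
  assumes "openin (gtop G) W" "a \<in> W"
  obtains B where "open_bisection G B" "a \<in> B" "B \<subseteq> W"
  using etale assms unfolding etale_groupoid_def by blast

lemma bisectionD:
  assumes "open_bisection G B"
  shows "openin (gtop G) B" "B \<subseteq> arr G" "inj_on (rng G) B" "inj_on (src G) B"
    "openin (unit_top G) (src G ` B)" "openin (unit_top G) (rng G ` B)"
proof -
  show o: "openin (gtop G) B" "openin (unit_top G) (src G ` B)" "openin (unit_top G) (rng G ` B)"
    using assms unfolding open_bisection_def by blast+
  from o(1) show B: "B \<subseteq> arr G" by (rule openin_subset)
  then have "topspace (subtopology (gtop G) B) = B" by (simp add: Int_absorb1)
  then show "inj_on (rng G) B" "inj_on (src G) B"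
    using assms homeomorphic_imp_injective_map unfolding open_bisection_def by metis+
qed

text \<open>Let B be a bisection around a unit u. An arrow \<gamma> in B with r(\<gamma>) in B has
  the same range as r(\<gamma>), so injectivity of the range map on B forces \<gamma> = r(\<gamma>).
  These arrows form an open neighbourhood of u.\<close>

lemma openin_units: "openin (gtop G) (units G)"
proof (subst openin_subopen, intro ballI)
  fix u assume u: "u \<in> units G"
  obtain B where B: "open_bisection G B" "u \<in> B" using ex_bisection[of "arr G" u] u by auto
  let ?B = "B \<inter> {\<gamma> \<in> arr G. rng G \<gamma> \<in> B}"
  have "openin (gtop G) ?B"
    using openin_continuous_map_preimage[OF continuous_rng_G] bisectionD[OF B(1)] by (intro openin_Int) auto
  moreover have "u \<in> ?B" using B u by simp
  moreover have "?B \<subseteq> units G"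
  proof
    fix \<gamma> assume g: "\<gamma> \<in> ?B"
    then have "\<gamma> \<in> arr G" "rng G \<gamma> = \<gamma>" using inj_onD[OF bisectionD(3)[OF B(1)], of "rng G \<gamma>" \<gamma>] by auto
    then show "\<gamma> \<in> units G" unfolding base.units_eq by blast
  qed
  ultimately show "\<exists>T. openin (gtop G) T \<and> u \<in> T \<and> T \<subseteq> units G" by blast
qed

lemma openin_unit_top: "openin (unit_top G) V \<longleftrightarrow> openin (gtop G) V \<and> V \<subseteq> units G"
  unfolding unit_top_def by (rule openin_open_subtopology[OF openin_units])

text \<open>Units are the fixed points of the continuous range map on a Hausdorff space.\<close>

lemma closedin_units: "closedin (gtop G) (units G)"
proof -
  have "closedin (gtop G) {x \<in> arr G. rng G x = id x}"
    by (rule closedin_continuous_maps_eq[OF Hausdorff_G continuous_rng_G]) (simp add: id_def)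
  then show ?thesis unfolding base.units_eq id_def .
qed

lemma open_map_src: "openin (gtop G) O' \<Longrightarrow> openin (gtop G) (src G ` O')"
proof (subst openin_subopen, intro ballI)
  fix y assume O': "openin (gtop G) O'" and "y \<in> src G ` O'"
  then obtain a where a: "a \<in> O'" "y = src G a" by blast
  obtain B where B: "open_bisection G B" "a \<in> B" "B \<subseteq> O'" using ex_bisection[OF O' a(1)] .
  then have "openin (gtop G) (src G ` B)" using bisectionD openin_unit_top by blast
  then show "\<exists>T. openin (gtop G) T \<and> y \<in> T \<and> T \<subseteq> src G ` O'" using B a by blast
qed

lemma open_map_rng: "openin (gtop G) O' \<Longrightarrow> openin (gtop G) (rng G ` O')"
proof (subst openin_subopen, intro ballI)
  fix y assume O': "openin (gtop G) O'" and "y \<in> rng G ` O'"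
  then obtain a where a: "a \<in> O'" "y = rng G a" by blast
  obtain B where B: "open_bisection G B" "a \<in> B" "B \<subseteq> O'" using ex_bisection[OF O' a(1)] .
  then have "openin (gtop G) (rng G ` B)" using bisectionD openin_unit_top by blast
  then show "\<exists>T. openin (gtop G) T \<and> y \<in> T \<and> T \<subseteq> rng G ` O'" using B a by blast
qed

text \<open>Finitely many bisections cover K, and each contains at most one arrow with a given range
  or a given source. Their number serves as the bound N for both kinds of fibres.\<close>

lemma compact_fibres_bounded:
  assumes "compactin (gtop G) K"
  obtains N where "\<And>y. finite {\<gamma> \<in> K. rng G \<gamma> = y}" "\<And>y. card {\<gamma> \<in> K. rng G \<gamma> = y} \<le> N"
    "\<And>y. finite {\<gamma> \<in> K. src G \<gamma> = y}" "\<And>y. card {\<gamma> \<in> K. src G \<gamma> = y} \<le> N"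
proof -
  have "K \<subseteq> \<Union> {B. open_bisection G B}"
    using compactin_subset_topspace[OF assms] ex_bisection[OF openin_topspace] by blast
  then obtain \<F> where \<F>: "finite \<F>" "\<F> \<subseteq> {B. open_bisection G B}" "K \<subseteq> \<Union>\<F>"
    using assms bisectionD(1) unfolding compactin_def by (metis mem_Collect_eq)
  have *: "finite {\<gamma> \<in> K. h \<gamma> = y} \<and> card {\<gamma> \<in> K. h \<gamma> = y} \<le> card \<F>"
    if h: "\<And>B. B \<in> \<F> \<Longrightarrow> inj_on h B" for h :: "'g \<Rightarrow> 'g" and y
  proof -
    \<comment> \<open>Each bisection is sent to its arrow over \<open>y\<close>, unique if it
      exists; so the fibre is covered by an image of the finite cover.\<close>
    have sub: "{\<gamma> \<in> K. h \<gamma> = y} \<subseteq> (\<lambda>B. SOME \<gamma>. \<gamma> \<in> B \<and> h \<gamma> = y) ` \<F>"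
    proof
      fix \<gamma> assume g: "\<gamma> \<in> {\<gamma> \<in> K. h \<gamma> = y}"
      then obtain B where B: "B \<in> \<F>" "\<gamma> \<in> B" using \<F> by blast
      have "(SOME \<gamma>. \<gamma> \<in> B \<and> h \<gamma> = y) = \<gamma>"
        using g B h[OF B(1)] by (intro some_equality) (auto dest: inj_onD)
      then show "\<gamma> \<in> (\<lambda>B. SOME \<gamma>. \<gamma> \<in> B \<and> h \<gamma> = y) ` \<F>" using B(1) by force
    qed
    then show ?thesis using \<F>(1) by (meson card_image_le card_mono finite_imageI finite_subset le_trans)
  qed
  show ?thesis
    by (rule that[of "card \<F>"]; use *[of "rng G"] *[of "src G"] \<F> bisectionD(3,4) in blast)
qed

text \<open>Stated on all arrows, unlike \<open>twisted_fun\<close>, so that it covers both kinds of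
  factors of a convolution: functions in \<open>Cc\<close> and vectors of a fibre Hilbert
  space.\<close>

definition equivariant :: "('s \<Rightarrow> complex) \<Rightarrow> bool" where
  "equivariant f \<longleftrightarrow> (\<forall>\<sigma>\<in>arr \<Sigma>. \<forall>z. cmod z = 1 \<longrightarrow> f (circle_act \<Sigma> z \<sigma>) = z * f \<sigma>)"

lemma equivariantD: "\<lbrakk>equivariant f; \<sigma> \<in> arr \<Sigma>; cmod z = 1\<rbrakk> \<Longrightarrow> f (circle_act \<Sigma> z \<sigma>) = z * f \<sigma>"
  unfolding equivariant_def by blast

lemma Cc_equivariant: "f \<in> Cc \<Sigma> \<Longrightarrow> equivariant f"
  unfolding Cc_def equivariant_def by simp

lemma twisted_fun_equivariant: "twisted_fun x \<xi> \<Longrightarrow> equivariant \<xi>"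
proof -
  assume t: "twisted_fun x \<xi>"
  have "\<xi> (circle_act \<Sigma> z \<sigma>) = z * \<xi> \<sigma>" if s: "\<sigma> \<in> arr \<Sigma>" "cmod z = 1" for \<sigma> z
  proof (cases "\<sigma> \<in> src_fibre \<Sigma> x")
    case False
    then have "circle_act \<Sigma> z \<sigma> \<notin> src_fibre \<Sigma> x" using s by (simp add: src_fibre_iff)
    then show ?thesis using False t unfolding twisted_fun_def by simp
  qed (use t s in \<open>simp add: twisted_fun_def\<close>)
  then show ?thesis unfolding equivariant_def by blast
qed

lemma Hx_equivariant: "\<xi> \<in> Hx \<Sigma> G x \<Longrightarrow> equivariant \<xi>"
  using Hx_twisted twisted_fun_equivariant by blast

lemma equivariant_cmod:
  assumes "equivariant f" "\<sigma> \<in> arr \<Sigma>" "\<tau> \<in> arr \<Sigma>" "proj \<Sigma> \<sigma> = proj \<Sigma> \<tau>"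
  shows "cmod (f \<sigma>) = cmod (f \<tau>)"
  using assms by (metis equivariantD mult_1 norm_mult proj_eqE)

text \<open>Changing the lift by z multiplies the first factor by z and the second by its inverse. A
  summand of the convolution may therefore be computed with any convenient lift.\<close>

lemma conv_term_lift:
  assumes "equivariant f" "equivariant g" "\<sigma> \<in> arr \<Sigma>" "\<tau> \<in> arr \<Sigma>" "\<tau>' \<in> arr \<Sigma>"
    "proj \<Sigma> \<tau> = proj \<Sigma> \<tau>'" "rng \<Sigma> \<tau> = rng \<Sigma> \<sigma>"
  shows "f \<tau>' * g (gmul \<Sigma> (ginv \<Sigma> \<tau>') \<sigma>) = f \<tau> * g (gmul \<Sigma> (ginv \<Sigma> \<tau>) \<sigma>)"
proof -
  obtain z where z: "cmod z = 1" "\<tau>' = circle_act \<Sigma> z \<tau>" using proj_eqE assms by metis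
  then have "z \<noteq> 0" by auto
  have "gmul \<Sigma> (ginv \<Sigma> \<tau>') \<sigma> = circle_act \<Sigma> (inverse z) (gmul \<Sigma> (ginv \<Sigma> \<tau>) \<sigma>)"
    using assms z by (simp add: ginv_act act_gmul_left norm_inverse)
  then have "g (gmul \<Sigma> (ginv \<Sigma> \<tau>') \<sigma>) = inverse z * g (gmul \<Sigma> (ginv \<Sigma> \<tau>) \<sigma>)"
    using assms z by (simp add: equivariantD norm_inverse)
  moreover have "f \<tau>' = z * f \<tau>" using assms z by (simp add: equivariantD)
  ultimately show ?thesis using \<open>z \<noteq> 0\<close> by simp
qed

lemma conv_eq_sum:
  assumes "\<sigma> \<in> arr \<Sigma>" "finite S" "S \<subseteq> {\<gamma> \<in> arr G. rng G \<gamma> = proj \<Sigma> (rng \<Sigma> \<sigma>)}"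
    and "\<And>\<gamma>. \<lbrakk>\<gamma> \<in> arr G; rng G \<gamma> = proj \<Sigma> (rng \<Sigma> \<sigma>); \<gamma> \<notin> S\<rbrakk>
      \<Longrightarrow> f (lift \<Sigma> \<gamma>) * g (gmul \<Sigma> (ginv \<Sigma> (lift \<Sigma> \<gamma>)) \<sigma>) = 0"
  shows "conv \<Sigma> G f g \<sigma> = (\<Sum>\<gamma>\<in>S. f (lift \<Sigma> \<gamma>) * g (gmul \<Sigma> (ginv \<Sigma> (lift \<Sigma> \<gamma>)) \<sigma>))"
proof -
  have "conv \<Sigma> G f g \<sigma> = infsum (\<lambda>\<gamma>. f (lift \<Sigma> \<gamma>) * g (gmul \<Sigma> (ginv \<Sigma> (lift \<Sigma> \<gamma>)) \<sigma>)) S"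
    unfolding conv_def by (rule infsum_cong_neutral) (use assms in auto)
  then show ?thesis using assms(2) by simp
qed

lemma rng_lift:
  assumes "\<gamma> \<in> arr G" "\<sigma> \<in> arr \<Sigma>" "rng G \<gamma> = proj \<Sigma> (rng \<Sigma> \<sigma>)"
  shows "rng \<Sigma> (lift \<Sigma> \<gamma>) = rng \<Sigma> \<sigma>"
  using assms by (simp add: rng_eq_rng_iff rng_proj)

lemma equivariant_conv:
  assumes "equivariant g"
  shows "equivariant (conv \<Sigma> G f g)"
  unfolding equivariant_def
proof (intro ballI allI impI)
  fix \<sigma> z assume s: "\<sigma> \<in> arr \<Sigma>" and z: "cmod z = 1"
  have "conv \<Sigma> G f g (circle_act \<Sigma> z \<sigma>) =
    (\<Sum>\<^sub>\<infinity>\<gamma>\<in>{\<gamma> \<in> arr G. rng G \<gamma> = proj \<Sigma> (rng \<Sigma> \<sigma>)}.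
        z * (f (lift \<Sigma> \<gamma>) * g (gmul \<Sigma> (ginv \<Sigma> (lift \<Sigma> \<gamma>)) \<sigma>)))"
    unfolding conv_def rng_act[OF s z]
    using s z assms by (intro infsum_cong) (auto simp: rng_lift act_gmul_right equivariantD)
  also have "\<dots> = z * conv \<Sigma> G f g \<sigma>" unfolding conv_def by (rule infsum_cmult_right')
  finally show "conv \<Sigma> G f g (circle_act \<Sigma> z \<sigma>) = z * conv \<Sigma> G f g \<sigma>" .
qed

text \<open>Only the arrow below \<rho>\<tau>^-1 contributes, since the point mass vanishes off the
  orbit of \<tau>. The values of f are thus the matrix coefficients of its operators.\<close>

lemma conv_delta:
  assumes f: "equivariant f" and \<rho>: "\<rho> \<in> src_fibre \<Sigma> x" and \<tau>: "\<tau> \<in> src_fibre \<Sigma> x"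
  shows "conv \<Sigma> G f (delta \<tau>) \<rho> = f (gmul \<Sigma> \<rho> (ginv \<Sigma> \<tau>))"
proof -
  have a: "\<rho> \<in> arr \<Sigma>" "\<tau> \<in> arr \<Sigma>" "src \<Sigma> \<rho> = src \<Sigma> \<tau>"
    using \<rho> \<tau> by (auto simp: src_fibre_iff src_eq_src_iff)
  let ?k = "gmul \<Sigma> \<rho> (ginv \<Sigma> \<tau>)"
  have k: "?k \<in> arr \<Sigma>" "rng \<Sigma> ?k = rng \<Sigma> \<rho>" using a by simp_all
  have gk: "gmul \<Sigma> (ginv \<Sigma> ?k) \<rho> = \<tau>"
    using a by (simp add: ext.ginv_gmul_rev ext.gmul_assoc)
  have e: "equivariant (delta \<tau>)" using twisted_fun_delta[OF \<tau>] twisted_fun_equivariant by blast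
  have "conv \<Sigma> G f (delta \<tau>) \<rho> = (\<Sum>\<gamma>\<in>{proj \<Sigma> ?k}. f (lift \<Sigma> \<gamma>) * delta \<tau> (gmul \<Sigma> (ginv \<Sigma> (lift \<Sigma> \<gamma>)) \<rho>))"
  proof (rule conv_eq_sum)
    fix \<gamma> assume g: "\<gamma> \<in> arr G" "rng G \<gamma> = proj \<Sigma> (rng \<Sigma> \<rho>)" "\<gamma> \<notin> {proj \<Sigma> ?k}"
    have l: "rng \<Sigma> (lift \<Sigma> \<gamma>) = rng \<Sigma> \<rho>" using rng_lift g a by simp
    have r: "rng G \<gamma> = rng G (proj \<Sigma> \<rho>)" using g a by (simp add: rng_proj)
    have s: "src G (proj \<Sigma> \<rho>) = src G (proj \<Sigma> \<tau>)" using a by (simp add: src_proj)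
    have "gmul G (ginv G \<gamma>) (proj \<Sigma> \<rho>) \<noteq> proj \<Sigma> \<tau>"
    proof
      assume "gmul G (ginv G \<gamma>) (proj \<Sigma> \<rho>) = proj \<Sigma> \<tau>"
      then have "\<gamma> = gmul G (proj \<Sigma> \<rho>) (ginv G (proj \<Sigma> \<tau>))"
        using g(1) r a s by (metis base.gmul_ginv_cancel base.gmul_ginv_cancel_right base.ginv_arr base.src_ginv base.gmul_arr base.rng_gmul base.rng_ginv proj_arr)
      then show False using g(3) a by simp
    qed
    then have "delta \<tau> (gmul \<Sigma> (ginv \<Sigma> (lift \<Sigma> \<gamma>)) \<rho>) = 0"
      using g l a by (intro delta_eq_0) simp
    then show "f (lift \<Sigma> \<gamma>) * delta \<tau> (gmul \<Sigma> (ginv \<Sigma> (lift \<Sigma> \<gamma>)) \<rho>) = 0" by simp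
  qed (use a k rng_proj[OF k(1)] in \<open>auto simp del: proj_gmul\<close>)
  \<comment> \<open>The chosen lift is exchanged for \<rho>\<tau>^-1 itself, for which the point
    mass is evaluated at \<tau> and gives 1.\<close>
  also have "\<dots> = f ?k * delta \<tau> (gmul \<Sigma> (ginv \<Sigma> ?k) \<rho>)"
    using k a by (simp del: proj_gmul, intro conv_term_lift[OF f e]) (auto simp del: proj_gmul)
  also have "\<dots> = f ?k" unfolding gk using a by simp
  finally show ?thesis .
qed

section \<open>Boundedness of the regular representation\<close>

lemma Cc_support:
  assumes "f \<in> Cc \<Sigma>"
  obtains K where "compactin (gtop \<Sigma>) K" "\<And>\<sigma>. f \<sigma> \<noteq> 0 \<Longrightarrow> \<sigma> \<in> K"
proof -
  let ?S = "{x \<in> arr \<Sigma>. f x \<noteq> 0}"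
  have "compactin (gtop \<Sigma>) (gtop \<Sigma> closure_of ?S)" "\<And>x. x \<notin> arr \<Sigma> \<Longrightarrow> f x = 0"
    using assms unfolding Cc_def compactly_supported_def by auto
  moreover have "?S \<subseteq> gtop \<Sigma> closure_of ?S" by (rule closure_of_subset) auto
  ultimately show ?thesis using that by blast
qed

lemma Cc_bounded:
  assumes "f \<in> Cc \<Sigma>"
  obtains C where "C \<ge> 0" "\<And>\<sigma>. cmod (f \<sigma>) \<le> C"
proof -
  obtain K where K: "compactin (gtop \<Sigma>) K" "\<And>\<sigma>. f \<sigma> \<noteq> 0 \<Longrightarrow> \<sigma> \<in> K" using Cc_support[OF assms] by blast
  have "continuous_map (gtop \<Sigma>) euclidean f" using assms unfolding Cc_def compactly_supported_def by auto
  then have "compactin euclidean (f ` K)" by (rule image_compactin[OF K(1)])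
  then have "compact (f ` K)" by simp
  then obtain C where "\<forall>v\<in>f ` K. cmod v \<le> C" using compact_imp_bounded[of "f ` K"] unfolding bounded_iff by blast
  then have "cmod (f \<sigma>) \<le> max C 0" for \<sigma> using K(2)[of \<sigma>] by (cases "f \<sigma> = 0") auto
  then show ?thesis using that[of "max C 0"] by auto
qed

lemma Cc_fibres:
  assumes "f \<in> Cc \<Sigma>"
  obtains K N where "K \<subseteq> arr G" "compactin (gtop G) K" "\<And>\<sigma>. f \<sigma> \<noteq> 0 \<Longrightarrow> proj \<Sigma> \<sigma> \<in> K"
    "\<And>y. finite {\<gamma> \<in> K. rng G \<gamma> = y}" "\<And>y. card {\<gamma> \<in> K. rng G \<gamma> = y} \<le> N"
    "\<And>y. finite {\<gamma> \<in> K. src G \<gamma> = y}" "\<And>y. card {\<gamma> \<in> K. src G \<gamma> = y} \<le> N"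
proof -
  obtain K where K: "compactin (gtop \<Sigma>) K" "\<And>\<sigma>. f \<sigma> \<noteq> 0 \<Longrightarrow> \<sigma> \<in> K" using Cc_support[OF assms] by blast
  have c: "compactin (gtop G) (proj \<Sigma> ` K)" by (rule image_compactin[OF K(1) continuous_proj])
  show ?thesis
    by (rule compact_fibres_bounded[OF c], rule that[OF compactin_subset_topspace[OF c] c])
      (use K(2) in auto)
qed

lemma conv_Cc_eq_sum:
  assumes "\<And>\<sigma>. f \<sigma> \<noteq> 0 \<Longrightarrow> proj \<Sigma> \<sigma> \<in> K" "K \<subseteq> arr G"
    "finite {\<gamma> \<in> K. rng G \<gamma> = proj \<Sigma> (rng \<Sigma> \<sigma>)}" "\<sigma> \<in> arr \<Sigma>"
  shows "conv \<Sigma> G f g \<sigma> = (\<Sum>\<gamma>\<in>{\<gamma> \<in> K. rng G \<gamma> = proj \<Sigma> (rng \<Sigma> \<sigma>)}.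
    f (lift \<Sigma> \<gamma>) * g (gmul \<Sigma> (ginv \<Sigma> (lift \<Sigma> \<gamma>)) \<sigma>))"
proof (rule conv_eq_sum)
  fix \<gamma> assume g: "\<gamma> \<in> arr G" "rng G \<gamma> = proj \<Sigma> (rng \<Sigma> \<sigma>)"
    "\<gamma> \<notin> {\<gamma> \<in> K. rng G \<gamma> = proj \<Sigma> (rng \<Sigma> \<sigma>)}"
  then have "f (lift \<Sigma> \<gamma>) = 0" using assms(1)[of "lift \<Sigma> \<gamma>"] by auto
  then show "f (lift \<Sigma> \<gamma>) * g (gmul \<Sigma> (ginv \<Sigma> (lift \<Sigma> \<gamma>)) \<sigma>) = 0" by simp
qed (use assms(2-4) in auto)

text \<open>The bound is C times N, with C a bound of |f| and N the fibre bound for its support.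
  Under the square, Cauchy-Schwarz costs one factor N, and counting how often an arrow recurs in the
  double sum costs another.\<close>

lemma reg_rep_bounded:
  assumes f: "f \<in> Cc \<Sigma>"
  obtains C where "C \<ge> 0" "\<And>x \<xi>. \<lbrakk>x \<in> units G; \<xi> \<in> Hx \<Sigma> G x\<rbrakk> \<Longrightarrow>
    reg_rep \<Sigma> G f x \<xi> \<in> Hx \<Sigma> G x \<and> Hx_norm \<Sigma> G x (reg_rep \<Sigma> G f x \<xi>) \<le> C * Hx_norm \<Sigma> G x \<xi>"
proof -
  obtain C where C: "C \<ge> 0" "\<And>\<sigma>. cmod (f \<sigma>) \<le> C" using Cc_bounded[OF f] by blast
  obtain K N where K: "K \<subseteq> arr G" "\<And>\<sigma>. f \<sigma> \<noteq> 0 \<Longrightarrow> proj \<Sigma> \<sigma> \<in> K"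
    "\<And>y. finite {\<gamma> \<in> K. rng G \<gamma> = y}" "\<And>y. card {\<gamma> \<in> K. rng G \<gamma> = y} \<le> N"
    "\<And>y. finite {\<gamma> \<in> K. src G \<gamma> = y}" "\<And>y. card {\<gamma> \<in> K. src G \<gamma> = y} \<le> N"
    by (rule Cc_fibres[OF f]) (rule that; assumption)
  have "reg_rep \<Sigma> G f x \<xi> \<in> Hx \<Sigma> G x \<and> Hx_norm \<Sigma> G x (reg_rep \<Sigma> G f x \<xi>) \<le> C * N * Hx_norm \<Sigma> G x \<xi>"
    if x: "x \<in> units G" and \<xi>: "\<xi> \<in> Hx \<Sigma> G x" for x \<xi>
  proof -
    let ?\<eta> = "reg_rep \<Sigma> G f x \<xi>"
    let ?n = "Hx_norm \<Sigma> G x \<xi>"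
    define w where "w \<gamma> = (cmod (\<xi> (lift \<Sigma> \<gamma>)))\<^sup>2" for \<gamma>
    define R where "R \<gamma> = {\<delta> \<in> K. rng G \<delta> = rng G \<gamma>}" for \<gamma>
    have \<eta>: "?\<eta> \<sigma> = (if \<sigma> \<in> src_fibre \<Sigma> x then conv \<Sigma> G f \<xi> \<sigma> else 0)" for \<sigma>
      using x \<xi> by (simp add: reg_rep_def)
    have t: "twisted_fun x ?\<eta>"
      using equivariant_conv[OF Hx_equivariant[OF \<xi>], of f] unfolding twisted_fun_def \<eta>
      by (auto simp: src_fibre_iff equivariantD)
    have term_bound: "(cmod (?\<eta> (lift \<Sigma> \<gamma>)))\<^sup>2 \<le> C\<^sup>2 * N * (\<Sum>\<delta>\<in>R \<gamma>. w (gmul G (ginv G \<delta>) \<gamma>))"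
      if \<gamma>: "\<gamma> \<in> gfibre x" for \<gamma>
    proof -
      let ?l = "lift \<Sigma> \<gamma>"
      have l: "?l \<in> src_fibre \<Sigma> x" "?l \<in> arr \<Sigma>" "proj \<Sigma> (rng \<Sigma> ?l) = rng G \<gamma>"
        using \<gamma> by (auto simp: src_fibre_iff rng_proj[symmetric])
      have "cmod (?\<eta> ?l) = cmod (\<Sum>\<delta>\<in>R \<gamma>. f (lift \<Sigma> \<delta>) * \<xi> (gmul \<Sigma> (ginv \<Sigma> (lift \<Sigma> \<delta>)) ?l))"
        unfolding \<eta> R_def using l conv_Cc_eq_sum[of f K ?l \<xi>] K(1-3) by simp
      also have "\<dots> \<le> (\<Sum>\<delta>\<in>R \<gamma>. C * cmod (\<xi> (lift \<Sigma> (gmul G (ginv G \<delta>) \<gamma>))))"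
      proof (rule sum_norm_le)
        fix \<delta> assume "\<delta> \<in> R \<gamma>"
        then have d: "\<delta> \<in> arr G" "rng G \<delta> = rng G \<gamma>" using K(1) by (auto simp: R_def)
        have r: "rng \<Sigma> (lift \<Sigma> \<delta>) = rng \<Sigma> ?l" using d l by (intro rng_lift) auto
        have "cmod (\<xi> (gmul \<Sigma> (ginv \<Sigma> (lift \<Sigma> \<delta>)) ?l)) = cmod (\<xi> (lift \<Sigma> (gmul G (ginv G \<delta>) \<gamma>)))"
          by (rule equivariant_cmod[OF Hx_equivariant[OF \<xi>]]) (use d l r \<gamma> in auto)
        then show "cmod (f (lift \<Sigma> \<delta>) * \<xi> (gmul \<Sigma> (ginv \<Sigma> (lift \<Sigma> \<delta>)) ?l))
            \<le> C * cmod (\<xi> (lift \<Sigma> (gmul G (ginv G \<delta>) \<gamma>)))"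
          using C by (simp add: norm_mult mult_right_mono)
      qed
      finally have "(cmod (?\<eta> ?l))\<^sup>2 \<le> (\<Sum>\<delta>\<in>R \<gamma>. C * cmod (\<xi> (lift \<Sigma> (gmul G (ginv G \<delta>) \<gamma>))))\<^sup>2"
        by (intro power_mono) auto
      \<comment> \<open>Cauchy-Schwarz against the constant 1; at most \<open>N\<close> arrows of
        \<open>K\<close> share a range.\<close>
      also have "\<dots> \<le> (\<Sum>\<delta>\<in>R \<gamma>. (C * cmod (\<xi> (lift \<Sigma> (gmul G (ginv G \<delta>) \<gamma>))))\<^sup>2) * card (R \<gamma>)"
        by (rule sum_squared_le_sum_of_squares)
      also have "\<dots> \<le> (\<Sum>\<delta>\<in>R \<gamma>. (C * cmod (\<xi> (lift \<Sigma> (gmul G (ginv G \<delta>) \<gamma>))))\<^sup>2) * N"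
        using K(4) unfolding R_def by (intro mult_left_mono sum_nonneg) auto
      also have "\<dots> = C\<^sup>2 * N * (\<Sum>\<delta>\<in>R \<gamma>. w (gmul G (ginv G \<delta>) \<gamma>))"
        by (simp add: w_def power_mult_distrib sum_distrib_left[symmetric] mult_ac)
      finally show ?thesis .
    qed
    have "l2sum ?\<eta> F \<le> C * N * ?n" if F: "finite F" "F \<subseteq> gfibre x" for F
    proof -
      define E where "E = (\<lambda>(\<gamma>, \<delta>). gmul G (ginv G \<delta>) \<gamma>) ` Sigma F R"
      define S where "S \<eta> = {\<delta> \<in> K. src G \<delta> = rng G \<eta>}" for \<eta>
      have fin: "finite (Sigma F R)" "finite E" "\<And>\<eta>. finite (S \<eta>)"
        using F K(3,5) unfolding E_def R_def S_def by auto
      have E: "E \<subseteq> gfibre x" using F K(1) unfolding E_def R_def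
        by (auto simp: subset_iff base.gmul_arr base.src_gmul)
      have "(\<Sum>\<gamma>\<in>F. (cmod (?\<eta> (lift \<Sigma> \<gamma>)))\<^sup>2) \<le> (\<Sum>\<gamma>\<in>F. C\<^sup>2 * N * (\<Sum>\<delta>\<in>R \<gamma>. w (gmul G (ginv G \<delta>) \<gamma>)))"
        using F term_bound by (intro sum_mono) auto
      also have "\<dots> = C\<^sup>2 * N * (\<Sum>\<gamma>\<in>F. \<Sum>\<delta>\<in>R \<gamma>. w (gmul G (ginv G \<delta>) \<gamma>))"
        by (simp add: sum_distrib_left)
      also have "(\<Sum>\<gamma>\<in>F. \<Sum>\<delta>\<in>R \<gamma>. w (gmul G (ginv G \<delta>) \<gamma>)) =
          (\<Sum>(\<gamma>, \<delta>)\<in>Sigma F R. w (gmul G (ginv G \<delta>) \<gamma>))"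
        by (rule sum.Sigma) (use F K(3) in \<open>auto simp: R_def\<close>)
      \<comment> \<open>The pair (\<gamma>, \<delta>) is replaced by (\<eta>, \<delta>) with \<eta>
        = \<delta>^-1\<gamma>, from which \<gamma> = \<delta>\<eta> is recovered. For fixed \<eta>
        only the arrows of \<open>K\<close> with source r(\<eta>) occur as \<delta>, at most
        \<open>N\<close> of them.\<close>
      also have "(\<Sum>(\<gamma>, \<delta>)\<in>Sigma F R. w (gmul G (ginv G \<delta>) \<gamma>)) \<le> (\<Sum>(\<eta>, \<delta>)\<in>Sigma E S. w \<eta>)"
      proof (rule sum_le_included[where i = "\<lambda>(\<eta>, \<delta>). (gmul G \<delta> \<eta>, \<delta>)"])
        show "\<forall>p\<in>Sigma F R. \<exists>q\<in>Sigma E S. (case q of (\<eta>, \<delta>) \<Rightarrow> (gmul G \<delta> \<eta>, \<delta>)) = p \<and>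
          (case p of (\<gamma>, \<delta>) \<Rightarrow> w (gmul G (ginv G \<delta>) \<gamma>)) \<le> (case q of (\<eta>, \<delta>) \<Rightarrow> w \<eta>)"
        proof
          fix p assume p: "p \<in> Sigma F R"
          then obtain \<gamma> \<delta> where pp: "p = (\<gamma>, \<delta>)" "\<gamma> \<in> F" "\<delta> \<in> R \<gamma>" by auto
          then have d: "\<gamma> \<in> arr G" "\<delta> \<in> arr G" "\<delta> \<in> K" "rng G \<delta> = rng G \<gamma>"
            using F K(1) unfolding R_def by auto
          have "(gmul G (ginv G \<delta>) \<gamma>, \<delta>) \<in> Sigma E S"
            using d pp unfolding E_def S_def by force
          moreover have "gmul G \<delta> (gmul G (ginv G \<delta>) \<gamma>) = \<gamma>" using d by simp
          ultimately show "\<exists>q\<in>Sigma E S. (case q of (\<eta>, \<delta>) \<Rightarrow> (gmul G \<delta> \<eta>, \<delta>)) = p \<and>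
              (case p of (\<gamma>, \<delta>) \<Rightarrow> w (gmul G (ginv G \<delta>) \<gamma>)) \<le> (case q of (\<eta>, \<delta>) \<Rightarrow> w \<eta>)"
            using pp by (intro bexI[of _ "(gmul G (ginv G \<delta>) \<gamma>, \<delta>)"]) auto
        qed
      qed (use fin in \<open>auto simp: w_def\<close>)
      also have "(\<Sum>(\<eta>, \<delta>)\<in>Sigma E S. w \<eta>) = (\<Sum>\<eta>\<in>E. card (S \<eta>) * w \<eta>)"
        using fin by (subst sum.Sigma[symmetric]) auto
      also have "\<dots> \<le> (\<Sum>\<eta>\<in>E. N * w \<eta>)"
        using K(6) unfolding S_def by (intro sum_mono mult_right_mono) (auto simp: w_def)
      also have "\<dots> = N * (\<Sum>\<eta>\<in>E. w \<eta>)" by (simp add: sum_distrib_left)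
      also have "(\<Sum>\<eta>\<in>E. w \<eta>) \<le> ?n\<^sup>2"
        using l2sum_le_Hx_norm[OF \<xi> fin(2) E] unfolding w_def L2_set_def by (simp add: sqrt_le_D)
      finally have "(\<Sum>\<gamma>\<in>F. (cmod (?\<eta> (lift \<Sigma> \<gamma>)))\<^sup>2) \<le> C\<^sup>2 * N * (N * ?n\<^sup>2)"
        by (simp add: mult_left_mono)
      also have "\<dots> = (C * N * ?n)\<^sup>2" by (simp add: power2_eq_square algebra_simps)
      finally show ?thesis using C(1) unfolding L2_set_def by (simp add: real_le_lsqrt)
    qed
    then show ?thesis using HxI[OF t, of "C * N * ?n"] C(1) by auto
  qed
  then show ?thesis using that[of "C * N"] C(1) by simp
qed

lemma reg_rep_op_families:
  assumes f: "f \<in> Cc \<Sigma>"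
  shows "reg_rep \<Sigma> G f \<in> op_families \<Sigma> G"
proof -
  obtain C where C: "C \<ge> 0" "\<And>x \<xi>. \<lbrakk>x \<in> units G; \<xi> \<in> Hx \<Sigma> G x\<rbrakk> \<Longrightarrow>
    reg_rep \<Sigma> G f x \<xi> \<in> Hx \<Sigma> G x \<and> Hx_norm \<Sigma> G x (reg_rep \<Sigma> G f x \<xi>) \<le> C * Hx_norm \<Sigma> G x \<xi>"
    using reg_rep_bounded[OF f] by blast
  obtain K where K: "K \<subseteq> arr G" "\<And>\<sigma>. f \<sigma> \<noteq> 0 \<Longrightarrow> proj \<Sigma> \<sigma> \<in> K"
    "\<And>y. finite {\<gamma> \<in> K. rng G \<gamma> = y}"
    by (rule Cc_fibres[OF f]) (rule that; assumption)
  \<comment> \<open>The finite index set depends on f and on the range of \<sigma> alone, which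
    makes the convolution linear in its second argument.\<close>
  have add: "conv \<Sigma> G f (\<xi> + \<eta>) \<sigma> = conv \<Sigma> G f \<xi> \<sigma> + conv \<Sigma> G f \<eta> \<sigma>" if "\<sigma> \<in> arr \<Sigma>" for \<xi> \<eta> \<sigma>
    by (simp add: conv_Cc_eq_sum[OF K(2,1,3) that] algebra_simps sum.distrib)
  have scale: "conv \<Sigma> G f (\<lambda>\<sigma>. c * \<xi> \<sigma>) \<sigma> = c * conv \<Sigma> G f \<xi> \<sigma>" if "\<sigma> \<in> arr \<Sigma>" for \<xi> c \<sigma>
    by (simp add: conv_Cc_eq_sum[OF K(2,1,3) that] algebra_simps sum_distrib_left)
  have "linear_op x (reg_rep \<Sigma> G f x)" if "x \<in> units G" for x
    unfolding linear_op_def using C(2)[OF that]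
    by (auto simp: reg_rep_def fun_eq_iff Hx_add Hx_scale that src_fibre_iff add scale)
  then have "linear_family (reg_rep \<Sigma> G f)"
    unfolding linear_family_def by (auto simp: reg_rep_def fun_eq_iff)
  then show ?thesis using C unfolding op_families_iff bounded_by_def by blast
qed

lemma reg_rep_delta:
  assumes "equivariant f" "\<rho> \<in> src_fibre \<Sigma> x" "\<tau> \<in> src_fibre \<Sigma> x"
  shows "reg_rep \<Sigma> G f x (delta \<tau>) \<rho> = f (gmul \<Sigma> \<rho> (ginv \<Sigma> \<tau>))"
  using conv_delta[OF assms] assms delta_Hx(1)[OF assms(3)] src_fibre_units[OF assms(2)]
  unfolding reg_rep_def by simp

end

section \<open>Convolution\<close>

lemma continuous_map_eps_iff:
  fixes h :: "'a \<Rightarrow> 'b::metric_space"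
  shows "continuous_map X euclidean h \<longleftrightarrow>
    (\<forall>x\<in>topspace X. \<forall>e>0. \<exists>U. openin X U \<and> x \<in> U \<and> (\<forall>y\<in>U. dist (h y) (h x) < e))"
proof (intro iffI ballI allI impI)
  fix x and e :: real assume c: "continuous_map X euclidean h" and x: "x \<in> topspace X" and e: "e > 0"
  have "openin X {y \<in> topspace X. h y \<in> ball (h x) e}"
    by (rule openin_continuous_map_preimage[OF c]) simp
  then show "\<exists>U. openin X U \<and> x \<in> U \<and> (\<forall>y\<in>U. dist (h y) (h x) < e)"
    using x e by (intro exI[of _ "{y \<in> topspace X. h y \<in> ball (h x) e}"]) (auto simp: dist_commute)
next
  assume r: "\<forall>x\<in>topspace X. \<forall>e>0. \<exists>U. openin X U \<and> x \<in> U \<and> (\<forall>y\<in>U. dist (h y) (h x) < e)"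
  show "continuous_map X euclidean h"
    unfolding continuous_map_def
  proof (intro conjI allI impI)
    fix O' :: "'b set" assume "openin euclidean O'"
    then have O': "open O'" by simp
    show "openin X {x \<in> topspace X. h x \<in> O'}"
    proof (subst openin_subopen, intro ballI)
      fix x assume x: "x \<in> {x \<in> topspace X. h x \<in> O'}"
      obtain e where e: "e > 0" "ball (h x) e \<subseteq> O'" using O' x by (auto simp: open_contains_ball)
      obtain U where U: "openin X U" "x \<in> U" "\<forall>y\<in>U. dist (h y) (h x) < e"
        using r[rule_format, of x e] x e(1) by auto
      have "U \<subseteq> {x \<in> topspace X. h x \<in> O'}"
      proof
        fix y assume y: "y \<in> U"
        then have "h y \<in> ball (h x) e" using U(3) by (metis dist_commute mem_ball)
        then show "y \<in> {x \<in> topspace X. h x \<in> O'}" using y e(2) openin_subset[OF U(1)] by blast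
      qed
      then show "\<exists>T. openin X T \<and> x \<in> T \<and> T \<subseteq> {x \<in> topspace X. h x \<in> O'}" using U by blast
    qed
  qed simp
qed

lemma continuous_map_uniform_approx:
  fixes h :: "'a \<Rightarrow> 'b::metric_space"
  assumes "\<And>e. e > 0 \<Longrightarrow> \<exists>k. continuous_map X euclidean k \<and> (\<forall>x\<in>topspace X. dist (h x) (k x) \<le> e)"
  shows "continuous_map X euclidean h"
  unfolding continuous_map_eps_iff
proof (intro ballI allI impI)
  fix x and e :: real assume x: "x \<in> topspace X" and e: "e > 0"
  obtain k where k: "continuous_map X euclidean k" "\<forall>x\<in>topspace X. dist (h x) (k x) \<le> e / 3"
    using assms[of "e / 3"] e by auto
  obtain U where U: "openin X U" "x \<in> U" "\<forall>y\<in>U. dist (k y) (k x) < e / 3"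
    using k(1)[unfolded continuous_map_eps_iff, rule_format, OF x, of "e / 3"] e by auto
  have "dist (h y) (h x) < e" if "y \<in> U" for y
  proof -
    have "dist (h y) (k y) \<le> e / 3" "dist (h x) (k x) \<le> e / 3" "dist (k y) (k x) < e / 3"
      using k(2) U that x openin_subset[OF U(1)] by auto
    then show ?thesis
      using dist_triangle[of "h y" "h x" "k y"] dist_triangle[of "k y" "h x" "k x"]
      by (simp add: dist_commute)
  qed
  then show "\<exists>U. openin X U \<and> x \<in> U \<and> (\<forall>y\<in>U. dist (h y) (h x) < e)" using U by blast
qed

lemma continuous_map_normed_mult:
  fixes f g :: "'a \<Rightarrow> 'b::real_normed_algebra"
  shows "\<lbrakk>continuous_map X euclidean f; continuous_map X euclidean g\<rbrakk>
    \<Longrightarrow> continuous_map X euclidean (\<lambda>x. f x * g x)"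
  by (simp add: continuous_map_atin tendsto_mult)

lemma ennreal_ex_real_below:
  assumes "(e :: ennreal) > 0"
  obtains r where "r > 0" "ennreal r < e"
proof -
  obtain y where y: "0 < y" "y < e" using dense[OF assms] by blast
  then have "y < top" using order_less_le_trans top_greatest by blast
  then have y': "ennreal (enn2real y) = y" by simp
  have "enn2real y > 0" using y \<open>y < top\<close> by (simp add: enn2real_positive_iff)
  then show ?thesis using that[of "enn2real y"] y' y(2) by simp
qed

section \<open>The functions of compact support are closed under convolution\<close>

context etale_twist
begin

text \<open>A compact subset of the Hausdorff space is closed, so once it contains the points of
  nonvanishing it contains their closure.\<close>

lemma CcI:
  assumes "continuous_map (gtop \<Sigma>) euclidean f" "\<And>\<sigma>. \<sigma> \<notin> arr \<Sigma> \<Longrightarrow> f \<sigma> = 0" "equivariant f"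
    and K: "compactin (gtop \<Sigma>) K" "\<And>\<sigma>. \<lbrakk>\<sigma> \<in> arr \<Sigma>; f \<sigma> \<noteq> 0\<rbrakk> \<Longrightarrow> \<sigma> \<in> K"
  shows "f \<in> Cc \<Sigma>"
proof -
  have "closedin (gtop \<Sigma>) K" using compactin_imp_closedin[OF Hausdorff_\<Sigma> K(1)] .
  then have "gtop \<Sigma> closure_of {x \<in> arr \<Sigma>. f x \<noteq> 0} \<subseteq> K"
    using K(2) by (intro closure_of_minimal) auto
  then have "compactin (gtop \<Sigma>) (gtop \<Sigma> closure_of {x \<in> arr \<Sigma>. f x \<noteq> 0})"
    by (rule closed_compactin[OF K(1)]) simp
  then show ?thesis
    using assms(1-3) unfolding Cc_def compactly_supported_def equivariant_def by simp
qed

lemma Cc_continuous: "f \<in> Cc \<Sigma> \<Longrightarrow> continuous_map (gtop \<Sigma>) euclidean f"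
  and Cc_outside: "\<lbrakk>f \<in> Cc \<Sigma>; \<sigma> \<notin> arr \<Sigma>\<rbrakk> \<Longrightarrow> f \<sigma> = 0"
  unfolding Cc_def compactly_supported_def by auto

lemma Cc_zero: "0 \<in> Cc \<Sigma>"
  by (rule CcI[where K = "{}"]) (auto simp: equivariant_def zero_fun_def)

lemma Cc_add:
  assumes f: "f \<in> Cc \<Sigma>" and g: "g \<in> Cc \<Sigma>"
  shows "f + g \<in> Cc \<Sigma>"
proof -
  obtain K where K: "compactin (gtop \<Sigma>) K" "\<And>\<sigma>. f \<sigma> \<noteq> 0 \<Longrightarrow> \<sigma> \<in> K" using Cc_support[OF f] by blast
  obtain L where L: "compactin (gtop \<Sigma>) L" "\<And>\<sigma>. g \<sigma> \<noteq> 0 \<Longrightarrow> \<sigma> \<in> L" using Cc_support[OF g] by blast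
  show ?thesis
  proof (rule CcI)
    show "continuous_map (gtop \<Sigma>) euclidean (f + g)"
      using continuous_map_add[OF Cc_continuous[OF f] Cc_continuous[OF g]] by (simp add: plus_fun_def)
    show "compactin (gtop \<Sigma>) (K \<union> L)" by (rule compactin_Un[OF K(1) L(1)])
    show "\<sigma> \<in> K \<union> L" if "(f + g) \<sigma> \<noteq> 0" for \<sigma>
    proof -
      from that have "f \<sigma> \<noteq> 0 \<or> g \<sigma> \<noteq> 0" by auto
      then show ?thesis using K(2) L(2) by blast
    qed
  qed (use Cc_outside[OF f] Cc_outside[OF g] Cc_equivariant[OF f] Cc_equivariant[OF g] in
      \<open>auto simp: equivariant_def algebra_simps\<close>)
qed

lemma Cc_scale:
  assumes f: "f \<in> Cc \<Sigma>"
  shows "(\<lambda>\<sigma>. c * f \<sigma>) \<in> Cc \<Sigma>"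
proof -
  obtain K where K: "compactin (gtop \<Sigma>) K" "\<And>\<sigma>. f \<sigma> \<noteq> 0 \<Longrightarrow> \<sigma> \<in> K" using Cc_support[OF f] by blast
  show ?thesis
  proof (rule CcI[OF _ _ _ K(1)])
    show "continuous_map (gtop \<Sigma>) euclidean (\<lambda>\<sigma>. c * f \<sigma>)"
      using continuous_map_compose[OF Cc_continuous[OF f], of euclidean "\<lambda>w. c * w"]
      by (simp add: o_def continuous_on_mult_left)
  qed (use Cc_outside[OF f] Cc_equivariant[OF f] K(2) in \<open>auto simp: equivariant_def algebra_simps\<close>)
qed

text \<open>The summand is jointly continuous on the pairs of arrows with equal range. Product
  neighbourhoods let the lift and the argument vary separately.\<close>

lemma conv_term_near:
  fixes f g :: "'s \<Rightarrow> complex"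
  assumes f: "continuous_map (gtop \<Sigma>) euclidean f" and g: "continuous_map (gtop \<Sigma>) euclidean g"
    and a: "\<tau>\<^sub>0 \<in> arr \<Sigma>" "\<sigma>\<^sub>0 \<in> arr \<Sigma>" "rng \<Sigma> \<tau>\<^sub>0 = rng \<Sigma> \<sigma>\<^sub>0" and e: "(e::real) > 0"
  shows "\<exists>P Q. openin (gtop \<Sigma>) P \<and> openin (gtop \<Sigma>) Q \<and> \<tau>\<^sub>0 \<in> P \<and> \<sigma>\<^sub>0 \<in> Q \<and>
    (\<forall>\<tau>\<in>P. \<forall>\<sigma>\<in>Q. rng \<Sigma> \<tau> = rng \<Sigma> \<sigma> \<longrightarrow>
      dist (f \<tau> * g (gmul \<Sigma> (ginv \<Sigma> \<tau>) \<sigma>)) (f \<tau>\<^sub>0 * g (gmul \<Sigma> (ginv \<Sigma> \<tau>\<^sub>0) \<sigma>\<^sub>0)) < e)"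
proof -
  let ?P = "prod_topology (gtop \<Sigma>) (gtop \<Sigma>)"
  let ?X = "subtopology ?P {(\<tau>, \<sigma>). rng \<Sigma> \<tau> = rng \<Sigma> \<sigma>}"
  have top: "topspace ?X = {(\<tau>, \<sigma>). \<tau> \<in> arr \<Sigma> \<and> \<sigma> \<in> arr \<Sigma> \<and> rng \<Sigma> \<tau> = rng \<Sigma> \<sigma>}" by auto
  have fst: "continuous_map ?X (gtop \<Sigma>) fst" and snd: "continuous_map ?X (gtop \<Sigma>) snd"
    by (auto intro: continuous_map_from_subtopology continuous_map_fst continuous_map_snd)
  have "continuous_map ?X ?P (\<lambda>p. (ginv \<Sigma> (fst p), snd p))"
    using continuous_map_compose[OF fst continuous_ginv_\<Sigma>] snd
    by (simp add: continuous_map_pairwise o_def)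
  then have "continuous_map ?X (subtopology ?P {(a, b). src \<Sigma> a = rng \<Sigma> b}) (\<lambda>p. (ginv \<Sigma> (fst p), snd p))"
    by (rule continuous_map_into_subtopology) (auto simp: top)
  from continuous_map_compose[OF this continuous_gmul_\<Sigma>]
  have "continuous_map ?X (gtop \<Sigma>) (\<lambda>p. gmul \<Sigma> (ginv \<Sigma> (fst p)) (snd p))" by (simp add: o_def)
  note 1 = continuous_map_compose[OF this g, unfolded o_def] and 2 = continuous_map_compose[OF fst f, unfolded o_def]
  have "continuous_map ?X euclidean (\<lambda>p. f (fst p) * g (gmul \<Sigma> (ginv \<Sigma> (fst p)) (snd p)))"
    using continuous_map_normed_mult[OF 2 1] .
  note c = this[unfolded continuous_map_eps_iff, rule_format]
  have "(\<tau>\<^sub>0, \<sigma>\<^sub>0) \<in> topspace ?X" unfolding top using a by simp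
  then obtain U where U: "openin ?X U" "(\<tau>\<^sub>0, \<sigma>\<^sub>0) \<in> U"
    "\<forall>p\<in>U. dist (f (fst p) * g (gmul \<Sigma> (ginv \<Sigma> (fst p)) (snd p))) (f \<tau>\<^sub>0 * g (gmul \<Sigma> (ginv \<Sigma> \<tau>\<^sub>0) \<sigma>\<^sub>0)) < e"
    using c[OF _ e, of "(\<tau>\<^sub>0, \<sigma>\<^sub>0)", unfolded fst_conv snd_conv] by blast
  obtain V where V: "openin ?P V" "U = V \<inter> {(\<tau>, \<sigma>). rng \<Sigma> \<tau> = rng \<Sigma> \<sigma>}"
    using U(1) unfolding openin_subtopology by blast
  obtain P Q where PQ: "openin (gtop \<Sigma>) P" "openin (gtop \<Sigma>) Q" "\<tau>\<^sub>0 \<in> P" "\<sigma>\<^sub>0 \<in> Q" "P \<times> Q \<subseteq> V"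
    using V(1)[unfolded openin_prod_topology_alt, rule_format, of "\<tau>\<^sub>0" "\<sigma>\<^sub>0"] U(2) V(2) by blast
  have "\<forall>\<tau>\<in>P. \<forall>\<sigma>\<in>Q. rng \<Sigma> \<tau> = rng \<Sigma> \<sigma> \<longrightarrow>
      dist (f \<tau> * g (gmul \<Sigma> (ginv \<Sigma> \<tau>) \<sigma>)) (f \<tau>\<^sub>0 * g (gmul \<Sigma> (ginv \<Sigma> \<tau>\<^sub>0) \<sigma>\<^sub>0)) < e"
  proof (intro ballI impI)
    fix \<tau> \<sigma> assume "\<tau> \<in> P" "\<sigma> \<in> Q" "rng \<Sigma> \<tau> = rng \<Sigma> \<sigma>"
    then have "(\<tau>, \<sigma>) \<in> U" using PQ(5) V(2) by auto
    then show "dist (f \<tau> * g (gmul \<Sigma> (ginv \<Sigma> \<tau>) \<sigma>)) (f \<tau>\<^sub>0 * g (gmul \<Sigma> (ginv \<Sigma> \<tau>\<^sub>0) \<sigma>\<^sub>0)) < e"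
      using U(3) by force
  qed
  then show ?thesis using PQ(1-4) by blast
qed

lemma finite_separation_G:
  assumes "finite S" "S \<subseteq> arr G"
  obtains D where "\<And>\<gamma>. \<gamma> \<in> S \<Longrightarrow> openin (gtop G) (D \<gamma>)" "\<And>\<gamma>. \<gamma> \<in> S \<Longrightarrow> \<gamma> \<in> D \<gamma>"
    "\<And>\<gamma> \<delta>. \<lbrakk>\<gamma> \<in> S; \<delta> \<in> S; \<gamma> \<noteq> \<delta>\<rbrakk> \<Longrightarrow> D \<gamma> \<inter> D \<delta> = {}"
proof -
  have "\<exists>U V. openin (gtop G) U \<and> openin (gtop G) V \<and> \<gamma> \<in> U \<and> \<delta> \<in> V \<and> U \<inter> V = {}"
    if "\<gamma> \<in> S" "\<delta> \<in> S" "\<gamma> \<noteq> \<delta>" for \<gamma> \<delta>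
    using Hausdorff_G that assms(2) unfolding Hausdorff_space_def disjnt_def by blast
  then obtain U V where UV: "\<And>\<gamma> \<delta>. \<lbrakk>\<gamma> \<in> S; \<delta> \<in> S; \<gamma> \<noteq> \<delta>\<rbrakk> \<Longrightarrow> openin (gtop G) (U \<gamma> \<delta>) \<and>
      openin (gtop G) (V \<gamma> \<delta>) \<and> \<gamma> \<in> U \<gamma> \<delta> \<and> \<delta> \<in> V \<gamma> \<delta> \<and> U \<gamma> \<delta> \<inter> V \<gamma> \<delta> = {}"
    by metis
  define D where "D \<gamma> = (\<Inter>\<delta>\<in>S - {\<gamma>}. U \<gamma> \<delta> \<inter> V \<delta> \<gamma>) \<inter> topspace (gtop G)" for \<gamma>
  show ?thesis
  proof (rule that[of D])
    show "openin (gtop G) (D \<gamma>)" if "\<gamma> \<in> S" for \<gamma>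
      unfolding D_def using assms(1) UV that by (intro openin_INT openin_Int) auto
    show "\<gamma> \<in> D \<gamma>" if "\<gamma> \<in> S" for \<gamma> unfolding D_def using UV that assms(2) by auto
    show "D \<gamma> \<inter> D \<delta> = {}" if "\<gamma> \<in> S" "\<delta> \<in> S" "\<gamma> \<noteq> \<delta>" for \<gamma> \<delta>
    proof -
      have "D \<gamma> \<subseteq> U \<gamma> \<delta>" "D \<delta> \<subseteq> V \<gamma> \<delta>" using that unfolding D_def by auto
      then show ?thesis using UV[OF that] by blast
    qed
  qed
qed

text \<open>The arrows of K ending at r(\<sigma>_0) have disjoint bisection neighbourhoods. For
  \<sigma> near \<sigma>_0 each of these contains one arrow ending at r(\<sigma>), and no other
  arrow can contribute, so the sum keeps a fixed number of terms, each varying continuously.\<close>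

lemma conv_continuous:
  assumes f: "f \<in> Cc \<Sigma>" and g: "g \<in> Cc \<Sigma>"
  shows "continuous_map (gtop \<Sigma>) euclidean (conv \<Sigma> G f g)"
  unfolding continuous_map_eps_iff
proof (intro ballI allI impI)
  fix \<sigma>\<^sub>0 and e :: real assume \<sigma>\<^sub>0: "\<sigma>\<^sub>0 \<in> arr \<Sigma>" and e: "e > 0"
  define h where "h \<tau> \<sigma> = f \<tau> * g (gmul \<Sigma> (ginv \<Sigma> \<tau>) \<sigma>)" for \<tau> \<sigma>
  obtain K where K: "K \<subseteq> arr G" "compactin (gtop G) K" "\<And>\<sigma>. f \<sigma> \<noteq> 0 \<Longrightarrow> proj \<Sigma> \<sigma> \<in> K"
    "\<And>y. finite {\<gamma> \<in> K. rng G \<gamma> = y}"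
    by (rule Cc_fibres[OF f]) (rule that; assumption)
  let ?y\<^sub>0 = "proj \<Sigma> (rng \<Sigma> \<sigma>\<^sub>0)"
  define S where "S = {\<gamma> \<in> K. rng G \<gamma> = ?y\<^sub>0}"
  have S: "finite S" "S \<subseteq> arr G" using K(1,4) unfolding S_def by auto
  \<comment> \<open>An equal share for each of the \<open>card S\<close> terms; the summand 1 makes
    the final inequality strict and covers an empty \<open>S\<close>.\<close>
  define e' where "e' = e / (card S + 1)"
  have e': "e' > 0" using e by (simp add: e'_def)
  have "\<exists>P Q. openin (gtop \<Sigma>) P \<and> openin (gtop \<Sigma>) Q \<and> lift \<Sigma> \<gamma> \<in> P \<and> \<sigma>\<^sub>0 \<in> Q \<and>
    (\<forall>\<tau>\<in>P. \<forall>\<sigma>\<in>Q. rng \<Sigma> \<tau> = rng \<Sigma> \<sigma> \<longrightarrow> dist (h \<tau> \<sigma>) (h (lift \<Sigma> \<gamma>) \<sigma>\<^sub>0) < e')"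
    if "\<gamma> \<in> S" for \<gamma>
    unfolding h_def
    by (rule conv_term_near[OF Cc_continuous[OF f] Cc_continuous[OF g] _ \<sigma>\<^sub>0 _ e'])
      (use that S \<sigma>\<^sub>0 rng_lift in \<open>auto simp: S_def\<close>)
  then obtain P Q where PQ: "\<And>\<gamma>. \<gamma> \<in> S \<Longrightarrow> openin (gtop \<Sigma>) (P \<gamma>) \<and> openin (gtop \<Sigma>) (Q \<gamma>) \<and>
      lift \<Sigma> \<gamma> \<in> P \<gamma> \<and> \<sigma>\<^sub>0 \<in> Q \<gamma>"
    "\<And>\<gamma> \<tau> \<sigma>. \<lbrakk>\<gamma> \<in> S; \<tau> \<in> P \<gamma>; \<sigma> \<in> Q \<gamma>; rng \<Sigma> \<tau> = rng \<Sigma> \<sigma>\<rbrakk> \<Longrightarrow> dist (h \<tau> \<sigma>) (h (lift \<Sigma> \<gamma>) \<sigma>\<^sub>0) < e'"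
    by metis
  obtain D where D: "\<And>\<gamma>. \<gamma> \<in> S \<Longrightarrow> openin (gtop G) (D \<gamma>)" "\<And>\<gamma>. \<gamma> \<in> S \<Longrightarrow> \<gamma> \<in> D \<gamma>"
    "\<And>\<gamma> \<delta>. \<lbrakk>\<gamma> \<in> S; \<delta> \<in> S; \<gamma> \<noteq> \<delta>\<rbrakk> \<Longrightarrow> D \<gamma> \<inter> D \<delta> = {}"
    using finite_separation_G[OF S] by blast
  have "\<exists>B. open_bisection G B \<and> \<gamma> \<in> B \<and> B \<subseteq> proj \<Sigma> ` P \<gamma> \<inter> D \<gamma>" if g: "\<gamma> \<in> S" for \<gamma>
  proof (rule ex_bisection[of "proj \<Sigma> ` P \<gamma> \<inter> D \<gamma>" \<gamma>])
    show "openin (gtop G) (proj \<Sigma> ` P \<gamma> \<inter> D \<gamma>)"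
      using PQ(1)[OF g] D(1)[OF g] open_map_proj unfolding open_map_def by (intro openin_Int) auto
    have "\<gamma> = proj \<Sigma> (lift \<Sigma> \<gamma>)" using g S by auto
    then show "\<gamma> \<in> proj \<Sigma> ` P \<gamma> \<inter> D \<gamma>" using PQ(1)[OF g] D(2)[OF g] by blast
  qed blast
  then obtain B where B: "\<And>\<gamma>. \<gamma> \<in> S \<Longrightarrow> open_bisection G (B \<gamma>)" "\<And>\<gamma>. \<gamma> \<in> S \<Longrightarrow> \<gamma> \<in> B \<gamma>"
      "\<And>\<gamma>. \<gamma> \<in> S \<Longrightarrow> B \<gamma> \<subseteq> proj \<Sigma> ` P \<gamma>" "\<And>\<gamma>. \<gamma> \<in> S \<Longrightarrow> B \<gamma> \<subseteq> D \<gamma>"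
    by (metis le_inf_iff)
  \<comment> \<open>The part of \<open>K\<close> outside the bisections has compact, hence closed,
    range image. This image misses \<open>?y\<^sub>0\<close>, because the arrows of \<open>K\<close>
    ending there all lie in the bisections.\<close>
  define K' where "K' = K \<inter> (arr G - (\<Union>\<gamma>\<in>S. B \<gamma>))"
  have "closedin (gtop G) (arr G - (\<Union>\<gamma>\<in>S. B \<gamma>))"
    using bisectionD(1)[OF B(1)] by (intro closedin_diff) auto
  then have "compactin (gtop G) K'" unfolding K'_def by (rule compact_Int_closedin[OF K(2)])
  then have "compactin (gtop G) (rng G ` K')" by (rule image_compactin[OF _ continuous_rng_G])
  then have cl: "closedin (gtop G) (rng G ` K')" by (rule compactin_imp_closedin[OF Hausdorff_G])
  \<comment> \<open>Intersecting with the whole space bounds the intersection when \<open>S\<close>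
    is empty.\<close>
  define N where "N = (\<Inter>\<gamma>\<in>S. rng G ` B \<gamma>) \<inter> topspace (gtop G) - rng G ` K'"
  have "openin (gtop G) N"
    unfolding N_def using S(1) open_map_rng bisectionD(1) B(1) cl by (intro openin_diff openin_INT) auto
  moreover have "?y\<^sub>0 \<in> N"
  proof -
    have "?y\<^sub>0 \<in> rng G ` B \<gamma>" if "\<gamma> \<in> S" for \<gamma>
      using B(2)[OF that] that unfolding S_def by (auto intro!: image_eqI[of _ _ \<gamma>])
    moreover have "?y\<^sub>0 \<notin> rng G ` K'"
    proof
      assume "?y\<^sub>0 \<in> rng G ` K'"
      then obtain \<gamma> where "\<gamma> \<in> K'" "rng G \<gamma> = ?y\<^sub>0" by auto
      then have "\<gamma> \<in> S" "\<gamma> \<notin> (\<Union>\<gamma>\<in>S. B \<gamma>)" unfolding K'_def S_def by auto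
      then show False using B(2) by auto
    qed
    ultimately show ?thesis unfolding N_def using \<sigma>\<^sub>0 by auto
  qed
  moreover define M where "M = {\<sigma> \<in> arr \<Sigma>. (proj \<Sigma> \<circ> rng \<Sigma>) \<sigma> \<in> N}"
  ultimately have M: "openin (gtop \<Sigma>) M" "\<sigma>\<^sub>0 \<in> M"
    using openin_continuous_map_preimage[OF continuous_map_compose[OF continuous_rng_\<Sigma> continuous_proj]] \<sigma>\<^sub>0
    by auto
  define U where "U = ((\<Inter>\<gamma>\<in>S. Q \<gamma>) \<inter> topspace (gtop \<Sigma>)) \<inter> M"
  have "openin (gtop \<Sigma>) U"
    unfolding U_def using S(1) PQ(1) M by (intro openin_Int[OF openin_INT]) auto
  moreover have "\<sigma>\<^sub>0 \<in> U" unfolding U_def using PQ(1) M \<sigma>\<^sub>0 by auto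
  moreover have "dist (conv \<Sigma> G f g \<sigma>) (conv \<Sigma> G f g \<sigma>\<^sub>0) < e" if \<sigma>U: "\<sigma> \<in> U" for \<sigma>
  proof -
    let ?y = "proj \<Sigma> (rng \<Sigma> \<sigma>)"
    have \<sigma>: "\<sigma> \<in> arr \<Sigma>" "?y \<in> N" "\<And>\<gamma>. \<gamma> \<in> S \<Longrightarrow> \<sigma> \<in> Q \<gamma>" using \<sigma>U unfolding U_def M_def by auto
    have "\<exists>b. b \<in> B \<gamma> \<and> rng G b = ?y" if "\<gamma> \<in> S" for \<gamma>
    proof -
      have "?y \<in> rng G ` B \<gamma>" using \<sigma>(2) that unfolding N_def by blast
      then show ?thesis by (auto simp: image_iff eq_commute)
    qed
    then obtain b where b: "\<And>\<gamma>. \<gamma> \<in> S \<Longrightarrow> b \<gamma> \<in> B \<gamma>" "\<And>\<gamma>. \<gamma> \<in> S \<Longrightarrow> rng G (b \<gamma>) = ?y" by metis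
    have barr: "b \<gamma> \<in> arr G" if "\<gamma> \<in> S" for \<gamma> using b(1) bisectionD(2)[OF B(1)] that by blast
    have inj: "inj_on b S"
    proof (rule inj_onI, rule ccontr)
      fix \<gamma> \<delta> assume "\<gamma> \<in> S" "\<delta> \<in> S" "b \<gamma> = b \<delta>" "\<gamma> \<noteq> \<delta>"
      then show False using D(3)[of \<gamma> \<delta>] B(4) b(1) by (metis disjoint_iff subsetD)
    qed
    have "conv \<Sigma> G f g \<sigma> = (\<Sum>\<delta>\<in>b ` S. h (lift \<Sigma> \<delta>) \<sigma>)"
      unfolding h_def
    proof (rule conv_eq_sum[OF \<sigma>(1)])
      fix \<delta> assume d: "\<delta> \<in> arr G" "rng G \<delta> = ?y" "\<delta> \<notin> b ` S"
      have "\<delta> \<notin> K"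
      proof
        assume dK: "\<delta> \<in> K"
        have "rng G \<delta> \<notin> rng G ` K'" using d(2) \<sigma>(2) unfolding N_def by auto
        then have "\<delta> \<notin> K'" by blast
        then obtain \<gamma> where g: "\<gamma> \<in> S" "\<delta> \<in> B \<gamma>" using dK d(1) unfolding K'_def by auto
        then have "\<delta> = b \<gamma>" using inj_onD[OF bisectionD(3)[OF B(1)[OF g(1)]]] b d(2) by metis
        then show False using d(3) g by blast
      qed
      then have "f (lift \<Sigma> \<delta>) = 0" using K(3)[of "lift \<Sigma> \<delta>"] d(1) by auto
      then show "f (lift \<Sigma> \<delta>) * g (gmul \<Sigma> (ginv \<Sigma> (lift \<Sigma> \<delta>)) \<sigma>) = 0" by simp
    qed (use S b barr in auto)
    also have "\<dots> = (\<Sum>\<gamma>\<in>S. h (lift \<Sigma> (b \<gamma>)) \<sigma>)" by (simp add: sum.reindex[OF inj])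
    finally have 1: "conv \<Sigma> G f g \<sigma> = (\<Sum>\<gamma>\<in>S. h (lift \<Sigma> (b \<gamma>)) \<sigma>)" .
    have 2: "conv \<Sigma> G f g \<sigma>\<^sub>0 = (\<Sum>\<gamma>\<in>S. h (lift \<Sigma> \<gamma>) \<sigma>\<^sub>0)"
      unfolding h_def S_def by (rule conv_Cc_eq_sum[OF K(3,1,4) \<sigma>\<^sub>0])
    have near: "cmod (h (lift \<Sigma> (b \<gamma>)) \<sigma> - h (lift \<Sigma> \<gamma>) \<sigma>\<^sub>0) \<le> e'" if g': "\<gamma> \<in> S" for \<gamma>
    proof -
      \<comment> \<open>\<open>B \<gamma>\<close> lies in the image of \<open>P \<gamma>\<close>, so
        \<open>b \<gamma>\<close> has a lift in the neighbourhood where the estimate holds; the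
        summand does not see the change of lift.\<close>
      obtain \<tau> where \<tau>: "\<tau> \<in> P \<gamma>" "b \<gamma> = proj \<Sigma> \<tau>" using b(1)[OF g'] B(3)[OF g'] by blast
      then have ta: "\<tau> \<in> arr \<Sigma>" using PQ(1)[OF g'] openin_subset by blast
      have r: "rng \<Sigma> \<tau> = rng \<Sigma> \<sigma>" using b(2)[OF g'] \<tau>(2) ta \<sigma>(1) by (simp add: rng_eq_rng_iff rng_proj)
      have "h (lift \<Sigma> (b \<gamma>)) \<sigma> = h \<tau> \<sigma>"
        unfolding h_def
        by (rule conv_term_lift[OF Cc_equivariant[OF f] Cc_equivariant[OF g] \<sigma>(1) ta])
          (use r \<tau>(2) ta in auto)
      then show ?thesis using PQ(2)[OF g' \<tau>(1) \<sigma>(3)[OF g'] r] by (simp add: dist_norm)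
    qed
    have "dist (conv \<Sigma> G f g \<sigma>) (conv \<Sigma> G f g \<sigma>\<^sub>0) =
        cmod (\<Sum>\<gamma>\<in>S. h (lift \<Sigma> (b \<gamma>)) \<sigma> - h (lift \<Sigma> \<gamma>) \<sigma>\<^sub>0)"
      unfolding 1 2 by (simp add: dist_norm sum_subtractf)
    also have "\<dots> \<le> (\<Sum>\<gamma>\<in>S. e')" by (rule sum_norm_le[OF near])
    also have "\<dots> = card S * e'" by simp
    also have "\<dots> < e" using e by (simp add: e'_def field_simps)
    finally show ?thesis .
  qed
  ultimately show "\<exists>U. openin (gtop \<Sigma>) U \<and> \<sigma>\<^sub>0 \<in> U \<and> (\<forall>y\<in>U. dist (conv \<Sigma> G f g y) (conv \<Sigma> G f g \<sigma>\<^sub>0) < e)"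
    by blast
qed

text \<open>Outside \<open>arr \<Sigma>\<close> the value of \<open>conv\<close> is arbitrary.\<close>

lemma conv_Cc:
  assumes f: "f \<in> Cc \<Sigma>" and g: "g \<in> Cc \<Sigma>"
  shows "zero_outside (arr \<Sigma>) (conv \<Sigma> G f g) \<in> Cc \<Sigma>"
proof -
  obtain K where K: "compactin (gtop \<Sigma>) K" "\<And>\<sigma>. f \<sigma> \<noteq> 0 \<Longrightarrow> \<sigma> \<in> K" using Cc_support[OF f] by blast
  obtain L where L: "compactin (gtop \<Sigma>) L" "\<And>\<sigma>. g \<sigma> \<noteq> 0 \<Longrightarrow> \<sigma> \<in> L" using Cc_support[OF g] by blast
  let ?P = "prod_topology (gtop \<Sigma>) (gtop \<Sigma>)"
  let ?M = "{p \<in> topspace ?P. (src \<Sigma> \<circ> fst) p = (rng \<Sigma> \<circ> snd) p}"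
  \<comment> \<open>The composable pairs form a closed subset of a compact set. The compact set of
    their products contains every arrow at which the convolution is nonzero.\<close>
  let ?C = "(K \<times> L) \<inter> ?M"
  have "closedin ?P ?M"
    by (rule closedin_continuous_maps_eq[OF Hausdorff_\<Sigma>])
      (rule continuous_map_compose[OF continuous_map_fst continuous_src_\<Sigma>]
        continuous_map_compose[OF continuous_map_snd continuous_rng_\<Sigma>])+
  then have "compactin ?P ?C"
    using K(1) L(1) by (intro compact_Int_closedin) (auto simp: compactin_Times)
  then have "compactin (subtopology ?P {(a, b). src \<Sigma> a = rng \<Sigma> b}) ?C"
    by (auto simp: compactin_subtopology)
  then have c: "compactin (gtop \<Sigma>) ((\<lambda>(a, b). gmul \<Sigma> a b) ` ?C)"
    by (rule image_compactin[OF _ continuous_gmul_\<Sigma>])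
  show ?thesis
  proof (rule CcI[OF _ _ _ c])
    show "continuous_map (gtop \<Sigma>) euclidean (zero_outside (arr \<Sigma>) (conv \<Sigma> G f g))"
      by (rule continuous_map_eq[OF conv_continuous[OF f g]]) (simp add: zero_outside_def)
    show "equivariant (zero_outside (arr \<Sigma>) (conv \<Sigma> G f g))"
      using equivariant_conv[OF Cc_equivariant[OF g]] unfolding equivariant_def zero_outside_def by simp
    show "\<sigma> \<in> (\<lambda>(a, b). gmul \<Sigma> a b) ` ?C"
      if \<sigma>: "\<sigma> \<in> arr \<Sigma>" and nz: "zero_outside (arr \<Sigma>) (conv \<Sigma> G f g) \<sigma> \<noteq> 0" for \<sigma>
    proof -
      have "conv \<Sigma> G f g \<sigma> \<noteq> 0" using \<sigma> nz by (simp add: zero_outside_def)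
      then obtain \<gamma> where \<gamma>: "\<gamma> \<in> arr G" "rng G \<gamma> = proj \<Sigma> (rng \<Sigma> \<sigma>)"
        "f (lift \<Sigma> \<gamma>) * g (gmul \<Sigma> (ginv \<Sigma> (lift \<Sigma> \<gamma>)) \<sigma>) \<noteq> 0"
        unfolding conv_def using infsum_0[of "{\<gamma> \<in> arr G. rng G \<gamma> = proj \<Sigma> (rng \<Sigma> \<sigma>)}"
          "\<lambda>\<gamma>. f (lift \<Sigma> \<gamma>) * g (gmul \<Sigma> (ginv \<Sigma> (lift \<Sigma> \<gamma>)) \<sigma>)"] by blast
      let ?l = "lift \<Sigma> \<gamma>"
      have r: "rng \<Sigma> ?l = rng \<Sigma> \<sigma>" using rng_lift \<gamma> \<sigma> by blast
      have "?l \<in> K" "gmul \<Sigma> (ginv \<Sigma> ?l) \<sigma> \<in> L" using \<gamma>(3) K(2) L(2) by auto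
      then have "(?l, gmul \<Sigma> (ginv \<Sigma> ?l) \<sigma>) \<in> ?C" using \<gamma> \<sigma> r by simp
      moreover have "\<sigma> = (\<lambda>(a, b). gmul \<Sigma> a b) (?l, gmul \<Sigma> (ginv \<Sigma> ?l) \<sigma>)" using \<gamma> \<sigma> r by simp
      ultimately show ?thesis by (rule rev_image_eqI)
    qed
  qed (simp add: zero_outside_def)
qed

end

section \<open>The reduced algebra as an algebra of functions\<close>

context etale_twist
begin

text \<open>Every positive extended real has a positive real strictly below it, so the strict
  \<open>ennreal\<close> tolerance can be exchanged for a real bound.\<close>

lemma norm_closure_iff:
  assumes "A \<subseteq> op_families \<Sigma> G" "S \<subseteq> op_families \<Sigma> G"
  shows "a \<in> norm_closure \<Sigma> G A S \<longleftrightarrow> a \<in> A \<and> (\<forall>e>0. \<exists>b\<in>S. bounded_by e (a - b))"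
proof -
  have le: "fam_norm \<Sigma> G (a - b) \<le> ennreal C \<longleftrightarrow> bounded_by C (a - b)"
    if "a \<in> A" "b \<in> S" "C \<ge> 0" for b C
    using that assms by (intro fam_norm_le_iff linear_family_diff) (auto simp: op_families_iff)
  show ?thesis
  proof
    assume a: "a \<in> norm_closure \<Sigma> G A S"
    then have aA: "a \<in> A" by (simp add: norm_closure_def)
    have "\<exists>b\<in>S. bounded_by e (a - b)" if e: "e > 0" for e
    proof -
      have "ennreal e > 0" using e by simp
      then obtain b where b: "b \<in> S" "fam_norm \<Sigma> G (a - b) < ennreal e"
        using a unfolding norm_closure_def by blast
      then have "bounded_by e (a - b)" using le[OF aA b(1), of e] e less_imp_le[OF b(2)] by simp
      then show ?thesis using b(1) by blast
    qed
    then show "a \<in> A \<and> (\<forall>e>0. \<exists>b\<in>S. bounded_by e (a - b))" using aA by blast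
  next
    assume r: "a \<in> A \<and> (\<forall>e>0. \<exists>b\<in>S. bounded_by e (a - b))"
    have "\<exists>b\<in>S. fam_norm \<Sigma> G (a - b) < e" if e: "e > 0" for e
    proof -
      obtain s where s: "s > 0" "ennreal s < e" using ennreal_ex_real_below[OF e] by blast
      obtain b where b: "b \<in> S" "bounded_by s (a - b)" using r s(1) by blast
      have "fam_norm \<Sigma> G (a - b) \<le> ennreal s" using le[of b s] r b s(1) by simp
      then have "fam_norm \<Sigma> G (a - b) < e" using s(2) by (rule order_le_less_trans)
      then show ?thesis using b(1) by blast
    qed
    then show "a \<in> norm_closure \<Sigma> G A S" using r unfolding norm_closure_def by simp
  qed
qed

lemma Cr_iff:
  "a \<in> Cr \<Sigma> G \<longleftrightarrow> a \<in> op_families \<Sigma> G \<and> (\<forall>e>0. \<exists>f\<in>Cc \<Sigma>. bounded_by e (a - reg_rep \<Sigma> G f))"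
  unfolding Cr_def using norm_closure_iff[of "op_families \<Sigma> G" "reg_rep \<Sigma> G ` Cc \<Sigma>" a] reg_rep_op_families
  by auto

lemma Cr_op_families: "a \<in> Cr \<Sigma> G \<Longrightarrow> a \<in> op_families \<Sigma> G"
  by (simp add: Cr_iff)

lemma Cr_approx:
  assumes "a \<in> Cr \<Sigma> G" "e > 0"
  obtains f where "f \<in> Cc \<Sigma>" "bounded_by e (a - reg_rep \<Sigma> G f)"
  using assms unfolding Cr_iff by blast

lemma op_families_linear: "a \<in> op_families \<Sigma> G \<Longrightarrow> linear_family a"
  by (simp add: op_families_iff)

lemma op_families_bound:
  assumes "a \<in> op_families \<Sigma> G" obtains C where "C \<ge> 0" "bounded_by C a"
  using assms unfolding op_families_iff by blast

lemma op_families_linear_op: "\<lbrakk>a \<in> op_families \<Sigma> G; x \<in> units G\<rbrakk> \<Longrightarrow> linear_op x (a x)"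
  using op_families_linear unfolding linear_family_def by blast

lemma op_families_outside: "\<lbrakk>a \<in> op_families \<Sigma> G; x \<notin> units G\<rbrakk> \<Longrightarrow> a x = 0"
  using op_families_linear unfolding linear_family_def by blast

lemma op_families_Hx: "\<lbrakk>a \<in> op_families \<Sigma> G; x \<in> units G\<rbrakk> \<Longrightarrow> a x \<xi> \<in> Hx \<Sigma> G x"
  using linear_opD(1,4)[OF op_families_linear_op[of a x]] by (cases "\<xi> \<in> Hx \<Sigma> G x") auto

lemma op_families_zero_arg: "a \<in> op_families \<Sigma> G \<Longrightarrow> a x 0 = 0"
  using op_families_linear_op[of a x] op_families_outside[of a x] linear_op_zero_arg[of x "a x"]
  by (cases "x \<in> units G") auto

lemma op_families_ext:
  assumes "a \<in> op_families \<Sigma> G" "b \<in> op_families \<Sigma> G"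
    and "\<And>x \<tau>. \<tau> \<in> src_fibre \<Sigma> x \<Longrightarrow> a x (delta \<tau>) = b x (delta \<tau>)"
  shows "a = b"
  by (rule ext) (rule linear_op_ext[OF assms(1,2)], use assms(3) in blast)

lemma reg_rep_delta_eq:
  assumes "f \<in> Cc \<Sigma>" "\<tau> \<in> src_fibre \<Sigma> x"
  shows "reg_rep \<Sigma> G f x (delta \<tau>) =
    (\<lambda>\<rho>. if \<rho> \<in> src_fibre \<Sigma> x then f (gmul \<Sigma> \<rho> (ginv \<Sigma> \<tau>)) else 0)"
  using reg_rep_delta[OF Cc_equivariant[OF assms(1)] _ assms(2)] by (auto simp: reg_rep_def)

lemma reg_rep_add:
  assumes "f \<in> Cc \<Sigma>" "g \<in> Cc \<Sigma>"
  shows "reg_rep \<Sigma> G (f + g) = reg_rep \<Sigma> G f + reg_rep \<Sigma> G g"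
  by (rule op_families_ext[OF reg_rep_op_families[OF Cc_add[OF assms]]
        op_families_add[OF reg_rep_op_families[OF assms(1)] reg_rep_op_families[OF assms(2)]]])
    (auto simp: reg_rep_delta_eq assms Cc_add[OF assms])

lemma reg_rep_scale:
  assumes "f \<in> Cc \<Sigma>"
  shows "reg_rep \<Sigma> G (\<lambda>\<sigma>. c * f \<sigma>) = fam_scale c (reg_rep \<Sigma> G f)"
  by (rule op_families_ext[OF reg_rep_op_families[OF Cc_scale[OF assms]]
        op_families_scale[OF reg_rep_op_families[OF assms]]])
    (auto simp: reg_rep_delta_eq assms Cc_scale[OF assms] fam_scale_def)

lemma reg_rep_zero: "reg_rep \<Sigma> G 0 = 0"
  by (rule op_families_ext[OF reg_rep_op_families[OF Cc_zero] op_families_zero])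
    (auto simp: reg_rep_delta_eq[OF Cc_zero] fun_eq_iff)

text \<open>Point masses suffice. The coefficient at (\<rho>, \<tau>) on the left is the convolution
  evaluated at \<rho>\<tau>^-1, and associativity matches its summands with those obtained by
  applying g to the point mass first and f afterwards.\<close>

lemma reg_rep_conv:
  assumes f: "f \<in> Cc \<Sigma>" and g: "g \<in> Cc \<Sigma>"
  shows "reg_rep \<Sigma> G (zero_outside (arr \<Sigma>) (conv \<Sigma> G f g)) = fam_mult (reg_rep \<Sigma> G f) (reg_rep \<Sigma> G g)"
proof (rule op_families_ext[OF reg_rep_op_families[OF conv_Cc[OF f g]]
      op_families_mult[OF reg_rep_op_families[OF f] reg_rep_op_families[OF g]]], rule ext)
  fix x \<tau> \<rho> assume \<tau>: "\<tau> \<in> src_fibre \<Sigma> x"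
  let ?L = "reg_rep \<Sigma> G (zero_outside (arr \<Sigma>) (conv \<Sigma> G f g)) x (delta \<tau>) \<rho>"
  let ?g = "reg_rep \<Sigma> G g x (delta \<tau>)"
  have x: "x \<in> units G" using src_fibre_units[OF \<tau>] .
  have R: "fam_mult (reg_rep \<Sigma> G f) (reg_rep \<Sigma> G g) x (delta \<tau>) \<rho> =
      (if \<rho> \<in> src_fibre \<Sigma> x then conv \<Sigma> G f ?g \<rho> else 0)"
    using x op_families_Hx[OF reg_rep_op_families[OF g] x, of "delta \<tau>"]
    by (simp add: fam_mult_def reg_rep_def[of \<Sigma> G f])
  show "?L = fam_mult (reg_rep \<Sigma> G f) (reg_rep \<Sigma> G g) x (delta \<tau>) \<rho>"
  proof (cases "\<rho> \<in> src_fibre \<Sigma> x")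
    case True
    have a: "\<rho> \<in> arr \<Sigma>" "\<tau> \<in> arr \<Sigma>" "src \<Sigma> \<rho> = src \<Sigma> \<tau>" "src G (proj \<Sigma> \<rho>) = x"
      using True \<tau> by (auto simp: src_fibre_iff src_eq_src_iff)
    let ?k = "gmul \<Sigma> \<rho> (ginv \<Sigma> \<tau>)"
    have k: "?k \<in> arr \<Sigma>" "rng \<Sigma> ?k = rng \<Sigma> \<rho>" using a by simp_all
    have "?L = conv \<Sigma> G f g ?k"
      using reg_rep_delta_eq[OF conv_Cc[OF f g] \<tau>] True k by (simp add: zero_outside_def)
    also have "\<dots> = conv \<Sigma> G f ?g \<rho>"
      unfolding conv_def k(2)
    proof (rule infsum_cong)
      fix \<gamma> assume "\<gamma> \<in> {\<gamma> \<in> arr G. rng G \<gamma> = proj \<Sigma> (rng \<Sigma> \<rho>)}"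
      then have \<gamma>: "\<gamma> \<in> arr G" "rng G \<gamma> = proj \<Sigma> (rng \<Sigma> \<rho>)" by auto
      have r: "rng \<Sigma> (lift \<Sigma> \<gamma>) = rng \<Sigma> \<rho>" using rng_lift \<gamma> a by blast
      have "gmul \<Sigma> (ginv \<Sigma> (lift \<Sigma> \<gamma>)) ?k = gmul \<Sigma> (gmul \<Sigma> (ginv \<Sigma> (lift \<Sigma> \<gamma>)) \<rho>) (ginv \<Sigma> \<tau>)"
        using a \<gamma> r by (simp add: ext.gmul_assoc)
      moreover have "gmul \<Sigma> (ginv \<Sigma> (lift \<Sigma> \<gamma>)) \<rho> \<in> src_fibre \<Sigma> x"
        using a \<gamma> r src_proj[of "gmul \<Sigma> (ginv \<Sigma> (lift \<Sigma> \<gamma>)) \<rho>"] src_proj[of \<rho>]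
        by (simp add: src_fibre_iff del: proj_gmul)
      ultimately show "f (lift \<Sigma> \<gamma>) * g (gmul \<Sigma> (ginv \<Sigma> (lift \<Sigma> \<gamma>)) ?k) =
          f (lift \<Sigma> \<gamma>) * ?g (gmul \<Sigma> (ginv \<Sigma> (lift \<Sigma> \<gamma>)) \<rho>)"
        by (simp add: reg_rep_delta_eq[OF g \<tau>])
    qed
    finally show ?thesis using R True by simp
  next
    case False
    then show ?thesis unfolding R reg_rep_delta_eq[OF conv_Cc[OF f g] \<tau>] by simp
  qed
qed

lemma reg_rep_Cr: "f \<in> Cc \<Sigma> \<Longrightarrow> reg_rep \<Sigma> G f \<in> Cr \<Sigma> G"
  unfolding Cr_iff using reg_rep_op_families bounded_by_mono[OF bounded_by_zero]
  by (metis diff_self less_imp_le)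

section \<open>The closure is an algebra\<close>

lemma Cr_zero: "0 \<in> Cr \<Sigma> G"
  using reg_rep_Cr[OF Cc_zero] by (simp add: reg_rep_zero)

lemma Cr_add:
  assumes a: "a \<in> Cr \<Sigma> G" and b: "b \<in> Cr \<Sigma> G"
  shows "a + b \<in> Cr \<Sigma> G"
  unfolding Cr_iff
proof (intro conjI allI impI)
  show "a + b \<in> op_families \<Sigma> G" using assms by (intro op_families_add Cr_op_families)
  fix e :: real assume "e > 0"
  then have e: "e / 2 > 0" by simp
  obtain f where f: "f \<in> Cc \<Sigma>" "bounded_by (e / 2) (a - reg_rep \<Sigma> G f)" using Cr_approx[OF a e] by blast
  obtain g where g: "g \<in> Cc \<Sigma>" "bounded_by (e / 2) (b - reg_rep \<Sigma> G g)" using Cr_approx[OF b e] by blast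
  have "bounded_by (e / 2 + e / 2) ((a - reg_rep \<Sigma> G f) + (b - reg_rep \<Sigma> G g))"
    using a b f g by (intro bounded_by_add linear_family_diff op_families_linear Cr_op_families reg_rep_op_families)
  moreover have "(a - reg_rep \<Sigma> G f) + (b - reg_rep \<Sigma> G g) = a + b - reg_rep \<Sigma> G (f + g)"
    unfolding reg_rep_add[OF f(1) g(1)] by simp
  ultimately show "\<exists>f\<in>Cc \<Sigma>. bounded_by e (a + b - reg_rep \<Sigma> G f)"
    using Cc_add[OF f(1) g(1)] by auto
qed

lemma Cr_scale:
  assumes a: "a \<in> Cr \<Sigma> G"
  shows "fam_scale c a \<in> Cr \<Sigma> G"
  unfolding Cr_iff
proof (intro conjI allI impI)
  show "fam_scale c a \<in> op_families \<Sigma> G" using assms by (intro op_families_scale Cr_op_families)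
  fix e :: real assume "e > 0"
  \<comment> \<open>The summand 1 keeps the denominator positive when \<open>c\<close> is
    zero.\<close>
  then have e: "e / (cmod c + 1) > 0" by (simp add: add_nonneg_pos)
  obtain f where f: "f \<in> Cc \<Sigma>" "bounded_by (e / (cmod c + 1)) (a - reg_rep \<Sigma> G f)"
    using Cr_approx[OF a e] by blast
  have "bounded_by (cmod c * (e / (cmod c + 1))) (fam_scale c (a - reg_rep \<Sigma> G f))"
    using a f by (intro bounded_by_scale linear_family_diff op_families_linear Cr_op_families reg_rep_op_families)
  moreover have "cmod c * (e / (cmod c + 1)) \<le> e"
    using \<open>e > 0\<close> add_nonneg_pos[OF norm_ge_zero zero_less_one, of c]
    by (simp add: pos_divide_le_eq distrib_left mult.commute)
  moreover have "fam_scale c (a - reg_rep \<Sigma> G f) = fam_scale c a - reg_rep \<Sigma> G (\<lambda>\<sigma>. c * f \<sigma>)"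
    unfolding reg_rep_scale[OF f(1)] by (simp add: fam_scale_def fun_eq_iff algebra_simps)
  ultimately have "bounded_by e (fam_scale c a - reg_rep \<Sigma> G (\<lambda>\<sigma>. c * f \<sigma>))"
    using bounded_by_mono by metis
  then show "\<exists>f\<in>Cc \<Sigma>. bounded_by e (fam_scale c a - reg_rep \<Sigma> G f)"
    using Cc_scale[OF f(1)] by blast
qed

text \<open>The usual splitting of a difference of products; composition distributes over the second
  difference because \<open>f\<close> is linear at each unit.\<close>

lemma fam_mult_split:
  assumes "a \<in> op_families \<Sigma> G" "b \<in> op_families \<Sigma> G" "f \<in> op_families \<Sigma> G" "g \<in> op_families \<Sigma> G"
  shows "fam_mult a b - fam_mult f g = fam_mult (a - f) b + fam_mult f (b - g)"
proof (rule ext, rule ext)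
  fix x \<xi>
  show "(fam_mult a b - fam_mult f g) x \<xi> = (fam_mult (a - f) b + fam_mult f (b - g)) x \<xi>"
  proof (cases "x \<in> units G")
    case True
    have "f x (b x \<xi> - g x \<xi>) = f x (b x \<xi>) - f x (g x \<xi>)"
      using assms True by (intro linear_op_diff_arg[OF op_families_linear_op] op_families_Hx)
    then show ?thesis by (simp add: fam_mult_def)
  next
    case False
    then have "a x = 0" "b x = 0" "f x = 0" "g x = 0" using assms op_families_outside by blast+
    then show ?thesis by (simp add: fam_mult_def fun_eq_iff)
  qed
qed

lemma Cr_mult:
  assumes a: "a \<in> Cr \<Sigma> G" and b: "b \<in> Cr \<Sigma> G"
  shows "fam_mult a b \<in> Cr \<Sigma> G"
  unfolding Cr_iff
proof (intro conjI allI impI)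
  note a' = Cr_op_families[OF a] and b' = Cr_op_families[OF b]
  show "fam_mult a b \<in> op_families \<Sigma> G" by (rule op_families_mult[OF a' b'])
  fix e :: real assume e: "e > 0"
  obtain D where D: "D \<ge> 0" "bounded_by D b" using op_families_bound[OF b'] by blast
  have "e / (2 * (D + 1)) > 0" using e D(1) by simp
  then obtain f where f: "f \<in> Cc \<Sigma>" "bounded_by (e / (2 * (D + 1))) (a - reg_rep \<Sigma> G f)"
    using Cr_approx[OF a] by blast
  note f' = reg_rep_op_families[OF f(1)]
  obtain C where C: "C \<ge> 0" "bounded_by C (reg_rep \<Sigma> G f)" using op_families_bound[OF f'] by blast
  \<comment> \<open>The tolerance for \<open>g\<close> depends on the bound \<open>C\<close> of the
    operators of \<open>f\<close>, so \<open>g\<close> is chosen after \<open>f\<close>.\<close>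
  have "e / (2 * (C + 1)) > 0" using e C(1) by simp
  then obtain g where g: "g \<in> Cc \<Sigma>" "bounded_by (e / (2 * (C + 1))) (b - reg_rep \<Sigma> G g)"
    using Cr_approx[OF b] by blast
  note g' = reg_rep_op_families[OF g(1)]
  have "bounded_by (e / (2 * (D + 1)) * D + C * (e / (2 * (C + 1))))
     (fam_mult (a - reg_rep \<Sigma> G f) b + fam_mult (reg_rep \<Sigma> G f) (b - reg_rep \<Sigma> G g))"
    using a' b' f' g' f(2) g(2) C D e
    by (intro bounded_by_add bounded_by_mult linear_family_mult linear_family_diff op_families_linear) auto
  moreover have "e / (2 * (D + 1)) * D \<le> e / 2" "C * (e / (2 * (C + 1))) \<le> e / 2"
    using e C D by (simp_all add: field_simps)
  then have "e / (2 * (D + 1)) * D + C * (e / (2 * (C + 1))) \<le> e / 2 + e / 2" by (rule add_mono)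
  then have "e / (2 * (D + 1)) * D + C * (e / (2 * (C + 1))) \<le> e" by simp
  ultimately have "bounded_by e (fam_mult a b - reg_rep \<Sigma> G (zero_outside (arr \<Sigma>) (conv \<Sigma> G f g)))"
    unfolding reg_rep_conv[OF f(1) g(1)] fam_mult_split[OF a' b' f' g'] using bounded_by_mono by blast
  then show "\<exists>f\<in>Cc \<Sigma>. bounded_by e (fam_mult a b - reg_rep \<Sigma> G f)"
    using conv_Cc[OF f(1) g(1)] by blast
qed

text \<open>The function on \<open>\<Sigma>\<close> of an element of the reduced algebra; for \<open>\<sigma>\<close> outside \<open>arr \<Sigma>\<close> its value is arbitrary.\<close>

definition func_of :: "('s, 'g) op_family \<Rightarrow> 's \<Rightarrow> complex" where
  "func_of a \<sigma> = a (proj \<Sigma> (src \<Sigma> \<sigma>)) (delta (src \<Sigma> \<sigma>)) \<sigma>"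

section \<open>The continuous function of an element and its open invariant support\<close>

lemma src_in_src_fibre [simp]: "\<sigma> \<in> arr \<Sigma> \<Longrightarrow> src \<Sigma> \<sigma> \<in> src_fibre \<Sigma> (proj \<Sigma> (src \<Sigma> \<sigma>))"
  and self_in_src_fibre [simp]: "\<sigma> \<in> arr \<Sigma> \<Longrightarrow> \<sigma> \<in> src_fibre \<Sigma> (proj \<Sigma> (src \<Sigma> \<sigma>))"
  by (auto simp: src_fibre_iff src_proj)

text \<open>Point masses have norm at most one and evaluation is bounded by the norm, so every
  matrix coefficient is controlled by the operator bound.\<close>

lemma delta_bound:
  assumes "linear_family a" "bounded_by e a" "\<tau> \<in> src_fibre \<Sigma> x" "e \<ge> 0"
  shows "cmod (a x (delta \<tau>) \<rho>) \<le> e"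
proof -
  have x: "x \<in> units G" using src_fibre_units[OF assms(3)] .
  note d = delta_Hx[OF assms(3)]
  have "cmod (a x (delta \<tau>) \<rho>) \<le> Hx_norm \<Sigma> G x (a x (delta \<tau>))"
    using assms(1) x d(1) by (intro Hx_pointwise) (auto simp: linear_family_def intro: linear_opD)
  also have "\<dots> \<le> e * Hx_norm \<Sigma> G x (delta \<tau>)" using assms(2) x d(1) unfolding bounded_by_def by blast
  also have "\<dots> \<le> e * 1" using d(2) assms(4) by (rule mult_left_mono)
  finally show ?thesis by simp
qed

lemma func_of_reg_rep: "\<lbrakk>f \<in> Cc \<Sigma>; \<sigma> \<in> arr \<Sigma>\<rbrakk> \<Longrightarrow> func_of (reg_rep \<Sigma> G f) \<sigma> = f \<sigma>"
  by (simp add: func_of_def reg_rep_delta_eq)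

lemma func_of_bound:
  assumes "linear_family a" "linear_family b" "bounded_by e (a - b)" "e \<ge> 0" "\<sigma> \<in> arr \<Sigma>"
  shows "cmod (func_of a \<sigma> - func_of b \<sigma>) \<le> e"
  using delta_bound[OF linear_family_diff[OF assms(1,2)] assms(3) src_in_src_fibre[OF assms(5)] assms(4)]
  unfolding func_of_def by simp

text \<open>For the operators of a function f in \<open>Cc\<close> both sides are
  f(\<rho>\<tau>^-1), and both depend continuously on the element. Hence the function
  \<open>func_of a\<close> determines all matrix coefficients.\<close>

lemma Cr_delta:
  assumes a: "a \<in> Cr \<Sigma> G" and \<rho>: "\<rho> \<in> src_fibre \<Sigma> x" and \<tau>: "\<tau> \<in> src_fibre \<Sigma> x"
  shows "a x (delta \<tau>) \<rho> = func_of a (gmul \<Sigma> \<rho> (ginv \<Sigma> \<tau>))"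
proof -
  let ?k = "gmul \<Sigma> \<rho> (ginv \<Sigma> \<tau>)"
  have k: "?k \<in> arr \<Sigma>" using \<rho> \<tau> by (auto simp: src_fibre_iff src_eq_src_iff)
  note la = op_families_linear[OF Cr_op_families[OF a]]
  have "cmod (a x (delta \<tau>) \<rho> - func_of a ?k) \<le> 0 + e" if "e > 0" for e
  proof -
    have e: "e / 2 > 0" using that by simp
    obtain f where f: "f \<in> Cc \<Sigma>" "bounded_by (e / 2) (a - reg_rep \<Sigma> G f)" using Cr_approx[OF a e] by blast
    note lf = op_families_linear[OF reg_rep_op_families[OF f(1)]]
    have "cmod ((a - reg_rep \<Sigma> G f) x (delta \<tau>) \<rho>) \<le> e / 2"
      using delta_bound[OF linear_family_diff[OF la lf] f(2) \<tau>] e by simp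
    then have 1: "cmod (a x (delta \<tau>) \<rho> - f ?k) \<le> e / 2"
      using \<rho> by (simp add: reg_rep_delta_eq[OF f(1) \<tau>])
    have 2: "cmod (func_of a ?k - f ?k) \<le> e / 2"
      using func_of_bound[OF la lf f(2) _ k] e func_of_reg_rep[OF f(1) k] by simp
    have "cmod ((a x (delta \<tau>) \<rho> - f ?k) - (func_of a ?k - f ?k)) \<le> e / 2 + e / 2"
      by (rule order_trans[OF norm_triangle_ineq4 add_mono[OF 1 2]])
    then show ?thesis by simp
  qed
  then have "cmod (a x (delta \<tau>) \<rho> - func_of a ?k) \<le> 0" by (rule field_le_epsilon)
  then show ?thesis by simp
qed

text \<open>Norm approximation of a by functions in \<open>Cc\<close> is uniform approximation of
  \<open>func_of a\<close>.\<close>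

lemma continuous_func_of:
  assumes a: "a \<in> Cr \<Sigma> G"
  shows "continuous_map (gtop \<Sigma>) euclidean (func_of a)"
proof (rule continuous_map_uniform_approx)
  fix e :: real assume e: "e > 0"
  obtain f where f: "f \<in> Cc \<Sigma>" "bounded_by e (a - reg_rep \<Sigma> G f)" using Cr_approx[OF a e] by blast
  have "dist (func_of a \<sigma>) (f \<sigma>) \<le> e" if "\<sigma> \<in> arr \<Sigma>" for \<sigma>
    using func_of_bound[OF op_families_linear[OF Cr_op_families[OF a]]
        op_families_linear[OF reg_rep_op_families[OF f(1)]] f(2) _ that] e func_of_reg_rep[OF f(1) that]
    by (simp add: dist_norm)
  then show "\<exists>k. continuous_map (gtop \<Sigma>) euclidean k \<and> (\<forall>x\<in>arr \<Sigma>. dist (func_of a x) (k x) \<le> e)"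
    using Cc_continuous[OF f(1)] by blast
qed

lemma Cr_eq_0_iff:
  assumes a: "a \<in> Cr \<Sigma> G"
  shows "a x = 0 \<longleftrightarrow> (\<forall>\<rho>\<in>src_fibre \<Sigma> x. \<forall>\<tau>\<in>src_fibre \<Sigma> x. func_of a (gmul \<Sigma> \<rho> (ginv \<Sigma> \<tau>)) = 0)"
proof
  assume "a x = 0"
  then show "\<forall>\<rho>\<in>src_fibre \<Sigma> x. \<forall>\<tau>\<in>src_fibre \<Sigma> x. func_of a (gmul \<Sigma> \<rho> (ginv \<Sigma> \<tau>)) = 0"
    using Cr_delta[OF a] by (metis zero_fun_apply)
next
  assume r: "\<forall>\<rho>\<in>src_fibre \<Sigma> x. \<forall>\<tau>\<in>src_fibre \<Sigma> x. func_of a (gmul \<Sigma> \<rho> (ginv \<Sigma> \<tau>)) = 0"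
  have "a x (delta \<tau>) = 0" if \<tau>: "\<tau> \<in> src_fibre \<Sigma> x" for \<tau>
  proof
    fix \<rho>
    show "a x (delta \<tau>) \<rho> = 0 \<rho>"
    proof (cases "\<rho> \<in> src_fibre \<Sigma> x")
      case False
      then show ?thesis
        using Hx_twisted[OF op_families_Hx[OF Cr_op_families[OF a] src_fibre_units[OF \<tau>]]]
        by (simp add: twisted_fun_def)
    qed (use r \<tau> Cr_delta[OF a] in simp)
  qed
  then show "a x = 0"
    using linear_op_ext[OF Cr_op_families[OF a] op_families_zero, of x] by simp
qed

text \<open>A nonzero coefficient at x is a nonzero value of the function at some \<rho>\<tau>^-1,
  an arrow whose source is r(\<tau>) for an arrow \<tau> starting at x. So the support is the
  saturation, under the groupoid, of the source image of the set where the function is nonzero;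
  openness and invariance can be read off.\<close>

lemma Cr_support_eq:
  assumes a: "a \<in> Cr \<Sigma> G"
  shows "{x. a x \<noteq> 0} = src G ` {\<gamma> \<in> arr G. rng G \<gamma> \<in> src G ` proj \<Sigma> ` {\<sigma> \<in> arr \<Sigma>. func_of a \<sigma> \<noteq> 0}}"
    (is "_ = src G ` {\<gamma> \<in> arr G. rng G \<gamma> \<in> ?O}")
proof (intro subset_antisym subsetI)
  fix x assume "x \<in> {x. a x \<noteq> 0}"
  then obtain \<rho> \<tau> where rt: "\<rho> \<in> src_fibre \<Sigma> x" "\<tau> \<in> src_fibre \<Sigma> x" "func_of a (gmul \<Sigma> \<rho> (ginv \<Sigma> \<tau>)) \<noteq> 0"
    using Cr_eq_0_iff[OF a, of x] by auto
  let ?k = "gmul \<Sigma> \<rho> (ginv \<Sigma> \<tau>)"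
  have k: "?k \<in> arr \<Sigma>" "src \<Sigma> ?k = rng \<Sigma> \<tau>" and t: "\<tau> \<in> arr \<Sigma>" "src G (proj \<Sigma> \<tau>) = x"
    using rt by (auto simp: src_fibre_iff src_eq_src_iff)
  have "src G (proj \<Sigma> ?k) = rng G (proj \<Sigma> \<tau>)" using k t by (simp add: src_proj rng_proj del: proj_gmul)
  then have "rng G (proj \<Sigma> \<tau>) \<in> ?O" using k rt(3) by (intro image_eqI[of _ _ "proj \<Sigma> ?k"] imageI) auto
  then show "x \<in> src G ` {\<gamma> \<in> arr G. rng G \<gamma> \<in> ?O}" using t by (intro image_eqI[of _ _ "proj \<Sigma> \<tau>"]) auto
next
  fix x assume "x \<in> src G ` {\<gamma> \<in> arr G. rng G \<gamma> \<in> ?O}"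
  then obtain \<gamma> \<sigma> where gs: "\<gamma> \<in> arr G" "x = src G \<gamma>" "\<sigma> \<in> arr \<Sigma>" "func_of a \<sigma> \<noteq> 0"
    "rng G \<gamma> = src G (proj \<Sigma> \<sigma>)" by auto
  let ?t = "lift \<Sigma> \<gamma>"
  have c: "src \<Sigma> \<sigma> = rng \<Sigma> ?t" using gs by (simp add: src_eq_rng_iff)
  have "gmul \<Sigma> \<sigma> ?t \<in> src_fibre \<Sigma> x" "?t \<in> src_fibre \<Sigma> x" using gs c by (auto simp: src_fibre_iff)
  moreover have "gmul \<Sigma> (gmul \<Sigma> \<sigma> ?t) (ginv \<Sigma> ?t) = \<sigma>" using gs c by simp
  ultimately have "a x \<noteq> 0" using Cr_eq_0_iff[OF a, of x] gs(4) by metis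
  then show "x \<in> {x. a x \<noteq> 0}" by simp
qed

lemma openin_Cr_support:
  assumes a: "a \<in> Cr \<Sigma> G"
  shows "openin (gtop G) {x. a x \<noteq> 0}"
proof -
  have "openin (gtop \<Sigma>) {\<sigma> \<in> arr \<Sigma>. func_of a \<sigma> \<in> - {0}}"
    by (rule openin_continuous_map_preimage[OF continuous_func_of[OF a]]) auto
  then have "openin (gtop G) (proj \<Sigma> ` {\<sigma> \<in> arr \<Sigma>. func_of a \<sigma> \<noteq> 0})"
    using open_map_proj unfolding open_map_def by simp
  then show ?thesis
    unfolding Cr_support_eq[OF a]
    by (intro open_map_src openin_continuous_map_preimage[OF continuous_rng_G])
qed

lemma invariant_Cr_support:
  assumes a: "a \<in> Cr \<Sigma> G"
  shows "invariant G {x. a x \<noteq> 0}"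
  unfolding invariant_def
proof (intro conjI ballI impI)
  show "{x. a x \<noteq> 0} \<subseteq> units G" using op_families_outside[OF Cr_op_families[OF a]] by blast
  fix b assume b: "b \<in> arr G" "src G b \<in> {x. a x \<noteq> 0}"
  then obtain \<gamma> where g: "\<gamma> \<in> arr G" "src G b = src G \<gamma>"
    "rng G \<gamma> \<in> src G ` proj \<Sigma> ` {\<sigma> \<in> arr \<Sigma>. func_of a \<sigma> \<noteq> 0}"
    unfolding Cr_support_eq[OF a] by auto
  \<comment> \<open>The arrow \<gamma>b^-1 starts at r(b) and ends at r(\<gamma>), which puts r(b)
    in the same saturation.\<close>
  then have "rng G b = src G (gmul G \<gamma> (ginv G b))" "gmul G \<gamma> (ginv G b) \<in> arr G"
    "rng G (gmul G \<gamma> (ginv G b)) = rng G \<gamma>"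
    using b by auto
  then show "rng G b \<in> {x. a x \<noteq> 0}" unfolding Cr_support_eq[OF a] using g(3)
    by (intro image_eqI[of _ _ "gmul G \<gamma> (ginv G b)"]) auto
qed

end

section \<open>Ideals of open invariant sets\<close>

text \<open>Complete regularity gives g with value 0 at x and 1 off the intersection of W with an
  open set U inside a compact set; the bump is 1 - g.\<close>

lemma locally_compact_bump:
  assumes "locally_compact_space X" "Hausdorff_space X" "openin X W" "x \<in> W"
  obtains f :: "'a \<Rightarrow> real" and K where "continuous_map X euclideanreal f" "f x = 1"
    "\<And>y. y \<in> topspace X \<Longrightarrow> 0 \<le> f y" "\<And>y. \<lbrakk>y \<in> topspace X; f y \<noteq> 0\<rbrakk> \<Longrightarrow> y \<in> W \<inter> K" "compactin X K"
proof -
  have x: "x \<in> topspace X" using assms(3,4) openin_subset by blast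
  obtain U K where UK: "openin X U" "compactin X K" "x \<in> U" "U \<subseteq> K"
    using assms(1) x unfolding locally_compact_space_def by blast
  have "regular_space X" by (rule locally_compact_Hausdorff_imp_regular_space[OF assms(1,2)])
  then have cr: "completely_regular_space X"
    using assms(1) locally_compact_regular_imp_completely_regular_space by blast
  have "closedin X (topspace X - U \<inter> W)" "x \<in> topspace X - (topspace X - U \<inter> W)"
    using UK assms(3,4) x by (auto intro: openin_Int)
  then obtain g :: "'a \<Rightarrow> real" where g: "continuous_map X (top_of_set {0..1}) g" "g x = 0"
    "g ` (topspace X - U \<inter> W) \<subseteq> {1}"
    using cr unfolding completely_regular_space_def by blast
  have gr: "g y \<le> 1" if "y \<in> topspace X" for y
    using continuous_map_image_subset_topspace[OF g(1)] that by auto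
  show ?thesis
  proof (rule that[of "\<lambda>y. 1 - g y" K])
    show "continuous_map X euclideanreal (\<lambda>y. 1 - g y)"
      using g(1) by (intro continuous_map_diff) (auto simp: continuous_map_in_subtopology)
    show "y \<in> W \<inter> K" if y: "y \<in> topspace X" "1 - g y \<noteq> 0" for y
    proof (rule ccontr)
      assume "y \<notin> W \<inter> K"
      then have "g y \<in> g ` (topspace X - U \<inter> W)" using y UK(4) by blast
      then show False using g(3) y(2) by auto
    qed
  qed (use g gr UK in auto)
qed

section \<open>Functions on the unit space as multiplication operators\<close>

context etale_twist
begin

lemma diag_fun_incl [simp]:
  assumes "y \<in> units G" "cmod z = 1"
  shows "diag_fun \<Sigma> G h (incl \<Sigma> (y, z)) = z * h y"
proof -
  have "inv_into (arr (circle_bundle G)) (incl \<Sigma>) (incl \<Sigma> (y, z)) = (y, z)"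
    unfolding arr_circle_bundle by (rule inv_into_f_f[OF incl_inj]) (use assms in auto)
  moreover have "incl \<Sigma> (y, z) \<in> incl \<Sigma> ` arr (circle_bundle G)"
    unfolding arr_circle_bundle using assms by auto
  ultimately show ?thesis unfolding diag_fun_def by simp
qed

lemma diag_fun_outside:
  "\<not> (\<sigma> \<in> arr \<Sigma> \<and> proj \<Sigma> \<sigma> \<in> units G) \<Longrightarrow> diag_fun \<Sigma> G h \<sigma> = 0"
  unfolding diag_fun_def arr_circle_bundle incl_image by auto

lemma over_units_cases:
  assumes "\<sigma> \<in> arr \<Sigma>" "proj \<Sigma> \<sigma> \<in> units G"
  obtains z where "cmod z = 1" "\<sigma> = incl \<Sigma> (proj \<Sigma> \<sigma>, z)"
proof -
  have "\<sigma> \<in> incl \<Sigma> ` (units G \<times> sphere 0 1)" unfolding incl_image using assms by simp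
  then obtain y z where yz: "y \<in> units G" "cmod z = 1" "\<sigma> = incl \<Sigma> (y, z)" by auto
  then show ?thesis using that[of z] by simp
qed

lemma equivariant_diag_fun: "equivariant (diag_fun \<Sigma> G h)"
  unfolding equivariant_def
proof (intro ballI allI impI)
  fix \<sigma> w assume \<sigma>: "\<sigma> \<in> arr \<Sigma>" and w: "cmod (w::complex) = 1"
  show "diag_fun \<Sigma> G h (circle_act \<Sigma> w \<sigma>) = w * diag_fun \<Sigma> G h \<sigma>"
  proof (cases "proj \<Sigma> \<sigma> \<in> units G")
    case True
    obtain z where z: "cmod z = 1" "\<sigma> = incl \<Sigma> (proj \<Sigma> \<sigma>, z)" using over_units_cases[OF \<sigma> True] by blast
    have "circle_act \<Sigma> w \<sigma> = incl \<Sigma> (proj \<Sigma> \<sigma>, w * z)"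
      using act_incl[OF True z(1) w] z(2) by simp
    moreover have "diag_fun \<Sigma> G h \<sigma> = z * h (proj \<Sigma> \<sigma>)" using diag_fun_incl[OF True z(1)] z(2) by metis
    ultimately show ?thesis using True z w by (simp add: norm_mult)
  next
    case False
    then show ?thesis using \<sigma> w by (simp add: diag_fun_outside)
  qed
qed

lemma openin_over_units: "openin (gtop \<Sigma>) {\<sigma> \<in> arr \<Sigma>. proj \<Sigma> \<sigma> \<in> units G}"
  by (rule openin_continuous_map_preimage[OF continuous_proj openin_units])

lemma closedin_over_units: "closedin (gtop \<Sigma>) {\<sigma> \<in> arr \<Sigma>. proj \<Sigma> \<sigma> \<in> units G}"
  by (rule closedin_continuous_map_preimage[OF continuous_proj closedin_units])

text \<open>The arrows over units form a clopen set. There \<open>incl\<close> transports the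
  continuous function z h(x), and off it the function is zero, so the two pieces glue.\<close>

lemma diag_fun_continuous:
  assumes h: "continuous_map (unit_top G) euclidean h"
  shows "continuous_map (gtop \<Sigma>) euclidean (diag_fun \<Sigma> G h)"
proof -
  let ?E = "{\<sigma> \<in> arr \<Sigma>. proj \<Sigma> \<sigma> \<in> units G}"
  let ?P = "prod_topology (unit_top G) (top_of_set (sphere (0::complex) 1))"
  obtain k where k: "homeomorphic_maps ?P (subtopology (gtop \<Sigma>) ?E) (incl \<Sigma>) k"
    using incl_homeo homeomorphic_map_maps by blast
  have tE: "topspace (subtopology (gtop \<Sigma>) ?E) = ?E" by auto
  have s: "continuous_map ?P euclidean snd"
    using continuous_map_snd continuous_map_into_fulltopology by blast
  have "continuous_map ?P euclidean (\<lambda>p. snd p * h (fst p))"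
    using s continuous_map_compose[OF continuous_map_fst h, of "top_of_set (sphere (0::complex) 1)"]
    unfolding o_def by (rule continuous_map_normed_mult)
  moreover have ck: "continuous_map (subtopology (gtop \<Sigma>) ?E) ?P k"
    using k unfolding homeomorphic_maps_def by blast
  ultimately have c: "continuous_map (subtopology (gtop \<Sigma>) ?E) euclidean (\<lambda>\<sigma>. snd (k \<sigma>) * h (fst (k \<sigma>)))"
    using continuous_map_compose[OF ck] unfolding o_def by blast
  have cE: "continuous_map (subtopology (gtop \<Sigma>) ?E) euclidean (diag_fun \<Sigma> G h)"
  proof (rule continuous_map_eq[OF c])
    fix \<sigma> assume "\<sigma> \<in> topspace (subtopology (gtop \<Sigma>) ?E)"
    then have \<sigma>: "\<sigma> \<in> ?E" unfolding tE .
    then obtain z where z: "cmod z = 1" "\<sigma> = incl \<Sigma> (proj \<Sigma> \<sigma>, z)" using over_units_cases by blast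
    have "k (incl \<Sigma> (proj \<Sigma> \<sigma>, z)) = (proj \<Sigma> \<sigma>, z)"
      using k z(1) \<sigma> unfolding homeomorphic_maps_def by auto
    then have "k \<sigma> = (proj \<Sigma> \<sigma>, z)" using z(2) by metis
    moreover have "diag_fun \<Sigma> G h \<sigma> = z * h (proj \<Sigma> \<sigma>)"
      using diag_fun_incl[of "proj \<Sigma> \<sigma>" z h] z \<sigma> by auto
    ultimately show "snd (k \<sigma>) * h (fst (k \<sigma>)) = diag_fun \<Sigma> G h \<sigma>" by simp
  qed
  show ?thesis
    unfolding continuous_map_eps_iff
  proof (intro ballI allI impI)
    fix \<sigma> and e :: real assume \<sigma>: "\<sigma> \<in> arr \<Sigma>" and e: "e > 0"
    show "\<exists>U. openin (gtop \<Sigma>) U \<and> \<sigma> \<in> U \<and> (\<forall>y\<in>U. dist (diag_fun \<Sigma> G h y) (diag_fun \<Sigma> G h \<sigma>) < e)"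
    proof (cases "\<sigma> \<in> ?E")
      case True
      then obtain U where U: "openin (subtopology (gtop \<Sigma>) ?E) U" "\<sigma> \<in> U"
        "\<forall>y\<in>U. dist (diag_fun \<Sigma> G h y) (diag_fun \<Sigma> G h \<sigma>) < e"
        using cE[unfolded continuous_map_eps_iff, rule_format, of \<sigma> e] e unfolding tE by blast
      then show ?thesis using openin_open_subtopology[OF openin_over_units] by blast
    next
      case False
      have "openin (gtop \<Sigma>) (topspace (gtop \<Sigma>) - ?E)"
        by (rule openin_diff[OF openin_topspace closedin_over_units])
      moreover have "dist (diag_fun \<Sigma> G h y) (diag_fun \<Sigma> G h \<sigma>) < e" if "y \<in> topspace (gtop \<Sigma>) - ?E" for y
        using that False e by (simp add: diag_fun_outside)
      ultimately show ?thesis using \<sigma> False by (intro exI[of _ "topspace (gtop \<Sigma>) - ?E"]) simp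
    qed
  qed
qed

lemma diag_fun_Cc:
  assumes h: "continuous_map (unit_top G) euclidean h"
    and K: "compactin (unit_top G) K" "\<And>y. \<lbrakk>y \<in> units G; h y \<noteq> 0\<rbrakk> \<Longrightarrow> y \<in> K"
  shows "diag_fun \<Sigma> G h \<in> Cc \<Sigma>"
proof -
  let ?E = "{\<sigma> \<in> arr \<Sigma>. proj \<Sigma> \<sigma> \<in> units G}"
  let ?P = "prod_topology (unit_top G) (top_of_set (sphere (0::complex) 1))"
  have "compactin (top_of_set (sphere (0::complex) 1)) (sphere 0 1)"
    by (simp add: compactin_subtopology)
  then have "compactin ?P (K \<times> sphere 0 1)" using K(1) by (simp add: compactin_Times)
  then have "compactin (subtopology (gtop \<Sigma>) ?E) (incl \<Sigma> ` (K \<times> sphere 0 1))"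
    by (rule image_compactin[OF _ homeomorphic_imp_continuous_map[OF incl_homeo]])
  then have c: "compactin (gtop \<Sigma>) (incl \<Sigma> ` (K \<times> sphere 0 1))" unfolding compactin_subtopology by blast
  show ?thesis
  proof (rule CcI[OF diag_fun_continuous[OF h] _ equivariant_diag_fun c])
    fix \<sigma> assume \<sigma>: "\<sigma> \<in> arr \<Sigma>" "diag_fun \<Sigma> G h \<sigma> \<noteq> 0"
    then have u: "proj \<Sigma> \<sigma> \<in> units G" using diag_fun_outside by blast
    then obtain z where z: "cmod z = 1" "\<sigma> = incl \<Sigma> (proj \<Sigma> \<sigma>, z)" using over_units_cases \<sigma>(1) by blast
    then have "diag_fun \<Sigma> G h \<sigma> = z * h (proj \<Sigma> \<sigma>)" using diag_fun_incl[OF u z(1)] by metis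
    then have "proj \<Sigma> \<sigma> \<in> K" using K(2) u \<sigma>(2) by auto
    then show "\<sigma> \<in> incl \<Sigma> ` (K \<times> sphere 0 1)" using z by (intro image_eqI[of _ _ "(proj \<Sigma> \<sigma>, z)"]) auto
  qed (simp add: diag_fun_outside)
qed

lemma compactly_supported_diag_fun_Cc: "compactly_supported (unit_top G) h \<Longrightarrow> diag_fun \<Sigma> G h \<in> Cc \<Sigma>"
  unfolding compactly_supported_def
  by (rule diag_fun_Cc[of h "unit_top G closure_of {x \<in> topspace (unit_top G). h x \<noteq> 0}"])
    (use closure_of_subset[of "{x \<in> units G. h x \<noteq> 0}" "unit_top G"] in auto)

text \<open>The diagonal function lives over units, and the only unit with range r(\<sigma>) is
  r(\<sigma>) itself. A single summand remains, and the action is pointwise multiplication.\<close>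

lemma reg_rep_diag_fun:
  assumes "x \<in> units G" "\<xi> \<in> Hx \<Sigma> G x" "\<sigma> \<in> src_fibre \<Sigma> x"
  shows "reg_rep \<Sigma> G (diag_fun \<Sigma> G h) x \<xi> \<sigma> = h (proj \<Sigma> (rng \<Sigma> \<sigma>)) * \<xi> \<sigma>"
proof -
  have \<sigma>: "\<sigma> \<in> arr \<Sigma>" using assms(3) by (simp add: src_fibre_iff)
  let ?y = "proj \<Sigma> (rng \<Sigma> \<sigma>)" and ?d = "diag_fun \<Sigma> G h"
  have y: "?y \<in> units G" using \<sigma> by simp
  have "conv \<Sigma> G ?d \<xi> \<sigma> = (\<Sum>\<gamma>\<in>{?y}. ?d (lift \<Sigma> \<gamma>) * \<xi> (gmul \<Sigma> (ginv \<Sigma> (lift \<Sigma> \<gamma>)) \<sigma>))"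
  proof (rule conv_eq_sum[OF \<sigma>])
    fix \<gamma> assume g: "\<gamma> \<in> arr G" "rng G \<gamma> = ?y" "\<gamma> \<notin> {?y}"
    then have "\<gamma> \<notin> units G" using base.unit_rng by force
    then have "?d (lift \<Sigma> \<gamma>) = 0" using g by (simp add: diag_fun_outside)
    then show "?d (lift \<Sigma> \<gamma>) * \<xi> (gmul \<Sigma> (ginv \<Sigma> (lift \<Sigma> \<gamma>)) \<sigma>) = 0" by simp
  qed (use y in auto)
  also have "\<dots> = ?d (lift \<Sigma> ?y) * \<xi> (gmul \<Sigma> (ginv \<Sigma> (lift \<Sigma> ?y)) \<sigma>)" by simp
  \<comment> \<open>The arbitrary lift of the unit is exchanged for the unit of the twist, so that
    no circle factor remains.\<close>
  also have "\<dots> = ?d (rng \<Sigma> \<sigma>) * \<xi> (gmul \<Sigma> (ginv \<Sigma> (rng \<Sigma> \<sigma>)) \<sigma>)"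
    by (rule conv_term_lift[OF equivariant_diag_fun Hx_equivariant[OF assms(2)]]) (use y \<sigma> in auto)
  also have "?d (rng \<Sigma> \<sigma>) = h ?y" using diag_fun_incl[OF y, of 1 h] \<sigma> by simp
  also have "gmul \<Sigma> (ginv \<Sigma> (rng \<Sigma> \<sigma>)) \<sigma> = \<sigma>" using \<sigma> by simp
  finally show ?thesis using assms by (simp add: reg_rep_def)
qed

lemma fam_mult_zero_left: "a x = 0 \<Longrightarrow> fam_mult a b x = 0"
  by (rule ext) (simp add: fam_mult_def)

lemma fam_mult_zero_right:
  assumes "a \<in> op_families \<Sigma> G" "b x = 0"
  shows "fam_mult a b x = 0"
proof
  fix \<xi>
  have "b x \<xi> = 0" using assms(2) by simp
  then show "fam_mult a b x \<xi> = 0 \<xi>"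
    unfolding fam_mult_def o_def using op_families_zero_arg[OF assms(1), of x] by (metis zero_fun_apply)
qed

text \<open>By exactness these ideals are the algebras \<open>Cr_sub \<Sigma> G D\<close> when \<open>D\<close> is open and invariant.\<close>

definition supported_ideal :: "'g set \<Rightarrow> ('s, 'g) op_family set" where
  "supported_ideal D = {a \<in> Cr \<Sigma> G. \<forall>x. a x \<noteq> 0 \<longrightarrow> x \<in> D}"

lemma supported_ideal_mono: "D \<subseteq> E \<Longrightarrow> supported_ideal D \<subseteq> supported_ideal E"
  unfolding supported_ideal_def by blast

text \<open>Closedness holds because matrix coefficients at a fixed unit are norm continuous, so
  vanishing at that unit passes to limits.\<close>

lemma closed_ideal_supported_ideal: "closed_ideal \<Sigma> G (supported_ideal D)"
  unfolding closed_ideal_def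
proof (intro conjI ballI allI)
  let ?J = "supported_ideal D"
  show J: "?J \<subseteq> Cr \<Sigma> G" unfolding supported_ideal_def by blast
  show "0 \<in> ?J" unfolding supported_ideal_def using Cr_zero by simp
  show "a + b \<in> ?J" if "a \<in> ?J" "b \<in> ?J" for a b
    using that unfolding supported_ideal_def
    by (auto intro: Cr_add) (metis add.right_neutral)
  show "fam_scale c a \<in> ?J" if "a \<in> ?J" for c a
  proof -
    have "fam_scale c a x = 0" if "a x = 0" for x using that by (simp add: fam_scale_def fun_eq_iff)
    then show ?thesis using \<open>a \<in> ?J\<close> Cr_scale[of a c] unfolding supported_ideal_def by blast
  qed
  fix a b assume a: "a \<in> ?J" and b: "b \<in> Cr \<Sigma> G"
  have aC: "a \<in> Cr \<Sigma> G" using a J by blast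
  show "fam_mult a b \<in> ?J" "fam_mult b a \<in> ?J"
    using a Cr_mult[OF aC b] Cr_mult[OF b aC] fam_mult_zero_left[of a _ b]
      fam_mult_zero_right[OF Cr_op_families[OF b], of a]
    unfolding supported_ideal_def by blast+
next
  let ?J = "supported_ideal D"
  show "norm_closure \<Sigma> G (Cr \<Sigma> G) ?J \<subseteq> ?J"
  proof
    fix a assume a: "a \<in> norm_closure \<Sigma> G (Cr \<Sigma> G) ?J"
    have JJ: "?J \<subseteq> op_families \<Sigma> G" "Cr \<Sigma> G \<subseteq> op_families \<Sigma> G"
      unfolding supported_ideal_def using Cr_op_families by auto
    have aC: "a \<in> Cr \<Sigma> G" and ap: "\<And>e. e > 0 \<Longrightarrow> \<exists>b\<in>?J. bounded_by e (a - b)"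
      using a norm_closure_iff[OF JJ(2,1), of a] by auto
    have "a x = 0" if x: "x \<notin> D" for x
    proof (rule linear_op_ext[OF Cr_op_families[OF aC] op_families_zero, of x, simplified])
      fix \<tau> assume \<tau>: "\<tau> \<in> src_fibre \<Sigma> x"
      show "a x (delta \<tau>) = 0"
      proof
        fix \<rho>
        have "cmod (a x (delta \<tau>) \<rho>) \<le> 0 + e" if e: "e > 0" for e
        proof -
          obtain b where b: "b \<in> ?J" "bounded_by e (a - b)" using ap[OF e] by blast
          have "b x = 0" using b(1) x unfolding supported_ideal_def by blast
          then show ?thesis
            using delta_bound[OF linear_family_diff[OF op_families_linear op_families_linear] b(2) \<tau>, of \<rho>]
              Cr_op_families[OF aC] JJ(1) b(1) e by auto
        qed
        then have "cmod (a x (delta \<tau>) \<rho>) \<le> 0" by (rule field_le_epsilon)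
        then show "a x (delta \<tau>) \<rho> = 0 \<rho>" by simp
      qed
    qed
    then show "a \<in> ?J" using aC unfolding supported_ideal_def by blast
  qed
qed

section \<open>Annihilators and interiors\<close>

lemma ex_diag_bump:
  assumes "openin (gtop G) W" "W \<subseteq> units G" "y \<in> W"
  obtains h where "diag_fun \<Sigma> G h \<in> Cc \<Sigma>" "h y = 1" "\<And>x. x \<in> units G - W \<Longrightarrow> h x = 0"
proof -
  have "locally_compact_space (unit_top G)" "Hausdorff_space (unit_top G)"
    unfolding unit_top_def
    using locally_compact_space_closed_subset[OF locally_compact_G closedin_units]
      Hausdorff_space_subtopology[OF Hausdorff_G] by auto
  moreover have "openin (unit_top G) W" using assms openin_unit_top by blast
  ultimately obtain f :: "'g \<Rightarrow> real" and K where f: "continuous_map (unit_top G) euclideanreal f" "f y = 1"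
    "\<And>y. \<lbrakk>y \<in> topspace (unit_top G); f y \<noteq> 0\<rbrakk> \<Longrightarrow> y \<in> W \<inter> K" "compactin (unit_top G) K"
    using assms(3) by (rule locally_compact_bump) (rule that; assumption)
  have "continuous_map (unit_top G) euclidean (complex_of_real \<circ> f)"
    by (rule continuous_map_compose[OF f(1)]) (simp add: continuous_on_of_real)
  then have "diag_fun \<Sigma> G (complex_of_real \<circ> f) \<in> Cc \<Sigma>"
    by (rule diag_fun_Cc[OF _ f(4)]) (use f(3) in auto)
  then show ?thesis by (rule that) (use f(2,3) in auto)
qed

text \<open>Some vector in the image of a at x is nonzero at an arrow \<sigma> starting at x. The
  multiplier is taken to be 1 at r(\<sigma>), which lies in W by invariance; left multiplication by
  it preserves the value at \<sigma>.\<close>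

lemma diag_bump_mult:
  assumes W: "openin (gtop G) W" "invariant G W" and a: "a \<in> Cr \<Sigma> G" and x: "a x \<noteq> 0" "x \<in> W"
  obtains b where "b \<in> supported_ideal W" "fam_mult b a \<noteq> 0"
proof -
  have xu: "x \<in> units G" using op_families_outside[OF Cr_op_families[OF a]] x(1) by blast
  have "\<exists>\<xi>. a x \<xi> \<noteq> 0" using x(1) by (auto simp: fun_eq_iff)
  then obtain \<xi> where "a x \<xi> \<noteq> 0" by blast
  then obtain \<sigma> where \<sigma>: "a x \<xi> \<sigma> \<noteq> 0" by (auto simp: fun_eq_iff)
  note aH = op_families_Hx[OF Cr_op_families[OF a] xu, of \<xi>]
  have s: "\<sigma> \<in> src_fibre \<Sigma> x" using \<sigma> Hx_twisted[OF aH] unfolding twisted_fun_def by blast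
  then have sa: "\<sigma> \<in> arr \<Sigma>" "src G (proj \<Sigma> \<sigma>) = x" by (auto simp: src_fibre_iff)
  let ?y = "proj \<Sigma> (rng \<Sigma> \<sigma>)"
  have y: "?y \<in> W" using base.invariant_src_iff[OF W(2), of "proj \<Sigma> \<sigma>"] sa x(2) by (simp add: rng_proj)
  have Wu: "W \<subseteq> units G" using W(2) by (simp add: invariant_def)
  obtain h where h: "diag_fun \<Sigma> G h \<in> Cc \<Sigma>" "h ?y = 1" "\<And>x. x \<in> units G - W \<Longrightarrow> h x = 0"
    using ex_diag_bump[OF W(1) Wu y] by blast
  let ?b = "reg_rep \<Sigma> G (diag_fun \<Sigma> G h)"
  \<comment> \<open>Arrows starting outside \<open>W\<close> end outside \<open>W\<close>, where
    \<open>h\<close> vanishes.\<close>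
  have "?b x' = 0" if x': "x' \<notin> W" for x'
  proof (intro ext)
    fix \<eta> \<rho>
    show "?b x' \<eta> \<rho> = 0 \<eta> \<rho>"
    proof (cases "x' \<in> units G \<and> \<eta> \<in> Hx \<Sigma> G x' \<and> \<rho> \<in> src_fibre \<Sigma> x'")
      case True
      then have "proj \<Sigma> (rng \<Sigma> \<rho>) \<in> units G - W"
        using base.invariant_src_iff[OF W(2), of "proj \<Sigma> \<rho>"] x' by (auto simp: src_fibre_iff rng_proj)
      then show ?thesis using True h(3) by (simp add: reg_rep_diag_fun)
    qed (auto simp: reg_rep_def)
  qed
  then have "?b \<in> supported_ideal W" unfolding supported_ideal_def using reg_rep_Cr[OF h(1)] by blast
  moreover have "fam_mult ?b a x \<xi> \<sigma> \<noteq> 0"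
    using reg_rep_diag_fun[OF xu aH s, of h] h(2) \<sigma> by (simp add: fam_mult_def)
  then have "fam_mult ?b a \<noteq> 0" by (metis zero_fun_apply)
  ultimately show ?thesis by (rule that)
qed

lemma supported_ideal_mult_zero:
  assumes "a \<in> supported_ideal D" "b \<in> supported_ideal E" "D \<inter> E = {}"
  shows "fam_mult a b = 0"
proof
  fix x
  have a: "a \<in> op_families \<Sigma> G" using assms(1) Cr_op_families unfolding supported_ideal_def by blast
  show "fam_mult a b x = 0 x"
    using assms fam_mult_zero_left[of a x b] fam_mult_zero_right[OF a, of b x]
    unfolding supported_ideal_def by auto
qed

text \<open>Multipliers supported in W detect every operator at a unit of W. Conversely, a product
  of elements with disjoint supports vanishes at each unit.\<close>

lemma annihilator_supported_ideal:
  assumes W: "openin (gtop G) W" "invariant G W"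
  shows "annihilator \<Sigma> G (supported_ideal W) = supported_ideal (units G - W)"
proof (intro subset_antisym subsetI)
  fix a assume a: "a \<in> annihilator \<Sigma> G (supported_ideal W)"
  then have aC: "a \<in> Cr \<Sigma> G" and z: "\<And>b. b \<in> supported_ideal W \<Longrightarrow> fam_mult b a = 0"
    unfolding annihilator_def by auto
  have "x \<in> units G - W" if x: "a x \<noteq> 0" for x
  proof (rule ccontr)
    assume "x \<notin> units G - W"
    then have "x \<in> W" using op_families_outside[OF Cr_op_families[OF aC]] x by blast
    then show False using diag_bump_mult[OF W aC x] z by blast
  qed
  then show "a \<in> supported_ideal (units G - W)" unfolding supported_ideal_def using aC by blast
next
  fix a assume a: "a \<in> supported_ideal (units G - W)"
  have "fam_mult a b = 0" "fam_mult b a = 0" if "b \<in> supported_ideal W" for b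
    using supported_ideal_mult_zero[OF a that] supported_ideal_mult_zero[OF that a] by auto
  then show "a \<in> annihilator \<Sigma> G (supported_ideal W)"
    using a unfolding annihilator_def supported_ideal_def by blast
qed

text \<open>The support of an element is open, so it lies in D only if it lies in the interior. This
  restores openness after a complement has been taken.\<close>

lemma supported_ideal_interior:
  assumes "D \<subseteq> units G"
  shows "supported_ideal (unit_top G interior_of D) = supported_ideal D"
proof (intro subset_antisym subsetI)
  fix a assume a: "a \<in> supported_ideal D"
  then have "openin (unit_top G) {x. a x \<noteq> 0}" "{x. a x \<noteq> 0} \<subseteq> D"
    using openin_Cr_support[of a] assms unfolding supported_ideal_def openin_unit_top by auto
  then have "{x. a x \<noteq> 0} \<subseteq> unit_top G interior_of D" by (rule interior_of_maximal[rotated])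
  then show "a \<in> supported_ideal (unit_top G interior_of D)" using a unfolding supported_ideal_def by auto
qed (use supported_ideal_mono[OF interior_of_subset] in blast)

text \<open>The range map is open, so the ranges of the arrows starting in the interior form an open
  set; it is contained in D and hence in the interior.\<close>

lemma invariant_interior:
  assumes D: "invariant G D"
  shows "invariant G (unit_top G interior_of D)"
  unfolding invariant_def
proof (intro conjI ballI impI)
  let ?I = "unit_top G interior_of D"
  have I: "openin (gtop G) ?I" "?I \<subseteq> D" "D \<subseteq> units G"
    using openin_interior_of[of "unit_top G" D] interior_of_subset[of "unit_top G" D] D
    unfolding openin_unit_top invariant_def by auto
  then show "?I \<subseteq> units G" by blast
  fix a assume a: "a \<in> arr G" "src G a \<in> ?I"
  let ?O = "rng G ` {\<gamma> \<in> arr G. src G \<gamma> \<in> ?I}"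
  have "openin (gtop G) ?O"
    by (rule open_map_rng[OF openin_continuous_map_preimage[OF continuous_src_G I(1)]])
  moreover have "?O \<subseteq> D" using D I(2) unfolding invariant_def by auto
  ultimately have "?O \<subseteq> ?I" using I(3) by (intro interior_of_maximal) (auto simp: openin_unit_top)
  then show "rng G a \<in> ?I" using a by blast
qed

end

section \<open>Restriction to a closed invariant set\<close>

text \<open>The concrete form of restriction to a closed invariant set, as
  \<open>Cr_restrict_eq_cut\<close> shows.\<close>

definition cut :: "'g set \<Rightarrow> ('s, 'g) op_family \<Rightarrow> ('s, 'g) op_family" where
  "cut F a = (\<lambda>x. if x \<in> F then a x else 0)"

lemma cut_eq_0_iff: "cut F a = 0 \<longleftrightarrow> (\<forall>x\<in>F. a x = 0)"
proof
  assume z: "cut F a = 0"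
  show "\<forall>x\<in>F. a x = 0"
  proof
    fix x assume "x \<in> F"
    then have "a x = cut F a x" by (simp add: cut_def)
    then show "a x = 0" using z by simp
  qed
qed (auto simp: cut_def intro!: ext)

context etale_twist
begin

lemma op_norm_zero: "op_norm \<Sigma> G x 0 = 0"
  using op_norm_le_iff[OF linear_op_zero, of 0 x] by simp

lemma fam_norm_cut: "F \<subseteq> units G \<Longrightarrow> fam_norm \<Sigma> G (cut F a) = (SUP x\<in>F. op_norm \<Sigma> G x (a x))"
  unfolding fam_norm_def
proof (intro antisym SUP_least)
  fix x assume "x \<in> units G"
  show "op_norm \<Sigma> G x (cut F a x) \<le> (SUP x\<in>F. op_norm \<Sigma> G x (a x))"
    by (cases "x \<in> F") (auto simp: cut_def op_norm_zero intro: SUP_upper)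
next
  fix x assume "F \<subseteq> units G" "x \<in> F"
  then show "op_norm \<Sigma> G x (a x) \<le> (SUP x\<in>units G. op_norm \<Sigma> G x (cut F a x))"
    by (intro SUP_upper2[of x]) (auto simp: cut_def)
qed

lemma fam_norm_cut_le: "F \<subseteq> units G \<Longrightarrow> fam_norm \<Sigma> G (cut F a) \<le> fam_norm \<Sigma> G a"
  unfolding fam_norm_cut by (unfold fam_norm_def, rule SUP_subset_mono) auto

lemma cut_diff: "cut F (a - b) = cut F a - cut F b"
  by (rule ext) (simp add: cut_def)

lemma cut_op_families: "a \<in> op_families \<Sigma> G \<Longrightarrow> cut F a \<in> op_families \<Sigma> G"
  unfolding op_families_iff linear_family_def bounded_by_def
  by (auto simp: cut_def linear_op_zero)

text \<open>Norm convergence forces convergence of all matrix coefficients. Uniqueness of limits is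
  what pins down the definite description in \<open>extend_to_Cr\<close>.\<close>

lemma fam_norm_limit_unique:
  assumes b: "b \<in> op_families \<Sigma> G" and b': "b' \<in> op_families \<Sigma> G"
    and c: "\<And>n. c n \<in> op_families \<Sigma> G"
    and lim: "(\<lambda>n::nat. fam_norm \<Sigma> G (c n - b)) \<longlonglongrightarrow> 0" "(\<lambda>n. fam_norm \<Sigma> G (c n - b')) \<longlonglongrightarrow> 0"
  shows "b = b'"
proof (rule op_families_ext[OF b b'], rule ext)
  fix x \<tau> \<rho> assume \<tau>: "\<tau> \<in> src_fibre \<Sigma> x"
  have "cmod (b x (delta \<tau>) \<rho> - b' x (delta \<tau>) \<rho>) \<le> 0 + e" if "e > 0" for e
  proof -
    have e: "ennreal (e / 2) > 0" "e / 2 \<ge> 0" using that by simp_all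
    have "\<forall>\<^sub>F n in sequentially. fam_norm \<Sigma> G (c n - b) < ennreal (e / 2) \<and> fam_norm \<Sigma> G (c n - b') < ennreal (e / 2)"
      using order_tendstoD(2)[OF lim(1) e(1)] order_tendstoD(2)[OF lim(2) e(1)] by (rule eventually_conj)
    then obtain n where n: "fam_norm \<Sigma> G (c n - b) \<le> ennreal (e / 2)" "fam_norm \<Sigma> G (c n - b') \<le> ennreal (e / 2)"
      unfolding eventually_sequentially by (meson less_imp_le order_refl)
    note l = linear_family_diff[OF op_families_linear[OF c[of n]] op_families_linear[OF b]]
      and l' = linear_family_diff[OF op_families_linear[OF c[of n]] op_families_linear[OF b']]
    have 1: "cmod ((c n - b) x (delta \<tau>) \<rho>) \<le> e / 2"
      using fam_norm_le_iff[OF l e(2)] n(1) delta_bound[OF l _ \<tau> e(2)] by blast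
    have 2: "cmod ((c n - b') x (delta \<tau>) \<rho>) \<le> e / 2"
      using fam_norm_le_iff[OF l' e(2)] n(2) delta_bound[OF l' _ \<tau> e(2)] by blast
    have "cmod ((c n - b') x (delta \<tau>) \<rho> - (c n - b) x (delta \<tau>) \<rho>) \<le> e / 2 + e / 2"
      by (rule order_trans[OF norm_triangle_ineq4 add_mono[OF 2 1]])
    then show ?thesis by simp
  qed
  then have "cmod (b x (delta \<tau>) \<rho> - b' x (delta \<tau>) \<rho>) \<le> 0" by (rule field_le_epsilon)
  then show "b x (delta \<tau>) \<rho> = b' x (delta \<tau>) \<rho>" by simp
qed

text \<open>\<open>extend_to_Cr\<close> speaks about all approximating sequences; the existence of
  one is what makes its condition determine a value.\<close>

lemma Cr_approx_seq:
  assumes a: "a \<in> Cr \<Sigma> G"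
  obtains f where "\<And>n::nat. f n \<in> Cc \<Sigma>" "(\<lambda>n. fam_norm \<Sigma> G (reg_rep \<Sigma> G (f n) - a)) \<longlonglongrightarrow> 0"
proof -
  have "\<exists>f. f \<in> Cc \<Sigma> \<and> fam_norm \<Sigma> G (reg_rep \<Sigma> G f - a) \<le> ennreal (1 / real (Suc n))" for n :: nat
  proof -
    have e: "1 / real (Suc n) > 0" by simp
    obtain f where f: "f \<in> Cc \<Sigma>" "bounded_by (1 / real (Suc n)) (a - reg_rep \<Sigma> G f)"
      using Cr_approx[OF a e] by blast
    note la = op_families_linear[OF Cr_op_families[OF a]] and lf = op_families_linear[OF reg_rep_op_families[OF f(1)]]
    \<comment> \<open>\<open>norm_closure\<close> measures the element minus its approximation and
      \<open>extend_to_Cr\<close> the opposite difference; scaling by -1 passes between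
      them.\<close>
    have "fam_scale (-1) (a - reg_rep \<Sigma> G f) = reg_rep \<Sigma> G f - a"
      by (simp add: fam_scale_def fun_eq_iff)
    then have "bounded_by (1 / real (Suc n)) (reg_rep \<Sigma> G f - a)"
      using bounded_by_scale[OF linear_family_diff[OF la lf] f(2), of "-1"] by simp
    then show ?thesis
      using fam_norm_le_iff[OF linear_family_diff[OF lf la], of "1 / real (Suc n)"] f(1) by auto
  qed
  then obtain f where f: "\<And>n. f n \<in> Cc \<Sigma>"
    "\<And>n. fam_norm \<Sigma> G (reg_rep \<Sigma> G (f n) - a) \<le> ennreal (1 / real (Suc n))"
    by metis
  have l0: "(\<lambda>n. ennreal (1 / real (Suc n))) \<longlonglongrightarrow> 0"
    using tendsto_ennrealI[OF LIMSEQ_inverse_real_of_nat] by (simp add: inverse_eq_divide)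
  have "(\<lambda>n. fam_norm \<Sigma> G (reg_rep \<Sigma> G (f n) - a)) \<longlonglongrightarrow> 0"
    by (rule tendsto_sandwich[OF _ _ tendsto_const l0]) (use f(2) in \<open>auto intro!: always_eventually\<close>)
  then show ?thesis using that f(1) by blast
qed

section \<open>The twist restricted to an invariant set, compared with the whole twist\<close>

context
  fixes F assumes F: "invariant G F"
begin

abbreviation "GF \<equiv> restrict_groupoid G F"
abbreviation "\<Sigma>F \<equiv> restrict_twist \<Sigma> G F"

lemma F_units: "F \<subseteq> units G"
  using F by (simp add: invariant_def)

lemma restrict_groupoid_simps [simp]:
  "rng GF = rng G" "src GF = src G" "gmul GF = gmul G" "ginv GF = ginv G"
  by (simp_all add: restrict_groupoid_def)

lemma restrict_twist_simps [simp]: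
  "rng \<Sigma>F = rng \<Sigma>" "src \<Sigma>F = src \<Sigma>" "gmul \<Sigma>F = gmul \<Sigma>" "ginv \<Sigma>F = ginv \<Sigma>"
  "incl \<Sigma>F = incl \<Sigma>" "proj \<Sigma>F = proj \<Sigma>"
  by (simp_all add: restrict_twist_def)

lemma arr_restrict_groupoid: "arr GF = {\<gamma> \<in> arr G. src G \<gamma> \<in> F}"
proof -
  have "\<gamma> \<in> arr G \<and> rng G \<gamma> \<in> F \<and> src G \<gamma> \<in> F \<longleftrightarrow> \<gamma> \<in> arr G \<and> src G \<gamma> \<in> F" for \<gamma>
    using base.invariant_src_iff[OF F, of \<gamma>] by blast
  moreover have top: "gtop GF = subtopology (gtop G) {a \<in> arr G. rng G a \<in> F \<and> src G a \<in> F}"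
    unfolding restrict_groupoid_def by simp
  ultimately show ?thesis unfolding top topspace_subtopology by blast
qed

lemma arr_restrict_twist: "arr \<Sigma>F = {\<sigma> \<in> arr \<Sigma>. src G (proj \<Sigma> \<sigma>) \<in> F}"
proof -
  have "arr \<Sigma>F = {\<sigma> \<in> arr \<Sigma>. proj \<Sigma> \<sigma> \<in> arr GF}"
  proof -
    have top: "gtop \<Sigma>F = subtopology (gtop \<Sigma>) {\<sigma> \<in> arr \<Sigma>. proj \<Sigma> \<sigma> \<in> arr GF}"
      unfolding restrict_twist_def by simp
    show ?thesis unfolding top topspace_subtopology by blast
  qed
  then show ?thesis unfolding arr_restrict_groupoid using proj_arr by blast
qed

lemma units_restrict_groupoid: "units GF = F"
proof (intro subset_antisym subsetI)
  fix u assume "u \<in> F"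
  then have "u \<in> arr GF" "rng G u = u" using F_units by (auto simp: arr_restrict_groupoid)
  then show "u \<in> units GF" unfolding units_def by force
next
  fix u assume "u \<in> units GF"
  then obtain a where "a \<in> arr G" "src G a \<in> F" "u = rng G a"
    unfolding units_def arr_restrict_groupoid by auto
  then show "u \<in> F" using F unfolding invariant_def by blast
qed

lemma circle_act_restrict: "circle_act \<Sigma>F = circle_act \<Sigma>"
  by (intro ext) (simp add: circle_act_def)

text \<open>Over an arrow of the restriction the two predicates under \<open>SOME\<close> coincide,
  so the same lift is chosen. This makes the fibre Hilbert spaces of the restriction equal to the
  original ones, rather than merely isomorphic.\<close>

lemma lift_restrict:
  assumes "\<gamma> \<in> arr GF"
  shows "lift \<Sigma>F \<gamma> = lift \<Sigma> \<gamma>"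
proof -
  have "(\<lambda>\<sigma>. \<sigma> \<in> arr \<Sigma>F \<and> proj \<Sigma> \<sigma> = \<gamma>) = (\<lambda>\<sigma>. \<sigma> \<in> arr \<Sigma> \<and> proj \<Sigma> \<sigma> = \<gamma>)"
    using assms by (auto simp: arr_restrict_twist arr_restrict_groupoid fun_eq_iff)
  then show ?thesis unfolding lift_def by simp
qed

lemma src_fibre_restrict: "x \<in> F \<Longrightarrow> src_fibre \<Sigma>F x = src_fibre \<Sigma> x"
  unfolding src_fibre_def by (auto simp: arr_restrict_twist src_proj)

lemma gfibre_restrict: "x \<in> F \<Longrightarrow> {\<gamma> \<in> arr GF. src GF \<gamma> = x} = gfibre x"
  by (auto simp: arr_restrict_groupoid)

lemma Hx_restrict: "x \<in> F \<Longrightarrow> Hx \<Sigma>F GF x = Hx \<Sigma> G x"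
proof -
  assume x: "x \<in> F"
  have "(\<lambda>\<gamma>. (cmod (\<xi> (lift \<Sigma>F \<gamma>)))\<^sup>2) summable_on gfibre x \<longleftrightarrow>
      (\<lambda>\<gamma>. (cmod (\<xi> (lift \<Sigma> \<gamma>)))\<^sup>2) summable_on gfibre x" for \<xi> :: "'s \<Rightarrow> complex"
    by (rule summable_on_cong) (use x lift_restrict in \<open>simp add: arr_restrict_groupoid\<close>)
  then show ?thesis
    unfolding Hx_def src_fibre_restrict[OF x] gfibre_restrict[OF x] circle_act_restrict by simp
qed

lemma Hx_norm_restrict: "x \<in> F \<Longrightarrow> Hx_norm \<Sigma>F GF x = Hx_norm \<Sigma> G x"
proof
  fix \<xi> assume x: "x \<in> F"
  have "(\<Sum>\<^sub>\<infinity>\<gamma>\<in>gfibre x. (cmod (\<xi> (lift \<Sigma>F \<gamma>)))\<^sup>2) = (\<Sum>\<^sub>\<infinity>\<gamma>\<in>gfibre x. (cmod (\<xi> (lift \<Sigma> \<gamma>)))\<^sup>2)"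
    by (rule infsum_cong) (use x lift_restrict in \<open>simp add: arr_restrict_groupoid\<close>)
  then show "Hx_norm \<Sigma>F GF x \<xi> = Hx_norm \<Sigma> G x \<xi>"
    unfolding Hx_norm_def gfibre_restrict[OF x] by simp
qed

lemma op_norm_restrict: "x \<in> F \<Longrightarrow> op_norm \<Sigma>F GF x = op_norm \<Sigma> G x"
  by (intro ext) (simp add: op_norm_def Hx_restrict Hx_norm_restrict)

lemma bounded_ops_restrict: "x \<in> F \<Longrightarrow> bounded_ops \<Sigma>F GF x = bounded_ops \<Sigma> G x"
  by (simp add: bounded_ops_def Hx_restrict op_norm_restrict)

lemma fam_norm_restrict: "fam_norm \<Sigma>F GF a = fam_norm \<Sigma> G (cut F a)"
  unfolding fam_norm_cut[OF F_units] unfolding fam_norm_def units_restrict_groupoid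
  by (simp add: op_norm_restrict)

lemma op_families_restrict: "a \<in> op_families \<Sigma>F GF \<longleftrightarrow> a \<in> op_families \<Sigma> G \<and> cut F a = a"
proof
  assume a: "a \<in> op_families \<Sigma>F GF"
  then have out: "\<And>x. x \<notin> F \<Longrightarrow> a x = 0" and ops: "\<And>x. x \<in> F \<Longrightarrow> a x \<in> bounded_ops \<Sigma> G x"
    unfolding op_families_def units_restrict_groupoid by (auto simp: bounded_ops_restrict)
  have c: "cut F a = a" by (rule ext) (simp add: cut_def out)
  have "0 \<in> bounded_ops \<Sigma> G x" for x
    using linear_op_zero unfolding linear_op_def bounded_ops_def by (simp add: op_norm_zero)
  then have "a x \<in> bounded_ops \<Sigma> G x" for x using ops out by (cases "x \<in> F") auto
  then show "a \<in> op_families \<Sigma> G \<and> cut F a = a"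
    using a c out F_units unfolding op_families_def fam_norm_restrict by auto
next
  assume a: "a \<in> op_families \<Sigma> G \<and> cut F a = a"
  have "a x = 0" if "x \<notin> F" for x
  proof -
    have "cut F a x = 0" using that by (simp add: cut_def)
    then show ?thesis using a by simp
  qed
  then show "a \<in> op_families \<Sigma>F GF"
    using a F_units unfolding op_families_def fam_norm_restrict units_restrict_groupoid
    by (auto simp: bounded_ops_restrict)
qed

text \<open>When \<sigma> starts in F, invariance puts every arrow ending at r(\<sigma>) into the
  restricted groupoid, so both convolution sums run over the same arrows.\<close>

lemma reg_rep_restrict: "reg_rep \<Sigma>F GF (zero_outside (arr \<Sigma>F) f) = cut F (reg_rep \<Sigma> G f)"
proof (intro ext)
  fix x \<xi> \<sigma>
  show "reg_rep \<Sigma>F GF (zero_outside (arr \<Sigma>F) f) x \<xi> \<sigma> = cut F (reg_rep \<Sigma> G f) x \<xi> \<sigma>"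
  proof (cases "x \<in> F \<and> \<sigma> \<in> src_fibre \<Sigma> x")
    case True
    then have x: "x \<in> F" and \<sigma>: "\<sigma> \<in> arr \<Sigma>" "src G (proj \<Sigma> \<sigma>) = x" by (auto simp: src_fibre_iff)
    let ?y = "proj \<Sigma> (rng \<Sigma> \<sigma>)"
    have y: "?y \<in> F" using base.invariant_src_iff[OF F, of "proj \<Sigma> \<sigma>"] \<sigma> x by (simp add: rng_proj)
    have g: "\<gamma> \<in> arr GF" if "\<gamma> \<in> arr G" "rng G \<gamma> = ?y" for \<gamma>
      using base.invariant_src_iff[OF F, of \<gamma>] that y by (simp add: arr_restrict_groupoid)
    have "conv \<Sigma>F GF (zero_outside (arr \<Sigma>F) f) \<xi> \<sigma> = conv \<Sigma> G f \<xi> \<sigma>"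
      unfolding conv_def
    proof (rule infsum_cong_neutral)
      fix \<gamma> assume "\<gamma> \<in> {\<gamma> \<in> arr GF. rng GF \<gamma> = proj \<Sigma>F (rng \<Sigma>F \<sigma>)} \<inter> {\<gamma> \<in> arr G. rng G \<gamma> = ?y}"
      then have \<gamma>: "\<gamma> \<in> arr G" "\<gamma> \<in> arr GF" by auto
      then have "lift \<Sigma> \<gamma> \<in> arr \<Sigma>F" by (simp add: arr_restrict_twist arr_restrict_groupoid)
      then show "zero_outside (arr \<Sigma>F) f (lift \<Sigma>F \<gamma>) * \<xi> (gmul \<Sigma>F (ginv \<Sigma>F (lift \<Sigma>F \<gamma>)) \<sigma>) =
          f (lift \<Sigma> \<gamma>) * \<xi> (gmul \<Sigma> (ginv \<Sigma> (lift \<Sigma> \<gamma>)) \<sigma>)"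
        using lift_restrict[OF \<gamma>(2)] by (simp add: zero_outside_def)
    qed (use g in \<open>auto simp: arr_restrict_groupoid\<close>)
    then show ?thesis using True F_units
      by (auto simp: reg_rep_def cut_def units_restrict_groupoid Hx_restrict src_fibre_restrict)
  next
    case False
    then show ?thesis
      by (auto simp: reg_rep_def cut_def units_restrict_groupoid src_fibre_restrict)
  qed
qed

text \<open>Closedness of F makes the restricted twist closed in the whole one, so it meets the
  compact support in a compact set.\<close>

lemma zero_outside_Cc_restrict:
  assumes f: "f \<in> Cc \<Sigma>" and cl: "closedin (gtop G) F"
  shows "zero_outside (arr \<Sigma>F) f \<in> Cc \<Sigma>F"
proof -
  let ?f = "zero_outside (arr \<Sigma>F) f"
  define S where "S = {\<sigma> \<in> arr \<Sigma>. src G (proj \<Sigma> \<sigma>) \<in> F}"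
  have arrS: "arr \<Sigma>F = S" unfolding S_def arr_restrict_twist ..
  have "S = {\<sigma> \<in> arr \<Sigma>. proj \<Sigma> \<sigma> \<in> arr GF}" unfolding S_def arr_restrict_groupoid using proj_arr by blast
  then have top: "gtop \<Sigma>F = subtopology (gtop \<Sigma>) S"
    unfolding restrict_twist_def by simp
  have "closedin (gtop \<Sigma>) {\<sigma> \<in> arr \<Sigma>. (src G \<circ> proj \<Sigma>) \<sigma> \<in> F}"
    by (rule closedin_continuous_map_preimage[OF continuous_map_compose[OF continuous_proj continuous_src_G] cl])
  then have clF: "closedin (gtop \<Sigma>) S" unfolding S_def by simp
  obtain K where K: "compactin (gtop \<Sigma>) K" "\<And>\<sigma>. f \<sigma> \<noteq> 0 \<Longrightarrow> \<sigma> \<in> K" using Cc_support[OF f] by blast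
  have "compactin (gtop \<Sigma>) (K \<inter> S)" by (rule compact_Int_closedin[OF K(1) clF])
  then have c: "compactin (gtop \<Sigma>F) (K \<inter> S)" unfolding top compactin_subtopology by blast
  have "Hausdorff_space (gtop \<Sigma>F)" unfolding top by (rule Hausdorff_space_subtopology[OF Hausdorff_\<Sigma>])
  then have "closedin (gtop \<Sigma>F) (K \<inter> S)" using compactin_imp_closedin c by blast
  then have "gtop \<Sigma>F closure_of {\<sigma> \<in> S. ?f \<sigma> \<noteq> 0} \<subseteq> K \<inter> S"
    using K(2) by (intro closure_of_minimal) (auto simp: zero_outside_def arrS)
  then have "compactin (gtop \<Sigma>F) (gtop \<Sigma>F closure_of {\<sigma> \<in> S. ?f \<sigma> \<noteq> 0})"
    by (rule closed_compactin[OF c]) simp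
  moreover have "continuous_map (gtop \<Sigma>F) euclidean ?f"
  proof (rule continuous_map_eq)
    show "continuous_map (gtop \<Sigma>F) euclidean f"
      unfolding top by (rule continuous_map_from_subtopology[OF Cc_continuous[OF f]])
  qed (simp add: zero_outside_def arrS)
  ultimately have "compactly_supported (gtop \<Sigma>F) ?f"
    unfolding compactly_supported_def arrS by (simp add: zero_outside_def arrS)
  moreover have "?f (circle_act \<Sigma>F z \<sigma>) = z * ?f \<sigma>" if "\<sigma> \<in> arr \<Sigma>F" "z \<in> sphere 0 1" for z \<sigma>
    using that equivariantD[OF Cc_equivariant[OF f], of \<sigma> z]
    by (auto simp: circle_act_restrict zero_outside_def arr_restrict_twist)
  ultimately show ?thesis unfolding Cc_def by blast
qed

text \<open>\<open>cut F\<close> does not increase norms and agrees with restriction of functions on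
  \<open>Cc\<close>, so it meets the condition defining the extension. Uniqueness comes from testing
  that condition on one approximating sequence.\<close>

lemma Cr_restrict_eq_cut:
  assumes a: "a \<in> Cr \<Sigma> G" and cl: "closedin (gtop G) F"
  shows "Cr_restrict \<Sigma> G F a = cut F a"
  unfolding Cr_restrict_def extend_to_Cr_def
proof (rule the_equality)
  let ?zo = "zero_outside (arr \<Sigma>F)"
  note aF = cut_op_families[OF Cr_op_families[OF a], of F]
  have cc: "cut F (cut F b) = cut F b" for b :: "('s, 'g) op_family" by (rule ext) (simp add: cut_def)
  have le: "fam_norm \<Sigma>F GF (reg_rep \<Sigma>F GF (?zo f) - cut F b) \<le> fam_norm \<Sigma> G (reg_rep \<Sigma> G f - b)" for f b
    unfolding fam_norm_restrict reg_rep_restrict cut_diff cc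
    using fam_norm_cut_le[OF F_units, of "reg_rep \<Sigma> G f - b"] by (simp add: cut_diff)
  have le': "fam_norm \<Sigma>F GF (cut F b - reg_rep \<Sigma>F GF (?zo f)) \<le> fam_norm \<Sigma> G (b - reg_rep \<Sigma> G f)" for f b
    unfolding fam_norm_restrict reg_rep_restrict cut_diff cc
    using fam_norm_cut_le[OF F_units, of "b - reg_rep \<Sigma> G f"] by (simp add: cut_diff)
  show "cut F a \<in> Cr \<Sigma>F GF \<and> (\<forall>f. (\<forall>n::nat. f n \<in> Cc \<Sigma>) \<and> (\<lambda>n. fam_norm \<Sigma> G (reg_rep \<Sigma> G (f n) - a)) \<longlonglongrightarrow> 0 \<longrightarrow>
      (\<lambda>n. fam_norm \<Sigma>F GF (reg_rep \<Sigma>F GF (?zo (f n)) - cut F a)) \<longlonglongrightarrow> 0)"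
  proof (intro conjI allI impI)
    show "cut F a \<in> Cr \<Sigma>F GF"
      unfolding Cr_def norm_closure_def
    proof (intro CollectI conjI allI impI)
      show "cut F a \<in> op_families \<Sigma>F GF" unfolding op_families_restrict using aF cc by blast
      fix e :: ennreal assume "e > 0"
      then obtain f where f: "f \<in> Cc \<Sigma>" "fam_norm \<Sigma> G (a - reg_rep \<Sigma> G f) < e"
        using a unfolding Cr_def norm_closure_def by blast
      then show "\<exists>b\<in>reg_rep \<Sigma>F GF ` Cc \<Sigma>F. fam_norm \<Sigma>F GF (cut F a - b) < e"
        using le'[of a f] zero_outside_Cc_restrict[OF f(1) cl] order_le_less_trans by blast
    qed
    fix f assume f: "(\<forall>n::nat. f n \<in> Cc \<Sigma>) \<and> (\<lambda>n. fam_norm \<Sigma> G (reg_rep \<Sigma> G (f n) - a)) \<longlonglongrightarrow> 0"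
    show "(\<lambda>n. fam_norm \<Sigma>F GF (reg_rep \<Sigma>F GF (?zo (f n)) - cut F a)) \<longlonglongrightarrow> 0"
      by (rule tendsto_sandwich[OF _ _ tendsto_const conjunct2[OF f]])
        (use le[of _ a] in \<open>auto intro!: always_eventually\<close>)
  qed
  then have lim: "(\<lambda>n. fam_norm \<Sigma>F GF (reg_rep \<Sigma>F GF (?zo (f n)) - cut F a)) \<longlonglongrightarrow> 0"
    if "\<And>n::nat. f n \<in> Cc \<Sigma>" "(\<lambda>n. fam_norm \<Sigma> G (reg_rep \<Sigma> G (f n) - a)) \<longlonglongrightarrow> 0" for f
    using that by blast
  fix b assume b: "b \<in> Cr \<Sigma>F GF \<and> (\<forall>f. (\<forall>n::nat. f n \<in> Cc \<Sigma>) \<and> (\<lambda>n. fam_norm \<Sigma> G (reg_rep \<Sigma> G (f n) - a)) \<longlonglongrightarrow> 0 \<longrightarrow>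
      (\<lambda>n. fam_norm \<Sigma>F GF (reg_rep \<Sigma>F GF (?zo (f n)) - b)) \<longlonglongrightarrow> 0)"
  obtain f where f: "\<And>n::nat. f n \<in> Cc \<Sigma>" "(\<lambda>n. fam_norm \<Sigma> G (reg_rep \<Sigma> G (f n) - a)) \<longlonglongrightarrow> 0"
    using Cr_approx_seq[OF a] by blast
  have "b \<in> op_families \<Sigma>F GF" using b unfolding Cr_def norm_closure_def by blast
  then have bo: "b \<in> op_families \<Sigma> G" "cut F b = b" unfolding op_families_restrict by auto
  have fo: "cut F (reg_rep \<Sigma> G (f n)) \<in> op_families \<Sigma> G" for n
    by (rule cut_op_families[OF reg_rep_op_families[OF f(1)]])
  have "(\<lambda>n. fam_norm \<Sigma>F GF (reg_rep \<Sigma>F GF (?zo (f n)) - b)) \<longlonglongrightarrow> 0" using b f by blast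
  then have "(\<lambda>n. fam_norm \<Sigma> G (cut F (reg_rep \<Sigma> G (f n)) - b)) \<longlonglongrightarrow> 0"
    unfolding fam_norm_restrict reg_rep_restrict cut_diff cc bo(2) .
  moreover have "(\<lambda>n. fam_norm \<Sigma> G (cut F (reg_rep \<Sigma> G (f n)) - cut F a)) \<longlonglongrightarrow> 0"
    using lim[OF f] unfolding fam_norm_restrict reg_rep_restrict cut_diff cc .
  ultimately show "b = cut F a" by (rule fam_norm_limit_unique[OF bo(1) aF fo])
qed

end

text \<open>Exactness identifies the subalgebra with the kernel of restriction to the complement of
  U, and \<open>cut\<close> kills an element there exactly when its operators off U vanish.\<close>

lemma Cr_sub_eq_supported_ideal:
  assumes ex: "exact_groupoid \<Sigma> G" and U: "open_invariant G U"
  shows "Cr_sub \<Sigma> G U = supported_ideal U"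
proof -
  let ?F = "units G - U"
  have U': "openin (gtop G) U" "invariant G U" using U unfolding open_invariant_def openin_unit_top by auto
  have F: "invariant G ?F" by (rule base.invariant_Compl[OF U'(2)])
  have cl: "closedin (gtop G) ?F" by (rule closedin_diff[OF closedin_units U'(1)])
  have "Cr_restrict \<Sigma> G ?F a = 0 \<longleftrightarrow> (\<forall>x. a x \<noteq> 0 \<longrightarrow> x \<in> U)" if a: "a \<in> Cr \<Sigma> G" for a
    unfolding Cr_restrict_eq_cut[OF F a cl]
    using op_families_outside[OF Cr_op_families[OF a]] cut_eq_0_iff[of ?F a] by blast
  then have "{a \<in> Cr \<Sigma> G. Cr_restrict \<Sigma> G ?F a = 0} = supported_ideal U"
    unfolding supported_ideal_def by blast
  then show ?thesis using ex U unfolding exact_groupoid_def by simp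
qed

end

section \<open>Regular ideals\<close>

text \<open>The shifted interval is split at p, and the piece beyond p is moved back by one
  period.\<close>

lemma integral_periodic_shift:
  fixes P :: "real \<Rightarrow> 'a::euclidean_space"
  assumes c: "continuous_on UNIV P" and per: "\<And>t. P (t + p) = P t" and s: "0 \<le> s" "s \<le> p"
  shows "integral {0..p} (\<lambda>t. P (t + s)) = integral {0..p} P"
proof -
  have co: "continuous_on A P" for A using c continuous_on_subset by blast
  then have int: "P integrable_on {a..b}" for a b by (rule integrable_continuous_real)
  have "integral {0..p} (\<lambda>t. P (t + s)) = integral {0 + s..p + s} P"
    using integral_shift[of 0 s p P] co by (simp add: o_def)
  also have "\<dots> = integral {s..p} P + integral {0 + p..s + p} P"
    using Henstock_Kurzweil_Integration.integral_combine[of s p "p + s" P] int s by (simp add: add.commute)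
  also have "integral {0 + p..s + p} P = integral {0..s} (\<lambda>t. P (t + p))"
    using integral_shift[of 0 p s P] co by (simp add: o_def)
  also have "\<dots> = integral {0..s} P" by (simp add: per)
  also have "integral {s..p} P + integral {0..s} P = integral {0..p} P"
    using Henstock_Kurzweil_Integration.integral_combine[of 0 s p P] int s by (simp add: add.commute)
  finally show ?thesis .
qed

lemma unit_complex_cis:
  assumes "cmod z = 1"
  obtains s where "0 \<le> s" "s < 2 * pi" "z = cis s"
proof -
  have "(Re z)\<^sup>2 + (Im z)\<^sup>2 = 1" using assms by (simp add: cmod_def)
  then obtain s where "0 \<le> s" "s < 2 * pi" "Re z = cos s" "Im z = sin s" using sincos_total_2pi by blast
  then show ?thesis using that by (simp add: complex_eq_iff)
qed

section \<open>Equivariant functions of compact support over a given open set\<close>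

context etale_twist
begin

lemma continuous_circle_act:
  "continuous_map (prod_topology (top_of_set (sphere 0 1)) (gtop \<Sigma>)) (gtop \<Sigma>) (\<lambda>p. circle_act \<Sigma> (fst p) (snd p))"
proof -
  let ?X = "prod_topology (top_of_set (sphere (0::complex) 1)) (gtop \<Sigma>)"
  have s: "continuous_map ?X (gtop \<Sigma>) snd" and f: "continuous_map ?X (top_of_set (sphere 0 1)) fst"
    by (auto intro: continuous_map_snd continuous_map_fst)
  have "continuous_map ?X (gtop G) (\<lambda>p. proj \<Sigma> (rng \<Sigma> (snd p)))"
    using continuous_map_compose[OF continuous_map_compose[OF s continuous_rng_\<Sigma>] continuous_proj]
    by (simp add: o_def)
  then have "continuous_map ?X (unit_top G) (\<lambda>p. proj \<Sigma> (rng \<Sigma> (snd p)))"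
    unfolding unit_top_def by (rule continuous_map_into_subtopology) auto
  then have "continuous_map ?X (prod_topology (unit_top G) (top_of_set (sphere 0 1)))
      (\<lambda>p. (proj \<Sigma> (rng \<Sigma> (snd p)), fst p))"
    using f by (simp add: continuous_map_pairwise o_def)
  from continuous_map_compose[OF this homeomorphic_imp_continuous_map[OF incl_homeo]]
  have "continuous_map ?X (gtop \<Sigma>) (\<lambda>p. incl \<Sigma> (proj \<Sigma> (rng \<Sigma> (snd p)), fst p))"
    by (simp add: o_def continuous_map_in_subtopology)
  then have "continuous_map ?X (prod_topology (gtop \<Sigma>) (gtop \<Sigma>))
      (\<lambda>p. (incl \<Sigma> (proj \<Sigma> (rng \<Sigma> (snd p)), fst p), snd p))"
    using s by (simp add: continuous_map_pairwise o_def)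
  then have "continuous_map ?X (subtopology (prod_topology (gtop \<Sigma>) (gtop \<Sigma>)) {(a, b). src \<Sigma> a = rng \<Sigma> b})
      (\<lambda>p. (incl \<Sigma> (proj \<Sigma> (rng \<Sigma> (snd p)), fst p), snd p))"
    by (rule continuous_map_into_subtopology) auto
  from continuous_map_compose[OF this continuous_gmul_\<Sigma>] show ?thesis
    by (simp add: o_def circle_act_def)
qed

text \<open>Averaging a bump function over the circle action makes it equivariant. On the circle orbit of \<open>\<tau>\<close>
  the bump function vanishes at \<open>z \<cdot> \<tau>\<close> unless \<open>Re z > 0\<close>, so that the average does not vanish at \<open>\<tau>\<close>.\<close>

lemma ex_Cc_over_open:
  assumes B: "openin (gtop G) B" and \<tau>: "\<tau> \<in> arr \<Sigma>" "proj \<Sigma> \<tau> \<in> B"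
  obtains f where "f \<in> Cc \<Sigma>" "f \<tau> \<noteq> 0" "\<And>\<sigma>. f \<sigma> \<noteq> 0 \<Longrightarrow> proj \<Sigma> \<sigma> \<in> B"
proof -
  let ?A = "\<lambda>p. circle_act \<Sigma> (fst p) (snd p)"
  let ?X = "prod_topology (top_of_set (sphere (0::complex) 1)) (gtop \<Sigma>)"
  let ?S = "{z::complex. cmod z = 1 \<and> Re z \<le> 0}"
  have "closed ?S"
  proof -
    have "?S = sphere 0 1 \<inter> {z. Re z \<le> 0}" by auto
    then show ?thesis by (simp add: closed_Int closed_halfspace_Re_le)
  qed
  moreover have "bounded ?S" by (rule bounded_subset[OF bounded_sphere[of 0 1]]) auto
  ultimately have "compactin (top_of_set (sphere 0 1)) ?S"
    by (auto simp: compactin_subtopology compact_eq_bounded_closed)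
  then have "compactin ?X (?S \<times> {\<tau>})" using \<tau> by (simp add: compactin_Times)
  then have "compactin (gtop \<Sigma>) (?A ` (?S \<times> {\<tau>}))"
    by (rule image_compactin[OF _ continuous_circle_act])
  then have cl: "closedin (gtop \<Sigma>) (?A ` (?S \<times> {\<tau>}))" by (rule compactin_imp_closedin[OF Hausdorff_\<Sigma>])
  define W where "W = {\<sigma> \<in> arr \<Sigma>. proj \<Sigma> \<sigma> \<in> B} - ?A ` (?S \<times> {\<tau>})"
  have W: "openin (gtop \<Sigma>) W"
    unfolding W_def by (rule openin_diff[OF openin_continuous_map_preimage[OF continuous_proj B] cl])
  have "\<tau> \<in> W"
  proof -
    have "circle_act \<Sigma> z \<tau> \<noteq> \<tau>" if "z \<in> ?S" for z
      using act_inj[OF \<tau>(1), of z 1] that \<tau>(1) by auto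
    then show ?thesis using \<tau> unfolding W_def by force
  qed
  then obtain g :: "'s \<Rightarrow> real" and K where g: "continuous_map (gtop \<Sigma>) euclideanreal g" "g \<tau> = 1"
    "\<And>y. y \<in> topspace (gtop \<Sigma>) \<Longrightarrow> 0 \<le> g y"
    "\<And>y. \<lbrakk>y \<in> topspace (gtop \<Sigma>); g y \<noteq> 0\<rbrakk> \<Longrightarrow> y \<in> W \<inter> K" "compactin (gtop \<Sigma>) K"
    by (rule locally_compact_bump[OF locally_compact_\<Sigma> Hausdorff_\<Sigma> W]) (rule that; assumption)
  \<comment> \<open>Integrating over a period gives the Fourier coefficient of index one along the
    circle orbit: replacing \<sigma> by e^(is)\<sigma> shifts t by s, and the factor
    \<open>cis (- fst p)\<close> turns the shift into a factor e^(is).\<close>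
  define H where "H p = complex_of_real (g (circle_act \<Sigma> (cis (fst p)) (snd p))) * cis (- fst p)" for p
  let ?R = "prod_topology euclideanreal (gtop \<Sigma>)"
  have f1: "continuous_map ?R euclideanreal fst" and s1: "continuous_map ?R (gtop \<Sigma>) snd"
    by (auto intro: continuous_map_fst continuous_map_snd)
  have "continuous_map ?R (top_of_set (sphere 0 1)) (cis \<circ> fst)"
    by (rule continuous_map_compose[OF f1]) (auto simp: continuous_map_in_subtopology continuous_on_cis)
  then have "continuous_map ?R ?X (\<lambda>p. (cis (fst p), snd p))"
    using s1 by (simp add: continuous_map_pairwise o_def)
  from continuous_map_compose[OF continuous_map_compose[OF this continuous_circle_act] g(1)]
  have "continuous_map ?R euclideanreal (\<lambda>p. g (circle_act \<Sigma> (cis (fst p)) (snd p)))" by (simp add: o_def)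
  from continuous_map_compose[OF this, of euclidean complex_of_real]
  have h1: "continuous_map ?R euclidean (\<lambda>p. complex_of_real (g (circle_act \<Sigma> (cis (fst p)) (snd p))))"
    by (simp add: o_def continuous_on_of_real)
  from continuous_map_compose[OF f1, of euclidean "\<lambda>t. cis (- t)"]
  have "continuous_map ?R euclidean (\<lambda>p. cis (- fst p))"
    by (simp add: o_def continuous_on_cis continuous_on_minus)
  with h1 have H: "continuous_map ?R euclidean H" unfolding H_def by (rule continuous_map_normed_mult)
  have cont: "continuous_on UNIV (\<lambda>t. H (t, \<sigma>))" if "\<sigma> \<in> arr \<Sigma>" for \<sigma>
  proof -
    have "continuous_map euclideanreal ?R (\<lambda>t. (t, \<sigma>))" using that by (simp add: continuous_map_pairwise o_def)
    from continuous_map_compose[OF this H] show ?thesis by (simp add: o_def)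
  qed
  define f where "f \<sigma> = (if \<sigma> \<in> arr \<Sigma> then integral {0..2 * pi} (\<lambda>t. H (t, \<sigma>)) else 0)" for \<sigma>
  have int: "(\<lambda>t. H (t, \<sigma>)) integrable_on {0..2 * pi}" if "\<sigma> \<in> arr \<Sigma>" for \<sigma>
    using cont[OF that] by (intro integrable_continuous_real) (rule continuous_on_subset, auto)
  have eq: "equivariant f"
    unfolding equivariant_def
  proof (intro ballI allI impI)
    fix \<sigma> z assume \<sigma>: "\<sigma> \<in> arr \<Sigma>" and "cmod z = 1"
    then obtain s where s: "0 \<le> s" "s < 2 * pi" "z = cis s" using unit_complex_cis by blast
    have sh: "H (t, circle_act \<Sigma> z \<sigma>) = z * H (t + s, \<sigma>)" for t
    proof -
      have "circle_act \<Sigma> (cis t) (circle_act \<Sigma> z \<sigma>) = circle_act \<Sigma> (cis (t + s)) \<sigma>"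
        using s(3) \<sigma> act_act[of \<sigma> "cis t" "cis s"] by (simp add: cis_mult)
      moreover have "cis (- t) = z * cis (- (t + s))" using s(3) by (simp add: cis_mult)
      ultimately show ?thesis by (simp only: H_def fst_conv snd_conv mult.left_commute)
    qed
    have c1: "cis (t + 2 * pi) = cis t" for t using cis_mult[of t "2 * pi"] by simp
    have c2: "cis (- (t + 2 * pi)) = cis (- t)" for t using c1[of t] by (metis cis_cnj)
    have per: "H (t + 2 * pi, \<sigma>) = H (t, \<sigma>)" for t by (simp only: H_def fst_conv snd_conv c1 c2)
    have "integral {0..2 * pi} (\<lambda>t. H (t + s, \<sigma>)) = integral {0..2 * pi} (\<lambda>t. H (t, \<sigma>))"
      by (rule integral_periodic_shift[OF cont[OF \<sigma>] per]) (use s in auto)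
    then show "f (circle_act \<Sigma> z \<sigma>) = z * f \<sigma>"
      using \<sigma> \<open>cmod z = 1\<close> by (simp add: f_def sh)
  qed
  have cf: "continuous_map (gtop \<Sigma>) euclidean f"
    unfolding continuous_map_eps_iff
  proof (intro ballI allI impI)
    fix \<sigma>\<^sub>0 and e :: real assume \<sigma>\<^sub>0: "\<sigma>\<^sub>0 \<in> arr \<Sigma>" and e: "e > 0"
    \<comment> \<open>The interval of integration has length 2 pi; the extra 1 makes the final
      inequality strict.\<close>
    define e' where "e' = e / (2 * pi + 1)"
    have e': "e' > 0" using e pi_gt_zero unfolding e'_def by (simp add: add_pos_pos)
    have "continuous_map ?R ?R (\<lambda>p. (fst p, \<sigma>\<^sub>0))"
      using \<sigma>\<^sub>0 f1 by (simp add: continuous_map_pairwise o_def)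
    from continuous_map_diff[OF H continuous_map_compose[OF this H]]
    have "continuous_map ?R euclidean (\<lambda>p. H p - H (fst p, \<sigma>\<^sub>0))" by (simp add: o_def)
    from openin_continuous_map_preimage[OF this, of "ball 0 e'"]
    have op: "openin ?R {p \<in> topspace ?R. H p - H (fst p, \<sigma>\<^sub>0) \<in> ball 0 e'}" by simp
    have cc: "compactin euclideanreal {0..2 * pi}" "compactin (gtop \<Sigma>) {\<sigma>\<^sub>0}" using \<sigma>\<^sub>0 by auto
    have sub: "{0..2 * pi} \<times> {\<sigma>\<^sub>0} \<subseteq> {p \<in> topspace ?R. H p - H (fst p, \<sigma>\<^sub>0) \<in> ball 0 e'}"
      using \<sigma>\<^sub>0 e' by auto
    \<comment> \<open>The tube lemma makes the estimate uniform over the compact interval of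
      angles.\<close>
    obtain T V where "openin euclideanreal T" and TV: "openin (gtop \<Sigma>) V" "{0..2 * pi} \<subseteq> T" "{\<sigma>\<^sub>0} \<subseteq> V"
      "T \<times> V \<subseteq> {p \<in> topspace ?R. H p - H (fst p, \<sigma>\<^sub>0) \<in> ball 0 e'}"
      by (rule Wallace_theorem_prod_topology[OF cc op sub]) (rule that; assumption)
    have "dist (f \<sigma>) (f \<sigma>\<^sub>0) < e" if \<sigma>V: "\<sigma> \<in> V" for \<sigma>
    proof -
      have \<sigma>: "\<sigma> \<in> arr \<Sigma>" using \<sigma>V openin_subset[OF TV(1)] by blast
      have near: "cmod (H (t, \<sigma>) - H (t, \<sigma>\<^sub>0)) \<le> e'" if "t \<in> {0..2 * pi}" for t
      proof -
        have "(t, \<sigma>) \<in> T \<times> V" using TV(2) that \<sigma>V by auto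
        then have "H (t, \<sigma>) - H (t, \<sigma>\<^sub>0) \<in> ball 0 e'" using TV(4) by fastforce
        then show ?thesis by simp
      qed
      have "dist (f \<sigma>) (f \<sigma>\<^sub>0) = cmod (integral {0..2 * pi} (\<lambda>t. H (t, \<sigma>) - H (t, \<sigma>\<^sub>0)))"
        using \<sigma> \<sigma>\<^sub>0 Henstock_Kurzweil_Integration.integral_diff[OF int[OF \<sigma>] int[OF \<sigma>\<^sub>0]]
        by (simp add: f_def dist_norm)
      also have "\<dots> \<le> e' * (2 * pi - 0)"
      proof (rule integral_bound)
        show "continuous_on {0..2 * pi} (\<lambda>t. H (t, \<sigma>) - H (t, \<sigma>\<^sub>0))"
          using cont[OF \<sigma>] cont[OF \<sigma>\<^sub>0] by (intro continuous_on_diff) (auto intro: continuous_on_subset)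
      qed (use near in auto)
      also have "\<dots> < e" using e pi_gt_zero unfolding e'_def by (simp add: field_simps add_pos_pos)
      finally show ?thesis .
    qed
    then show "\<exists>U. openin (gtop \<Sigma>) U \<and> \<sigma>\<^sub>0 \<in> U \<and> (\<forall>y\<in>U. dist (f y) (f \<sigma>\<^sub>0) < e)" using TV(1,3) by blast
  qed
  have supp: "\<exists>t. circle_act \<Sigma> (cis t) \<sigma> \<in> W \<inter> K" if "\<sigma> \<in> arr \<Sigma>" "f \<sigma> \<noteq> 0" for \<sigma>
  proof (rule ccontr)
    assume "\<not> (\<exists>t. circle_act \<Sigma> (cis t) \<sigma> \<in> W \<inter> K)"
    then have "H (t, \<sigma>) = 0" for t using g(4)[of "circle_act \<Sigma> (cis t) \<sigma>"] that(1) unfolding H_def by auto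
    then show False using that by (simp add: f_def)
  qed
  have "f \<in> Cc \<Sigma>"
  proof (rule CcI[OF cf _ eq])
    show "compactin (gtop \<Sigma>) (?A ` (sphere 0 1 \<times> K))"
      by (rule image_compactin[OF _ continuous_circle_act]) (use g(5) in \<open>simp add: compactin_Times compactin_subtopology\<close>)
    fix \<sigma> assume \<sigma>: "\<sigma> \<in> arr \<Sigma>" "f \<sigma> \<noteq> 0"
    then obtain t where t: "circle_act \<Sigma> (cis t) \<sigma> \<in> K" using supp by blast
    have "\<sigma> = circle_act \<Sigma> (cis (- t)) (circle_act \<Sigma> (cis t) \<sigma>)" using \<sigma>(1) by (simp add: act_act cis_mult)
    then show "\<sigma> \<in> ?A ` (sphere 0 1 \<times> K)"
      using t by (intro image_eqI[of _ _ "(cis (- t), circle_act \<Sigma> (cis t) \<sigma>)"]) auto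
  qed (simp add: f_def)
  moreover have "f \<tau> \<noteq> 0"
  proof
    assume z: "f \<tau> = 0"
    \<comment> \<open>At \<tau> this is g at the rotated arrow times cos t. It is nonnegative
      because g vanishes at the rotations with cos t \<le> 0, and it equals 1 at t = 0, so its
      integral cannot be zero.\<close>
    let ?r = "\<lambda>t. Re (H (t, \<tau>))"
    have "integral {0..2 * pi} ?r = Re (f \<tau>)"
      using integral_linear[OF int[OF \<tau>(1)] bounded_linear_Re] \<tau>(1) by (simp add: f_def o_def)
    then have i0: "integral {0..2 * pi} ?r = 0" using z by simp
    have "continuous_on {0..2 * pi} ?r"
      using cont[OF \<tau>(1)] by (intro continuous_on_Re) (auto intro: continuous_on_subset)
    moreover have "?r t \<ge> 0" for t
    proof (cases "g (circle_act \<Sigma> (cis t) \<tau>) = 0")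
      case False
      then have "circle_act \<Sigma> (cis t) \<tau> \<in> W" using g(4)[of "circle_act \<Sigma> (cis t) \<tau>"] \<tau>(1) by auto
      then have "cis t \<notin> ?S" unfolding W_def by force
      then have "cos t > 0" by simp
      then show ?thesis using g(3)[of "circle_act \<Sigma> (cis t) \<tau>"] \<tau>(1) by (simp add: H_def)
    qed (simp add: H_def)
    ultimately have "\<forall>t\<in>{0..2 * pi}. ?r t = 0" using integral_eq_0_iff[of 0 "2 * pi" ?r] i0 by simp
    then have "?r 0 = 0" by simp
    then show False using g(2) \<tau>(1) by (simp add: H_def)
  qed
  moreover have "proj \<Sigma> \<sigma> \<in> B" if nz: "f \<sigma> \<noteq> 0" for \<sigma>
  proof -
    have \<sigma>: "\<sigma> \<in> arr \<Sigma>" using nz unfolding f_def by presburger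
    then obtain t where "circle_act \<Sigma> (cis t) \<sigma> \<in> W" using supp[OF \<sigma> nz] by blast
    then show ?thesis using \<sigma> unfolding W_def by simp
  qed
  ultimately show ?thesis by (rule that)
qed

end

section \<open>Double annihilators, intersections and elements of the diagonal\<close>

context etale_twist
begin

text \<open>The first annihilator is rewritten with an interior so that
  \<open>annihilator_supported_ideal\<close>, stated for open sets, applies a second time.\<close>

lemma annihilator_annihilator_supported_ideal:
  assumes W: "openin (gtop G) W" "invariant G W"
  shows "annihilator \<Sigma> G (annihilator \<Sigma> G (supported_ideal W)) =
    supported_ideal (unit_top G interior_of (unit_top G closure_of W))"
proof -
  let ?W' = "unit_top G interior_of (units G - W)"
  have "invariant G ?W'" by (rule invariant_interior[OF base.invariant_Compl[OF W(2)]])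
  moreover have "openin (gtop G) ?W'"
    using openin_interior_of[of "unit_top G"] openin_unit_top by blast
  moreover have "annihilator \<Sigma> G (supported_ideal W) = supported_ideal ?W'"
    unfolding annihilator_supported_ideal[OF W] by (rule supported_ideal_interior[symmetric]) blast
  ultimately have "annihilator \<Sigma> G (annihilator \<Sigma> G (supported_ideal W)) = supported_ideal (units G - ?W')"
    using annihilator_supported_ideal[of ?W'] by simp
  also have "units G - ?W' = unit_top G closure_of W"
    using closure_of_interior_of[of "unit_top G" W] by simp
  also have "supported_ideal \<dots> = supported_ideal (unit_top G interior_of (unit_top G closure_of W))"
    by (rule supported_ideal_interior[symmetric])
      (use closure_of_subset_topspace[of "unit_top G" W] in simp)
  finally show ?thesis .
qed

lemma regular_ideal_supported_ideal:
  assumes U: "open_invariant G U" "regular_open (unit_top G) U"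
  shows "regular_ideal \<Sigma> G (supported_ideal U)"
proof -
  have "openin (gtop G) U" "invariant G U" using U(1) unfolding open_invariant_def openin_unit_top by auto
  then show ?thesis
    unfolding regular_ideal_def
    using closed_ideal_supported_ideal annihilator_annihilator_supported_ideal U(2) unfolding regular_open_def by metis
qed

lemma annihilator_antimono: "X \<subseteq> Y \<Longrightarrow> annihilator \<Sigma> G Y \<subseteq> annihilator \<Sigma> G X"
  unfolding annihilator_def by blast

lemma subset_annihilator_annihilator: "X \<subseteq> Cr \<Sigma> G \<Longrightarrow> X \<subseteq> annihilator \<Sigma> G (annihilator \<Sigma> G X)"
  unfolding annihilator_def by blast

text \<open>The double annihilator is monotone, so that of the intersection lies in both ideals; the
  other inclusion holds for every subset of the algebra.\<close>

lemma regular_ideal_Int: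
  assumes I: "regular_ideal \<Sigma> G I" and J: "regular_ideal \<Sigma> G J"
  shows "regular_ideal \<Sigma> G (I \<inter> J)"
proof -
  have cI: "closed_ideal \<Sigma> G I" and cJ: "closed_ideal \<Sigma> G J"
    and aI: "I = annihilator \<Sigma> G (annihilator \<Sigma> G I)" and aJ: "J = annihilator \<Sigma> G (annihilator \<Sigma> G J)"
    using I J unfolding regular_ideal_def by auto
  have "norm_closure \<Sigma> G (Cr \<Sigma> G) (I \<inter> J) \<subseteq> norm_closure \<Sigma> G (Cr \<Sigma> G) I \<inter> norm_closure \<Sigma> G (Cr \<Sigma> G) J"
    unfolding norm_closure_def by blast
  then have "closed_ideal \<Sigma> G (I \<inter> J)" using cI cJ unfolding closed_ideal_def by blast
  moreover have "annihilator \<Sigma> G (annihilator \<Sigma> G (I \<inter> J)) \<subseteq> I \<inter> J"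
    using annihilator_antimono[OF annihilator_antimono[of "I \<inter> J" I]]
      annihilator_antimono[OF annihilator_antimono[of "I \<inter> J" J]] aI aJ by blast
  moreover have "I \<inter> J \<subseteq> Cr \<Sigma> G" using cI unfolding closed_ideal_def by blast
  ultimately show ?thesis
    unfolding regular_ideal_def using subset_annihilator_annihilator[of "I \<inter> J"] by blast
qed

lemma fam_mult_zero [simp]: "fam_mult 0 b = 0"
  by (rule ext) (simp add: fam_mult_zero_left)

lemma fam_mult_assoc: "fam_mult (fam_mult a b) c = fam_mult a (fam_mult b c)"
  by (simp add: fam_mult_def o_assoc)

lemma annihilator_mult_right:
  assumes J: "closed_ideal \<Sigma> G J" and k: "k \<in> annihilator \<Sigma> G J" and b: "b \<in> Cr \<Sigma> G"
  shows "fam_mult k b \<in> annihilator \<Sigma> G J"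
proof -
  have kC: "k \<in> Cr \<Sigma> G" and z: "\<And>x. x \<in> J \<Longrightarrow> fam_mult k x = 0 \<and> fam_mult x k = 0"
    using k unfolding annihilator_def by auto
  have "fam_mult b x \<in> J" if "x \<in> J" for x using J b that unfolding closed_ideal_def by blast
  then have "fam_mult (fam_mult k b) x = 0 \<and> fam_mult x (fam_mult k b) = 0" if "x \<in> J" for x
    using z that by (simp add: fam_mult_assoc flip: fam_mult_assoc[of x k b])
  then show ?thesis unfolding annihilator_def using Cr_mult[OF kC b] by blast
qed

text \<open>Diagonal functions vanish off the arrows over units, and evaluation is norm
  continuous.\<close>

lemma C0_units_func_of:
  assumes c: "c \<in> C0_units \<Sigma> G" and \<sigma>: "\<sigma> \<in> arr \<Sigma>" "proj \<Sigma> \<sigma> \<notin> units G"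
  shows "func_of c \<sigma> = 0"
proof -
  let ?D = "reg_rep \<Sigma> G ` diag_fun \<Sigma> G ` {h. compactly_supported (unit_top G) h}"
  have D: "?D \<subseteq> op_families \<Sigma> G" using compactly_supported_diag_fun_Cc reg_rep_op_families by blast
  have Cr: "Cr \<Sigma> G \<subseteq> op_families \<Sigma> G" using Cr_op_families by blast
  have cC: "c \<in> Cr \<Sigma> G" and ap: "\<And>e. e > 0 \<Longrightarrow> \<exists>b\<in>?D. bounded_by e (c - b)"
    using c norm_closure_iff[OF Cr D, of c] unfolding C0_units_def by auto
  have "cmod (func_of c \<sigma>) \<le> 0 + e" if e: "e > 0" for e
  proof -
    obtain b where b: "b \<in> ?D" "bounded_by e (c - b)" using ap[OF e] by blast
    then obtain h where h: "compactly_supported (unit_top G) h" "b = reg_rep \<Sigma> G (diag_fun \<Sigma> G h)" by blast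
    have "func_of b \<sigma> = 0"
      using func_of_reg_rep[OF compactly_supported_diag_fun_Cc[OF h(1)] \<sigma>(1)] h(2) \<sigma>(2)
      by (simp add: diag_fun_outside)
    moreover have "b \<in> op_families \<Sigma> G" using D b(1) by blast
    ultimately show ?thesis
      using func_of_bound[OF op_families_linear[OF Cr_op_families[OF cC]] op_families_linear b(2) _ \<sigma>(1)] e
      by simp
  qed
  then have "cmod (func_of c \<sigma>) \<le> 0" by (rule field_le_epsilon)
  then show ?thesis by simp
qed

lemma C0_units_subset_Cr: "C0_units \<Sigma> G \<subseteq> Cr \<Sigma> G"
  unfolding C0_units_def norm_closure_def by blast

text \<open>With 0 present, an intersection different from {0} contains a nonzero element; this is
  how the intersection property is read.\<close>

lemma zero_in_C0_units: "0 \<in> C0_units \<Sigma> G"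
proof -
  have "compactly_supported (unit_top G) (\<lambda>_. 0)" unfolding compactly_supported_def by simp
  moreover have "diag_fun \<Sigma> G (\<lambda>_. 0) = 0"
    by (rule ext) (simp add: diag_fun_def split: prod.split)
  ultimately have "reg_rep \<Sigma> G 0 \<in> reg_rep \<Sigma> G ` diag_fun \<Sigma> G ` {h. compactly_supported (unit_top G) h}"
    by (metis (mono_tags, lifting) imageI mem_Collect_eq)
  then have "0 \<in> reg_rep \<Sigma> G ` diag_fun \<Sigma> G ` {h. compactly_supported (unit_top G) h}"
    unfolding reg_rep_zero .
  moreover have "fam_norm \<Sigma> G (0 - 0) = 0"
    using fam_norm_le_iff[OF linear_family_zero, of 0] bounded_by_zero by simp
  ultimately show ?thesis unfolding C0_units_def norm_closure_def using Cr_zero by force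
qed

text \<open>An arrow starting at a unit x and lying over a unit lies over x, so
  \<open>C0_units_func_of\<close> leaves only the orbit of u: the point mass at u is an
  eigenvector.\<close>

lemma C0_units_delta:
  assumes c: "c \<in> C0_units \<Sigma> G" and u: "u \<in> units \<Sigma>"
  shows "c (proj \<Sigma> u) (delta u) = (\<lambda>\<rho>. func_of c u * delta u \<rho>)"
proof
  let ?x = "proj \<Sigma> u"
  have cC: "c \<in> Cr \<Sigma> G" using c C0_units_subset_Cr by blast
  have ua: "u \<in> arr \<Sigma>" and uf: "u \<in> src_fibre \<Sigma> ?x" and ux: "?x \<in> units G"
    using u by (auto simp: src_fibre_iff)
  have t: "twisted_fun ?x (c ?x (delta u))"
    using Hx_twisted[OF op_families_Hx[OF Cr_op_families[OF cC] ux]] .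
  fix \<rho>
  show "c ?x (delta u) \<rho> = func_of c u * delta u \<rho>"
  proof (cases "\<rho> \<in> src_fibre \<Sigma> ?x")
    case True
    then have \<rho>: "\<rho> \<in> arr \<Sigma>" "src G (proj \<Sigma> \<rho>) = ?x" "src \<Sigma> \<rho> = u"
      using u ux src_eq_src_iff[of \<rho> u] by (auto simp: src_fibre_iff)
    show ?thesis
    proof (cases "proj \<Sigma> \<rho> = ?x")
      case eq: True
      then obtain z where z: "cmod z = 1" "\<rho> = circle_act \<Sigma> z u" using proj_eqE[OF ua \<rho>(1)] by metis
      have "c ?x (delta u) \<rho> = z * c ?x (delta u) u" using t uf z unfolding twisted_fun_def by simp
      also have "c ?x (delta u) u = func_of c u" using u by (simp add: func_of_def)
      finally show ?thesis using z ua by simp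
    next
      case False
      then have "proj \<Sigma> \<rho> \<notin> units G" using \<rho> base.unit_src by metis
      then have "func_of c \<rho> = 0" using C0_units_func_of[OF c \<rho>(1)] by simp
      then have "c ?x (delta u) \<rho> = 0" using \<rho>(3) by (simp add: func_of_def)
      then show ?thesis using False by (simp add: delta_eq_0)
    qed
  next
    case False
    then show ?thesis using t twisted_fun_delta[OF uf] unfolding twisted_fun_def by simp
  qed
qed

text \<open>P is the image under the open map \<open>proj\<close> of the set where the function of c
  is nonzero. Its openness allows a point in the closure of a set to be moved into that set.\<close>

lemma C0_units_support:
  assumes c: "c \<in> C0_units \<Sigma> G" "c \<noteq> 0"
  obtains P where "openin (unit_top G) P" "P \<noteq> {}"
    "\<And>x. x \<in> P \<Longrightarrow> \<exists>u\<in>units \<Sigma>. proj \<Sigma> u = x \<and> func_of c u \<noteq> 0"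
proof -
  have cC: "c \<in> Cr \<Sigma> G" using c C0_units_subset_Cr by blast
  define P where "P = proj \<Sigma> ` {\<sigma> \<in> arr \<Sigma>. func_of c \<sigma> \<noteq> 0}"
  have sub: "P \<subseteq> units G" using C0_units_func_of[OF c(1)] unfolding P_def by blast
  have "openin (gtop \<Sigma>) {\<sigma> \<in> arr \<Sigma>. func_of c \<sigma> \<in> - {0}}"
    by (rule openin_continuous_map_preimage[OF continuous_func_of[OF cC]]) auto
  then have "openin (gtop G) P" using open_map_proj unfolding P_def open_map_def by simp
  then have op: "openin (unit_top G) P" using sub openin_unit_top by blast
  have "P \<noteq> {}"
  proof
    assume "P = {}"
    then have z: "func_of c \<sigma> = 0" if "\<sigma> \<in> arr \<Sigma>" for \<sigma> using that unfolding P_def by blast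
    have "c x = 0" for x
      unfolding Cr_eq_0_iff[OF cC] by (auto intro!: z simp: src_fibre_iff src_eq_src_iff)
    then have "c = 0" by (simp add: fun_eq_iff)
    then show False using c(2) by simp
  qed
  moreover have "\<exists>u\<in>units \<Sigma>. proj \<Sigma> u = x \<and> func_of c u \<noteq> 0" if x: "x \<in> P" for x
  proof -
    obtain \<sigma> where \<sigma>: "\<sigma> \<in> arr \<Sigma>" "proj \<Sigma> \<sigma> = x" "func_of c \<sigma> \<noteq> 0" using x unfolding P_def by blast
    let ?u = "src \<Sigma> \<sigma>"
    have u: "?u \<in> units \<Sigma>" "proj \<Sigma> ?u = x" using \<sigma> sub x src_proj[OF \<sigma>(1)] by auto
    \<comment> \<open>The value at \<sigma> is a multiple of the value at the unit
      \<open>?u\<close>, which therefore cannot vanish.\<close>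
    have "func_of c \<sigma> = func_of c ?u * delta ?u \<sigma>"
      using fun_cong[OF C0_units_delta[OF c(1) u(1)], of \<sigma>] by (simp add: func_of_def)
    then have "func_of c ?u \<noteq> 0" using \<sigma>(3) by auto
    then show ?thesis using u by blast
  qed
  ultimately show ?thesis using that[of P] op by blast
qed

text \<open>A function supported over a bisection through \<tau> and nonzero at \<tau> sends the
  point mass at u to a nonzero multiple of the one at \<tau>. So k kills every point mass of the
  fibre.\<close>

lemma right_multiples_vanish:
  assumes k: "k \<in> Cr \<Sigma> G" and u: "u \<in> units \<Sigma>"
    and z: "\<And>f. f \<in> Cc \<Sigma> \<Longrightarrow> fam_mult k (reg_rep \<Sigma> G f) (proj \<Sigma> u) (delta u) = 0"
  shows "k (proj \<Sigma> u) = 0"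
proof -
  let ?x = "proj \<Sigma> u"
  have ua: "u \<in> arr \<Sigma>" and uf: "u \<in> src_fibre \<Sigma> ?x" and ux: "?x \<in> units G"
    using u by (auto simp: src_fibre_iff)
  have "k ?x (delta \<tau>) = 0" if \<tau>: "\<tau> \<in> src_fibre \<Sigma> ?x" for \<tau>
  proof -
    have ta: "\<tau> \<in> arr \<Sigma>" "src G (proj \<Sigma> \<tau>) = ?x" using \<tau> by (auto simp: src_fibre_iff)
    obtain B where B: "open_bisection G B" "proj \<Sigma> \<tau> \<in> B"
      by (rule ex_bisection[OF openin_topspace proj_arr[OF ta(1)]])
    obtain f where f: "f \<in> Cc \<Sigma>" "f \<tau> \<noteq> 0" "\<And>\<sigma>. f \<sigma> \<noteq> 0 \<Longrightarrow> proj \<Sigma> \<sigma> \<in> B"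
      using ex_Cc_over_open[OF bisectionD(1)[OF B(1)] ta(1) B(2)] by blast
    have "reg_rep \<Sigma> G f ?x (delta u) = (\<lambda>\<rho>. f \<tau> * delta \<tau> \<rho>)"
    proof
      fix \<rho>
      show "reg_rep \<Sigma> G f ?x (delta u) \<rho> = f \<tau> * delta \<tau> \<rho>"
      proof (cases "\<rho> \<in> src_fibre \<Sigma> ?x")
        case True
        then have \<rho>: "\<rho> \<in> arr \<Sigma>" "src G (proj \<Sigma> \<rho>) = ?x" "src \<Sigma> \<rho> = u"
          using u ux src_eq_src_iff[of \<rho> u] by (auto simp: src_fibre_iff)
        have L: "reg_rep \<Sigma> G f ?x (delta u) \<rho> = f \<rho>"
          using reg_rep_delta_eq[OF f(1) uf] True \<rho>(1) u ext.gmul_src_id[OF \<rho>(1)] \<rho>(3) by simp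
        show ?thesis
        proof (cases "proj \<Sigma> \<rho> = proj \<Sigma> \<tau>")
          case eq: True
          then obtain w where w: "cmod w = 1" "\<rho> = circle_act \<Sigma> w \<tau>" using proj_eqE[OF ta(1) \<rho>(1)] by metis
          then show ?thesis unfolding L using equivariantD[OF Cc_equivariant[OF f(1)] ta(1) w(1)] ta(1) by simp
        next
          case False
          \<comment> \<open>Arrows of a bisection with the same source coincide, so \<open>f\<close>
            vanishes at every arrow of this fibre outside the orbit of \<tau>.\<close>
          then have "proj \<Sigma> \<rho> \<notin> B" using inj_onD[OF bisectionD(4)[OF B(1)], of "proj \<Sigma> \<rho>" "proj \<Sigma> \<tau>"] B(2) \<rho> ta by auto
          then have "f \<rho> = 0" using f(3) by blast
          then show ?thesis unfolding L using False by (simp add: delta_eq_0)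
        qed
      next
        case False
        then show ?thesis
          using twisted_fun_delta[OF \<tau>] reg_rep_delta_eq[OF f(1) uf] unfolding twisted_fun_def by simp
      qed
    qed
    then have "k ?x (\<lambda>\<rho>. f \<tau> * delta \<tau> \<rho>) = 0" using z[OF f(1)] by (simp add: fam_mult_def)
    then have "(\<lambda>\<rho>. f \<tau> * k ?x (delta \<tau>) \<rho>) = 0"
      using linear_opD(3)[OF op_families_linear_op[OF Cr_op_families[OF k] ux] delta_Hx(1)[OF \<tau>]] by simp
    then show ?thesis using f(2) by (auto simp: fun_eq_iff)
  qed
  then show ?thesis using linear_op_ext[OF Cr_op_families[OF k] op_families_zero, of ?x] by simp
qed

lemma regular_ideal_is_supported_ideal:
  assumes J: "regular_ideal \<Sigma> G J"
    and riip: "regular_ideal_intersection_property \<Sigma> G (C0_units \<Sigma> G)"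
  obtains V where "open_invariant G V" "regular_open (unit_top G) V" "J = supported_ideal V"
proof -
  let ?X = "unit_top G"
  define K where "K = annihilator \<Sigma> G J"
  define W where "W = (\<Union>k\<in>K. {x. k x \<noteq> 0})"
  have cJ: "closed_ideal \<Sigma> G J" and JK: "J = annihilator \<Sigma> G K"
    using J unfolding regular_ideal_def K_def by auto
  have JC: "J \<subseteq> Cr \<Sigma> G" using cJ unfolding closed_ideal_def by blast
  have KC: "K \<subseteq> Cr \<Sigma> G" unfolding K_def annihilator_def by blast
  have oW: "openin (gtop G) W" unfolding W_def using KC openin_Cr_support by (intro openin_Union) auto
  have iW: "invariant G W"
    using invariant_Cr_support KC unfolding W_def invariant_def by blast
  have Wu: "W \<subseteq> units G" using iW unfolding invariant_def by blast
  let ?V = "?X interior_of (units G - W)"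
  \<comment> \<open>The interior of a closed set is always regular open.\<close>
  have "closedin ?X (units G - W)"
    using closedin_diff[OF closedin_topspace, of ?X W] oW Wu by (simp add: openin_unit_top)
  then have "?X closure_of ?V \<subseteq> units G - W"
    by (intro closure_of_minimal interior_of_subset)
  then have "?X interior_of (?X closure_of ?V) \<subseteq> ?V" by (rule interior_of_mono)
  moreover have "?V \<subseteq> ?X interior_of (?X closure_of ?V)"
    by (intro interior_of_maximal closure_of_subset) (use openin_subset[of ?X ?V] in auto)
  ultimately have "?V = ?X interior_of (?X closure_of ?V)" by (rule subset_antisym[rotated])
  then have regV: "regular_open ?X ?V" unfolding regular_open_def using openin_interior_of by blast
  have invV: "open_invariant G ?V"
    unfolding open_invariant_def using openin_interior_of invariant_interior[OF base.invariant_Compl[OF iW]] by blast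
  have sV: "supported_ideal ?V = supported_ideal (units G - W)" by (rule supported_ideal_interior) blast
  have "supported_ideal (units G - W) \<subseteq> J"
  proof
    fix a assume a: "a \<in> supported_ideal (units G - W)"
    have "fam_mult a k = 0 \<and> fam_mult k a = 0" if "k \<in> K" for k
    proof -
      have "k \<in> supported_ideal W" using that KC unfolding supported_ideal_def W_def by blast
      then show ?thesis using supported_ideal_mult_zero[OF a] supported_ideal_mult_zero[OF _ a] by blast
    qed
    then show "a \<in> J" unfolding JK annihilator_def using a unfolding supported_ideal_def by blast
  qed
  moreover have "J \<subseteq> supported_ideal (units G - W)"
  proof
    fix a assume a: "a \<in> J"
    then have aC: "a \<in> Cr \<Sigma> G" using JC by blast
    have "x \<notin> W" if x: "a x \<noteq> 0" for x
    proof
      assume "x \<in> W"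
      then obtain b where b: "b \<in> supported_ideal W" "fam_mult b a \<noteq> 0"
        using diag_bump_mult[OF oW iW aC x] by blast
      let ?D = "?X interior_of (?X closure_of W)"
      have bC: "b \<in> Cr \<Sigma> G" using b(1) unfolding supported_ideal_def by blast
      \<comment> \<open>The nonzero product lies in both ideals, which shows that their intersection
        is nonzero.\<close>
      have "fam_mult b a \<in> J" using cJ a bC unfolding closed_ideal_def by blast
      moreover have "fam_mult b a \<in> supported_ideal W"
        using closed_ideal_supported_ideal b(1) aC unfolding closed_ideal_def by blast
      moreover have WD: "W \<subseteq> ?D"
        using oW Wu by (intro interior_of_maximal closure_of_subset) (auto simp: openin_unit_top)
      ultimately have ne: "J \<inter> supported_ideal ?D \<noteq> {0}" using b(2) supported_ideal_mono[OF WD] by blast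
      \<comment> \<open>As the complement of the invariant set \<open>?V\<close> the closure of
        \<open>W\<close> is invariant, and so is its interior.\<close>
      have clW: "?X closure_of W = units G - ?V" using closure_of_interior_of[of ?X W] by simp
      have "open_invariant G ?D"
        unfolding open_invariant_def clW
        using openin_interior_of invariant_interior[OF base.invariant_Compl] invV
        unfolding open_invariant_def by blast
      moreover have "regular_open ?X ?D"
      proof -
        have "?X closure_of ?D = ?X closure_of W"
          using closure_of_mono[OF interior_of_subset[of ?X "?X closure_of W"], of ?X]
            closure_of_mono[OF WD, of ?X] by simp
        then show ?thesis unfolding regular_open_def by simp
      qed
      ultimately have "regular_ideal \<Sigma> G (J \<inter> supported_ideal ?D)"
        by (intro regular_ideal_Int[OF J] regular_ideal_supported_ideal)
      then have "J \<inter> supported_ideal ?D \<inter> C0_units \<Sigma> G \<noteq> {0}"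
        using riip ne unfolding regular_ideal_intersection_property_def by blast
      moreover have "0 \<in> J \<inter> supported_ideal ?D \<inter> C0_units \<Sigma> G"
        using cJ closed_ideal_supported_ideal zero_in_C0_units unfolding closed_ideal_def by blast
      ultimately obtain c where c: "c \<in> J" "c \<in> supported_ideal ?D" "c \<in> C0_units \<Sigma> G" "c \<noteq> 0" by blast
      obtain P where P: "openin ?X P" "P \<noteq> {}"
        "\<And>x. x \<in> P \<Longrightarrow> \<exists>u\<in>units \<Sigma>. proj \<Sigma> u = x \<and> func_of c u \<noteq> 0"
        using C0_units_support[OF c(3,4)] by blast
      obtain y where y: "y \<in> P" using P(2) by blast
      obtain v where v: "v \<in> units \<Sigma>" "proj \<Sigma> v = y" "func_of c v \<noteq> 0" using P(3)[OF y] by blast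
      have "c y \<noteq> 0" 
      proof
        assume "c y = 0"
        then have "func_of c v = 0" using v(1,2) by (simp add: func_of_def)
        then show False using v(3) by simp
      qed
      then have "y \<in> ?D" using c(2) unfolding supported_ideal_def by blast
      then have "y \<in> ?X closure_of W" using interior_of_subset by (rule rev_subsetD)
      \<comment> \<open>\<open>P\<close> is a neighbourhood of a point in the closure of
        \<open>W\<close>. The argument continues at a unit of \<open>W\<close>, where by
        construction some element of \<open>K\<close> is nonzero.\<close>
      then obtain w where w: "w \<in> W" "w \<in> P" using y P(1) unfolding in_closure_of by blast
      obtain u where u: "u \<in> units \<Sigma>" "proj \<Sigma> u = w" "func_of c u \<noteq> 0" using P(3)[OF w(2)] by blast
      have uf: "u \<in> src_fibre \<Sigma> w" and wu: "w \<in> units G" using u by (auto simp: src_fibre_iff)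
      have kill: "k w (delta u) = 0" if k: "k \<in> K" for k
      proof -
        have kC: "k \<in> Cr \<Sigma> G" using k KC by blast
        have "fam_mult k c = 0" using k c(1) unfolding K_def annihilator_def by blast
        then have "fam_mult k c w (delta u) = 0" by simp
        then have "k w (\<lambda>\<rho>. func_of c u * delta u \<rho>) = 0"
          using C0_units_delta[OF c(3) u(1)] u(2) by (simp add: fam_mult_def)
        then have "(\<lambda>\<rho>. func_of c u * k w (delta u) \<rho>) = 0"
          using linear_opD(3)[OF op_families_linear_op[OF Cr_op_families[OF kC] wu] delta_Hx(1)[OF uf]] by simp
        then show ?thesis using u(3) by (auto simp: fun_eq_iff)
      qed
      have "k w = 0" if k: "k \<in> K" for k
      proof -
        \<comment> \<open>\<open>K\<close> absorbs right factors, so \<open>kill\<close> applies to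
          the product as well as to \<open>k\<close>.\<close>
        have "fam_mult k (reg_rep \<Sigma> G f) (proj \<Sigma> u) (delta u) = 0" if "f \<in> Cc \<Sigma>" for f
          using kill annihilator_mult_right[OF cJ _ reg_rep_Cr[OF that]] k u(2) unfolding K_def by blast
        then show ?thesis using right_multiples_vanish[of k u] k KC u by blast
      qed
      then show False using w(1) unfolding W_def by blast
    qed
    then show "a \<in> supported_ideal (units G - W)"
      using aC op_families_outside[OF Cr_op_families[OF aC]] unfolding supported_ideal_def by blast
  qed
  ultimately show ?thesis using that[OF invV regV] sV by blast
qed

end

theorem theorem5p6:
  fixes G :: "'g groupoid" and \<Sigma> :: "('s, 'g) twist" and U :: "'g set"
  assumes "etale_groupoid G"
    and "is_twist \<Sigma> G"
    and "exact_groupoid \<Sigma> G"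
    and "open_invariant G U"
    and "regular_open (unit_top G) U"
  shows "regular_ideal \<Sigma> G (Cr_sub \<Sigma> G U) \<and>
    (regular_ideal_intersection_property \<Sigma> G (C0_units \<Sigma> G) \<longrightarrow>
      (\<forall>J. regular_ideal \<Sigma> G J \<longrightarrow>
        (\<exists>V. open_invariant G V \<and> regular_open (unit_top G) V \<and> J = Cr_sub \<Sigma> G V)))"
proof -
  interpret etale_twist G \<Sigma>
    using assms(1,2) by unfold_locales
  have sub: "Cr_sub \<Sigma> G V = supported_ideal V" if "open_invariant G V" for V
    using Cr_sub_eq_supported_ideal[OF assms(3) that] .
  show ?thesis
  proof (intro conjI impI allI)
    show "regular_ideal \<Sigma> G (Cr_sub \<Sigma> G U)"
      unfolding sub[OF assms(4)] by (rule regular_ideal_supported_ideal[OF assms(4,5)])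
  next
    fix J
    assume "regular_ideal_intersection_property \<Sigma> G (C0_units \<Sigma> G)" "regular_ideal \<Sigma> G J"
    then obtain V where V: "open_invariant G V" "regular_open (unit_top G) V" "J = supported_ideal V"
      using regular_ideal_is_supported_ideal by blast
    then show "\<exists>V. open_invariant G V \<and> regular_open (unit_top G) V \<and> J = Cr_sub \<Sigma> G V"
      using sub[OF V(1)] by blast
  qed
qed

end
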